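(* Let $I$ and $J$ be squarefree monomial ideals of $K[x_1,\dots,x_n]$ whose associated simplicial complexes have the same $f$-vector $\vec v$, with Betti numbers $s^I=(s^I_i)$ and $s^J=(s^J_i)$. Suppose that for some $k$: $s_0^I=s_0^J$, $s_1^I>s_1^J$, $s_k^I<s_k^J$, $s_{k+i}^I\le s_{k+i}^J$ for all positive integers $i$, and $\beta_{i,j}^I=0$ whenever $j-i$ is even and $j>0$. Then for each $f$-vector $\vec w$ in the tree created by $0$-coning and $\infty$-coning $\vec v$, with $H$ the Hilbert function associated to $\vec w$ and $R'$ the polynomial ring over $K$ in as many variables as $\vec w$ has entries, the partially ordered set of Betti numbers of all homogeneous ideals $L\subseteq R'$ such that $R'/L$ has Hilbert function $H$ does not have a unique minimum (i.e. it has no smallest element). The same remains true for the partially ordered set of Betti numbers of all squarefree monomial ideals $L\subseteq R'$ such that $R'/L$ has Hilbert function $H$.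
   Context: $K$ is a fixed field. For a homogeneous ideal $I$ in a polynomial ring $R$ over $K$, the Hilbert function of $R/I$ is $H(R/I,d)=\dim_K (R/I)_d$, and $\beta^I_{i,j}$ denotes the graded Betti numbers of $R/I$: the $i$-th module in the minimal graded free resolution of $R/I$ is $\bigoplus_j R(-j)^{\beta^I_{i,j}}$. The (ungraded) Betti numbers are $s^I_i=\sum_j\beta^I_{i,j}$. Betti numbers are partially ordered componentwise: $s^I\ge s^J$ iff $s^I_i\ge s^J_i$ for all $i$. A simplicial complex $\Delta$ on $n$ vertices is a collection of subsets (faces) of $\{1,\dots,n\}$ closed under taking subsets and containing every $\{v\}$. Its associated (Stanley–Reisner) ideal in $K[x_1,\dots,x_n]$ is generated by the squarefree monomials corresponding to the minimal non-faces; this gives a bijection between simplicial complexes and squarefree monomial ideals with no linear terms. The $f$-vector of $\Delta$ is $(f_0,\dots,f_{n-1})$, where $f_i$ is the number of faces of cardinality $i+1$. The $f$-vector of $\Delta$ determines (and is determined by) the Hilbert function of $R/I$, where $I$ is the associated ideal: $H(R/I,0)=1$ and $H(R/I,m)=\sum_{i=0}^{n-1} f_i\binom{m-1}{i}$ for $m>0$; this is the Hilbert function associated to the $f$-vector. For an integer $p\ge 0$, the $p$-cone $C_{(p)}\Delta$ of a complex $\Delta$ on $n$ vertices is the complex on $n+1$ vertices whose faces are the faces of $\Delta$ together with all sets $\sigma\cup\{n+1\}$ with $\sigma\in\Delta$ and $|\sigma|\le p$. (So the $0$-cone adds an isolated vertex.) The $\infty$-cone is $C_{(\infty)}\Delta=C_{(n)}\Delta$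 (the full cone). The $f$-vector of $C_{(p)}\Delta$ depends only on the $f$-vector of $\Delta$ and on $p$; it is called the $f$-vector obtained by $p$-coning the $f$-vector of $\Delta$. The tree created by $0$-coning and $\infty$-coning $\vec v$ is the collection of all $f$-vectors obtained from $\vec v$ by applying any finite (possibly empty) sequence of operations, each of which is either $0$-coning or $\infty$-coning. *)

theory Defs
  imports
    "HOL-Library.Poly_Mapping"
    "HOL-Algebra.Ideal"
    "Jordan_Normal_Form.Matrix"
begin

section \<open>Polynomial rings, forms and homogeneous ideals\<close>

type_synonym 'k mpoly = "(nat \<Rightarrow>\<^sub>0 nat) \<Rightarrow>\<^sub>0 'k"

text \<open>
  The variable \<open>x\<^sub>v\<close> of \<open>K[x\<^sub>1,\<dots>,x\<^sub>n]\<close> has index \<open>v \<in> {1..n}\<close>; the rings for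
  different \<open>n\<close> are nested subrings of one type.
\<close>

definition polyring :: "nat \<Rightarrow> 'k::field mpoly ring" where
  "polyring n = \<lparr>carrier = {p. \<forall>m\<in>Poly_Mapping.keys p. Poly_Mapping.keys m \<subseteq> {1..n}},
     monoid.mult = (*), one = 1, zero = 0, add = (+)\<rparr>"

definition mdeg :: "(nat \<Rightarrow>\<^sub>0 nat) \<Rightarrow> nat" where
  "mdeg m = (\<Sum>v\<in>Poly_Mapping.keys m. Poly_Mapping.lookup m v)"

definition forms :: "nat \<Rightarrow> nat \<Rightarrow> 'k::field mpoly set" where
  "forms n d = {p \<in> carrier (polyring n). \<forall>m\<in>Poly_Mapping.keys p. mdeg m = d}"

definition hcomponent :: "nat \<Rightarrow> 'k::field mpoly \<Rightarrow> 'k mpoly" where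
  "hcomponent d p =
     (\<Sum>m | m \<in> Poly_Mapping.keys p \<and> mdeg m = d.
        Poly_Mapping.single m (Poly_Mapping.lookup p m))"

definition homogeneous_ideal :: "nat \<Rightarrow> 'k::field mpoly set \<Rightarrow> bool" where
  "homogeneous_ideal n L \<longleftrightarrow>
     ideal L (polyring n) \<and> (\<forall>p\<in>L. \<forall>d. hcomponent d p \<in> L)"

definition sqfree_monomial :: "nat set \<Rightarrow> 'k::field mpoly" where
  "sqfree_monomial \<sigma> = Poly_Mapping.single (\<Sum>v\<in>\<sigma>. Poly_Mapping.single v 1) 1"

definition sqfree_monomial_ideal :: "nat \<Rightarrow> 'k::field mpoly set \<Rightarrow> bool" where
  "sqfree_monomial_ideal n L \<longleftrightarrow>
     (\<exists>S \<subseteq> Pow {1..n}. L = Idl\<^bsub>polyring n\<^esub> (sqfree_monomial ` S))"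


section \<open>Hilbert functions\<close>

text \<open>
  The residue classes of the finite set \<open>B\<close> of forms of degree \<open>d\<close> are a \<open>K\<close>-basis of
  \<open>(R/L)\<^sub>d\<close>: each class is a \<open>K\<close>-linear combination of them in exactly one way.
\<close>

definition residue_basis :: "nat \<Rightarrow> 'k::field mpoly set \<Rightarrow> nat \<Rightarrow> 'k mpoly set \<Rightarrow> bool" where
  "residue_basis n L d B \<longleftrightarrow>
     finite B \<and> B \<subseteq> forms n d \<and>
     (\<forall>p\<in>forms n d. \<exists>!c::'k mpoly \<Rightarrow> 'k. (\<forall>b. b \<notin> B \<longrightarrow> c b = 0) \<and>
        p - (\<Sum>b\<in>B. Poly_Mapping.single 0 (c b) * b) \<in> L)"

definition hilbert_function :: "nat \<Rightarrow> 'k::field mpoly set \<Rightarrow> nat \<Rightarrow> nat" where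
  "hilbert_function n L d = (THE h. \<exists>B. residue_basis n L d B \<and> card B = h)"


section \<open>Minimal graded free resolutions and Betti numbers\<close>

text \<open>
  A list \<open>ds\<close> of degrees encodes the graded free module \<open>\<Oplus>\<^sub>a R(-ds!a)\<close>, whose elements are the
  vectors of length \<open>length ds\<close> with entries in \<open>R\<close>.
\<close>

definition free_module :: "nat \<Rightarrow> nat list \<Rightarrow> 'k::field mpoly vec set" where
  "free_module n ds = {u \<in> carrier_vec (length ds). \<forall>a<length ds. u $ a \<in> carrier (polyring n)}"

text \<open>
  Degree-preserving maps from \<open>\<Oplus>\<^sub>b R(-es!b)\<close> to \<open>\<Oplus>\<^sub>a R(-ds!a)\<close>: the entry at \<open>(a, b)\<close> is a form
  of degree \<open>es!b - ds!a\<close>, and hence zero if this difference is negative.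
\<close>

definition graded_map ::
    "nat \<Rightarrow> nat list \<Rightarrow> nat list \<Rightarrow> 'k::field mpoly mat \<Rightarrow> bool" where
  "graded_map n es ds M \<longleftrightarrow>
     M \<in> carrier_mat (length ds) (length es) \<and>
     (\<forall>a<length ds. \<forall>b<length es. M $$ (a, b) \<in> carrier (polyring n) \<and>
        (\<forall>m\<in>Poly_Mapping.keys (M $$ (a, b)). mdeg m + ds ! a = es ! b))"

text \<open>
  \<open>\<cdots> \<rightarrow> F 2 \<rightarrow> F 1 \<rightarrow> F 0 \<rightarrow> R/L \<rightarrow> 0\<close> with differentials \<open>D i : F (i + 1) \<rightarrow> F i\<close>.  The
  augmentation sends the \<open>a\<close>-th basis vector of \<open>F 0\<close> to the residue class of \<open>g $ a\<close>.
  Minimality, i.e. the image of \<open>D i\<close> lies in \<open>(x\<^sub>1,\<dots>,x\<^sub>n) F i\<close>, says that no entry of \<open>D i\<close> has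
  a constant term.
\<close>

definition minimal_graded_free_resolution ::
    "nat \<Rightarrow> 'k::field mpoly set \<Rightarrow> (nat \<Rightarrow> nat list) \<Rightarrow> 'k mpoly vec \<Rightarrow>
     (nat \<Rightarrow> 'k mpoly mat) \<Rightarrow> bool" where
  "minimal_graded_free_resolution n L F g D \<longleftrightarrow>
     g \<in> carrier_vec (length (F 0)) \<and>
     (\<forall>a<length (F 0). g $ a \<in> forms n (F 0 ! a)) \<and>
     (\<forall>i. graded_map n (F (Suc i)) (F i) (D i)) \<and>
     (\<forall>p\<in>carrier (polyring n). \<exists>u\<in>free_module n (F 0). p - g \<bullet> u \<in> L) \<and>
     {u \<in> free_module n (F 0). g \<bullet> u \<in> L} =
       (\<lambda>u. D 0 *\<^sub>v u) ` free_module n (F 1) \<and>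
     (\<forall>i. {u \<in> free_module n (F (Suc i)). D i *\<^sub>v u = 0\<^sub>v (length (F i))} =
       (\<lambda>u. D (Suc i) *\<^sub>v u) ` free_module n (F (Suc (Suc i)))) \<and>
     (\<forall>i. \<forall>a<length (F i). \<forall>b<length (F (Suc i)). Poly_Mapping.lookup (D i $$ (a, b)) 0 = 0)"

text \<open>Both Betti numbers are those of \<open>R/L\<close>, not of the module \<open>L\<close>.\<close>

definition graded_betti :: "nat \<Rightarrow> 'k::field mpoly set \<Rightarrow> nat \<Rightarrow> nat \<Rightarrow> nat" where
  "graded_betti n L i j =
     (THE r. \<exists>F g D. minimal_graded_free_resolution n L F g D \<and> count_list (F i) j = r)"

definition betti :: "nat \<Rightarrow> 'k::field mpoly set \<Rightarrow> nat \<Rightarrow> nat" where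
  "betti n L i = (\<Sum>j | graded_betti n L i j \<noteq> 0. graded_betti n L i j)"


section \<open>Simplicial complexes\<close>

text \<open>The condition \<open>{} \<in> \<Delta>\<close> excludes the void complex on no vertices; for \<open>n > 0\<close> it is implied.\<close>

definition simplicial_complex :: "nat \<Rightarrow> nat set set \<Rightarrow> bool" where
  "simplicial_complex n \<Delta> \<longleftrightarrow>
     \<Delta> \<subseteq> Pow {1..n} \<and> {} \<in> \<Delta> \<and>
     (\<forall>\<sigma>\<in>\<Delta>. \<forall>\<tau>. \<tau> \<subseteq> \<sigma> \<longrightarrow> \<tau> \<in> \<Delta>) \<and> (\<forall>v\<in>{1..n}. {v} \<in> \<Delta>)"

definition minimal_nonfaces :: "nat \<Rightarrow> nat set set \<Rightarrow> nat set set" where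
  "minimal_nonfaces n \<Delta> = {\<sigma>. \<sigma> \<subseteq> {1..n} \<and> \<sigma> \<notin> \<Delta> \<and> (\<forall>\<tau>. \<tau> \<subset> \<sigma> \<longrightarrow> \<tau> \<in> \<Delta>)}"

definition stanley_reisner_ideal :: "nat \<Rightarrow> nat set set \<Rightarrow> 'k::field mpoly set" where
  "stanley_reisner_ideal n \<Delta> = Idl\<^bsub>polyring n\<^esub> (sqfree_monomial ` minimal_nonfaces n \<Delta>)"

text \<open>The \<open>f\<close>-vector always has \<open>n\<close> entries, including trailing zeros.\<close>

definition fvector :: "nat \<Rightarrow> nat set set \<Rightarrow> nat list" where
  "fvector n \<Delta> = map (\<lambda>i. card {\<sigma>\<in>\<Delta>. card \<sigma> = i + 1}) [0..<n]"

definition fvector_hilbert :: "nat list \<Rightarrow> nat \<Rightarrow> nat" where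
  "fvector_hilbert w m =
     (if m = 0 then 1 else (\<Sum>i<length w. w ! i * ((m - 1) choose i)))"

definition cone :: "nat \<Rightarrow> nat \<Rightarrow> nat set set \<Rightarrow> nat set set" where
  "cone n p \<Delta> = \<Delta> \<union> {insert (n + 1) \<sigma> | \<sigma>. \<sigma> \<in> \<Delta> \<and> card \<sigma> \<le> p}"

definition fvector_cone :: "nat \<Rightarrow> nat list \<Rightarrow> nat list \<Rightarrow> bool" where
  "fvector_cone p u w \<longleftrightarrow>
     (\<exists>\<Delta>. simplicial_complex (length u) \<Delta> \<and> fvector (length u) \<Delta> = u \<and>
        w = fvector (length u + 1) (cone (length u) p \<Delta>))"

text \<open>The \<open>\<infinity>\<close>-cone of a complex on \<open>n\<close> vertices is its \<open>n\<close>-cone.\<close>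

inductive_set cone_tree :: "nat list \<Rightarrow> nat list set" for v where
  root: "v \<in> cone_tree v"
| zero_cone: "u \<in> cone_tree v \<Longrightarrow> fvector_cone 0 u w \<Longrightarrow> w \<in> cone_tree v"
| full_cone: "u \<in> cone_tree v \<Longrightarrow> fvector_cone (length u) u w \<Longrightarrow> w \<in> cone_tree v"

end

theory Submission
  imports
    Defs
    "HOL-Library.Function_Algebras"
    "HOL-Computational_Algebra.Formal_Power_Series"
begin

text \<open>
  The alternating sums \<open>\<Sum>\<^sub>i (-1)\<^sup>i \<beta>\<^sub>i\<^sub>,\<^sub>j\<close> are the coefficients of the numerator of the Hilbert
      series, so they
  depend on the Hilbert function only.  If \<open>\<beta>\<^sup>I\<^sub>i\<^sub>,\<^sub>j = 0\<close> whenever \<open>j > 0\<close>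
      and \<open>j - i\<close> is even, there is no
  cancellation for \<open>I\<close>, and \<open>\<Sum>\<^sub>i \<beta>\<^sub>i\<^sub>,\<^sub>j\<close> is smallest
      for \<open>I\<close> among all ideals with the same Hilbert function.
  Hence Betti numbers that are \<open>\<le> s\<^sup>I\<close> are equal to \<open>s\<^sup>I\<close>, and \<open>s\<^sup>I\<^sub>1 > s\<^sup>J\<^sub>1\<close> excludes a minimum.

  Both properties of the pair \<open>(I, J)\<close> pass to cones.  The full cone has the same minimal
      resolution.  The
  zero cone adds \<open>n\<close> minimal generators,
      and it keeps the parity condition since the ideal \<open>I + x\<^sub>n\<^sub>+\<^sub>1 (x\<^sub>1,\<dots>,x\<^sub>n)\<close>
  is resolved by a mapping cone built from the resolution of \<open>I\<close> and the Koszul complex.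
\<close>

section \<open>Forms and graded free modules\<close>

text \<open>Betti numbers are given by a definite description, so existence and uniqueness of
  minimal resolutions have to be settled before anything is computed. The minimal resolution of a
  zero cone is not determined: the parity condition is a vanishing statement, and the minimal
  resolution has at most as many generators in each index and degree as any other. In the mapping
  cone, the copy of \<open>F i\<close> moves up by one both in index and in degree, which keeps
  \<open>j - i\<close>; the Koszul generators of index \<open>i\<close> have degree \<open>i\<close>
  and move up in degree only, so their difference becomes 1. The first Betti numbers, where an exact
  count matters, come from minimal nonfaces instead. The comparison of total sums requires a finite
  range of degrees: the numerator of the Hilbert series of an f-vector with \<open>n\<close> entries
  has degree at most \<open>n\<close>, and without cancellation this bounds the degrees of the
  generators for \<open>I\<close>.\<close>

abbreviation "keys \<equiv> Poly_Mapping.keys"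
abbreviation "lookup \<equiv> Poly_Mapping.lookup"
abbreviation "single \<equiv> Poly_Mapping.single"

lemma forms_iff:
  "p \<in> forms n e \<longleftrightarrow> (\<forall>m\<in>keys p. keys m \<subseteq> {1..n} \<and> mdeg m = e)"
  by (auto simp: forms_def polyring_def)

lemma keys_add_nat: "keys (m + m' :: 'a \<Rightarrow>\<^sub>0 nat) = keys m \<union> keys m'"
  by (auto simp: in_keys_iff lookup_add)

lemma mdeg_eq_sum: "finite A \<Longrightarrow> keys m \<subseteq> A \<Longrightarrow> mdeg m = (\<Sum>v\<in>A. lookup m v)"
  unfolding mdeg_def by (rule sum.mono_neutral_left) (auto simp: in_keys_iff)

lemma mdeg_add: "mdeg (m + m') = mdeg m + mdeg m'"
proof -
  let ?A = "keys m \<union> keys m'"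
  have "mdeg (m + m') = (\<Sum>v\<in>?A. lookup (m + m') v)"
    by (intro mdeg_eq_sum) (simp_all add: keys_add_nat)
  also have "\<dots> = (\<Sum>v\<in>?A. lookup m v) + (\<Sum>v\<in>?A. lookup m' v)"
    by (simp add: lookup_add sum.distrib)
  also have "\<dots> = mdeg m + mdeg m'"
    by (simp add: mdeg_eq_sum[symmetric])
  finally show ?thesis .
qed

lemma mdeg_0 [simp]: "mdeg 0 = 0"
  by (simp add: mdeg_def)

lemma mdeg_single [simp]: "mdeg (single v k) = k"
  by (simp add: mdeg_def)

lemma mdeg_eq_0_iff [simp]: "mdeg m = 0 \<longleftrightarrow> m = 0"
  by (auto simp: mdeg_def in_keys_iff poly_mapping_eq_iff fun_eq_iff)

text \<open>A sum of exponent vectors is 0 only if both are, so taking constant terms is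
  multiplicative. This is reduction modulo the variables, through which minimality is used.\<close>

lemma lookup_mult_0: "lookup (p * q :: 'k::field mpoly) 0 =
    lookup p 0 * lookup q 0"
proof -
  have *: "(0 :: nat \<Rightarrow>\<^sub>0 nat) = a + b \<longleftrightarrow> a = 0 \<and> b = 0" for a b
    by (auto simp: poly_mapping_eq_iff fun_eq_iff lookup_add)
  have "lookup (p * q) 0 =
      (\<Sum>a. lookup p a * (\<Sum>b. lookup q b when b = 0) when a = 0)"
    unfolding lookup_mult * by (rule Sum_any.cong) (auto simp: when_def)
  then show ?thesis by simp
qed

lemma keys_mult_mpoly: "m \<in> keys (p * q :: 'k::field mpoly) \<Longrightarrow>
    \<exists>a\<in>keys p. \<exists>b\<in>keys q. m = a + b"
  using keys_mult[of p q] by blast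

lemma lookup_single_mult: "lookup (single t c * p :: 'k::field mpoly) (t + m) =
    c * lookup p m"
proof -
  have "(\<Sum>l. lookup (single t c) l *
          (\<Sum>q. lookup p q when t + m = l + q))
     = (\<Sum>l. (c * (\<Sum>q. lookup p q when q = m)) when l = t)"
    by (rule Sum_any.cong) (auto simp: lookup_single when_def intro!: Sum_any.cong)
  then show ?thesis unfolding lookup_mult by simp
qed

lemma lookup_single_mult_not:
  assumes "\<And>m'. m \<noteq> t + m'"
  shows "lookup (single t c * p :: 'k::field mpoly) m = 0"
proof -
  have "m \<notin> keys (single t c * p)"
    using assms keys_mult_mpoly[of m "single t c" p] by (auto split: if_splits)
  then show ?thesis by (simp add: in_keys_iff)
qed

section \<open>Homogeneous forms and homogeneous components\<close>

lemma forms_0 [simp]: "0 \<in> forms n e"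
  by (simp add: forms_iff)

lemma forms_add: "p \<in> forms n e \<Longrightarrow> q \<in> forms n e \<Longrightarrow> p + q \<in> forms n e"
  using keys_add[of p q] by (fastforce simp: forms_iff)

lemma forms_uminus: "p \<in> forms n e \<Longrightarrow> - p \<in> forms n e"
  by (simp add: forms_iff)

lemma forms_diff: "p \<in> forms n e \<Longrightarrow> q \<in> forms n e \<Longrightarrow> p - q \<in> forms n e"
  using forms_add[of p n e "- q"] forms_uminus[of q n e] by simp

lemma forms_sum: "(\<And>i. i \<in> A \<Longrightarrow> f i \<in> forms n e) \<Longrightarrow> sum f A \<in> forms n e"
  by (induction A rule: infinite_finite_induct) (auto intro: forms_add)

lemma forms_mult: "p \<in> forms n e \<Longrightarrow> q \<in> forms n e' \<Longrightarrow> p * q \<in> forms n (e + e')"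
  by (fastforce simp: forms_iff mdeg_add keys_add_nat dest: keys_mult_mpoly)

lemma forms_const [simp]: "single 0 c \<in> forms n 0"
  by (simp add: forms_iff)

lemma forms_1 [simp]: "1 \<in> forms n 0"
  by (simp add: forms_iff)

lemma forms_single: "keys m \<subseteq> {1..n} \<Longrightarrow> single m c \<in> forms n (mdeg m)"
  by (simp add: forms_iff)

lemma forms_zero_const: "p \<in> forms n 0 \<Longrightarrow> p = single 0 (lookup p 0)"
proof (rule poly_mapping_eqI)
  fix m assume p: "p \<in> forms n 0"
  show "lookup p m = lookup (single 0 (lookup p 0)) m"
  proof (cases "m = 0")
    case False
    with p have "m \<notin> keys p" by (auto simp: forms_iff)
    with False show ?thesis by (simp add: lookup_single when_def in_keys_iff)
  qed simp
qed

lemma forms_mono: "n \<le> n' \<Longrightarrow> p \<in> forms n e \<Longrightarrow> p \<in> forms n' e"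
  by (fastforce simp: forms_iff)

lemma poly_mapping_sum_single: "finite A \<Longrightarrow> keys p \<subseteq> A \<Longrightarrow>
    p = (\<Sum>m\<in>A. single m (lookup p m))"
  by (rule poly_mapping_eqI) (auto simp: lookup_sum lookup_single when_def in_keys_iff)

lemma lookup_hcomponent: "lookup (hcomponent d p) m =
    (if mdeg m = d then lookup p m else 0)"
  unfolding hcomponent_def by (auto simp: lookup_sum lookup_single when_def in_keys_iff)

lemma hcomponent_0 [simp]: "hcomponent d 0 = 0"
  by (rule poly_mapping_eqI) (simp add: lookup_hcomponent)

lemma hcomponent_diff: "hcomponent d (p - q) = hcomponent d p - hcomponent d q"
  by (rule poly_mapping_eqI) (simp add: lookup_hcomponent lookup_minus)

lemma hcomponent_sum: "hcomponent d (sum f A) = (\<Sum>i\<in>A. hcomponent d (f i))"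
  by (rule poly_mapping_eqI) (simp add: lookup_hcomponent lookup_sum)

lemma hcomponent_forms: "p \<in> forms n e \<Longrightarrow> hcomponent d p = (if d = e then p else 0)"
  by (rule poly_mapping_eqI) (fastforce simp: forms_iff in_keys_iff lookup_hcomponent)

lemma hcomponent_in_forms: "p \<in> carrier (polyring n) \<Longrightarrow> hcomponent d p \<in> forms n d"
  by (auto simp: forms_iff polyring_def in_keys_iff lookup_hcomponent split: if_splits)

lemma sum_hcomponent:
  assumes "\<And>m. m \<in> keys p \<Longrightarrow> mdeg m \<le> N"
  shows "(\<Sum>d\<le>N. hcomponent d p) = p"
proof (rule poly_mapping_eqI)
  fix m
  show "lookup (\<Sum>d\<le>N. hcomponent d p) m = lookup p m"
    using assms[of m] by (cases "lookup p m = 0") (auto simp: lookup_sum lookup_hcomponent in_keys_iff)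
qed

lemma ex_degree_bound: "\<exists>N. \<forall>m\<in>keys (p :: 'k::field mpoly). mdeg m \<le> N"
  by (rule exI[of _ "\<Sum>m\<in>keys p. mdeg m"]) (auto intro: member_le_sum)

text \<open>
  Vectors are total functions, so that they form an abelian group type; entries beyond the rank are
      zero, and
  linear maps are defined on all of them.
\<close>

type_synonym 'k pvec = "nat \<Rightarrow> 'k mpoly"

definition pscale :: "'k::field mpoly \<Rightarrow> 'k pvec \<Rightarrow> 'k pvec" (infixr \<open>*\<^sub>p\<close> 75) where
  "p *\<^sub>p u = (\<lambda>a. p * u a)"

definition bvec :: "nat \<Rightarrow> 'k::field pvec" where
  "bvec b = (\<lambda>a. if a = b then 1 else 0)"

text \<open>The degree \<open>e\<close> strand of the free module. Since
  \<open>a < length ds\<close> is demanded for each monomial, entries beyond the rank vanish, and so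
  do entries whose generator degree exceeds \<open>e\<close>.\<close>

definition gvec :: "nat \<Rightarrow> nat list \<Rightarrow> nat \<Rightarrow> 'k::field pvec set" where
  "gvec n ds e = {u. \<forall>a. \<forall>m\<in>keys (u a).
     a < length ds \<and> keys m \<subseteq> {1..n} \<and> mdeg m + ds ! a = e}"

definition plinear :: "('k::field pvec \<Rightarrow> 'k pvec) \<Rightarrow> bool" where
  "plinear f \<longleftrightarrow> (\<forall>u v. f (u + v) = f u + f v) \<and> (\<forall>p u. f (p *\<^sub>p u) = p *\<^sub>p f u)"

text \<open>Linearity is imposed on all vectors of the type, so composites and differences carry no
  side conditions; only the degree condition refers to the graded modules.\<close>

definition glin :: "nat \<Rightarrow> nat list \<Rightarrow> nat list \<Rightarrow> ('k::field pvec \<Rightarrow> 'k pvec) \<Rightarrow> bool" where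
  "glin n es ds f \<longleftrightarrow> plinear f \<and> (\<forall>e. \<forall>u\<in>gvec n es e. f u \<in> gvec n ds e)"

definition lin :: "nat \<Rightarrow> (nat \<Rightarrow> 'k::field pvec) \<Rightarrow> 'k pvec \<Rightarrow> 'k pvec" where
  "lin k c u = (\<Sum>b<k. u b *\<^sub>p c b)"

lemma sum_fun_apply: "(sum f A) a = (\<Sum>i\<in>A. f i a)"
  by (induction A rule: infinite_finite_induct) auto

lemma pscale_apply [simp]: "(p *\<^sub>p u) a = p * u a"
  by (simp add: pscale_def)

lemma pscale_simps [simp]:
  "p *\<^sub>p 0 = 0" "0 *\<^sub>p u = 0" "1 *\<^sub>p u = u" "(- p) *\<^sub>p u = - (p *\<^sub>p u)" "p *\<^sub>p (- u) = - (p *\<^sub>p u)"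
  by (auto simp: fun_eq_iff)

lemma pscale_add_right: "p *\<^sub>p (u + v) = p *\<^sub>p u + p *\<^sub>p v"
  and pscale_add_left: "(p + q) *\<^sub>p u = p *\<^sub>p u + q *\<^sub>p u"
  and pscale_diff_right: "p *\<^sub>p (u - v) = p *\<^sub>p u - p *\<^sub>p v"
  and pscale_pscale: "p *\<^sub>p q *\<^sub>p u = (p * q) *\<^sub>p u"
  by (auto simp: fun_eq_iff algebra_simps)

lemma pscale_sum_right: "p *\<^sub>p sum f A = (\<Sum>i\<in>A. p *\<^sub>p f i)"
  by (rule ext) (simp add: sum_fun_apply sum_distrib_left)

lemma gvecD: "u \<in> gvec n ds e \<Longrightarrow> m \<in> keys (u a) \<Longrightarrow>
    a < length ds \<and> keys m \<subseteq> {1..n} \<and> mdeg m + ds ! a = e"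
  by (auto simp: gvec_def)

lemma gvec_iff: "u \<in> gvec n ds e \<longleftrightarrow>
    (\<forall>a. if a < length ds \<and> ds ! a \<le> e then u a \<in> forms n (e - ds ! a) else u a = 0)"
proof
  assume u: "u \<in> gvec n ds e"
  show "\<forall>a. if a < length ds \<and> ds ! a \<le> e then u a \<in> forms n (e - ds ! a) else u a = 0"
  proof
    fix a
    show "if a < length ds \<and> ds ! a \<le> e then u a \<in> forms n (e - ds ! a) else u a = 0"
    proof (cases "a < length ds \<and> ds ! a \<le> e")
      case True
      then show ?thesis using gvecD[OF u, of _ a] by (fastforce simp: forms_iff)
    next
      case False
      then have "keys (u a) = {}" using gvecD[OF u, of _ a] by fastforce
      with False show ?thesis by auto
    qed
  qed
next
  assume *: "\<forall>a. if a < length ds \<and> ds ! a \<le> e then u a \<in> forms n (e - ds ! a) else u a = 0"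
  show "u \<in> gvec n ds e"
    unfolding gvec_def
  proof (intro CollectI allI ballI)
    fix a m assume m: "m \<in> keys (u a)"
    show "a < length ds \<and> keys m \<subseteq> {1..n} \<and> mdeg m + ds ! a = e"
      using spec[OF *, of a] m by (auto simp: forms_iff split: if_splits)
  qed
qed

lemma gvec_forms: "u \<in> gvec n ds e \<Longrightarrow> a < length ds \<Longrightarrow> ds ! a \<le> e \<Longrightarrow> u a \<in> forms n (e - ds ! a)"
  and gvec_outside: "u \<in> gvec n ds e \<Longrightarrow> length ds \<le> a \<Longrightarrow> u a = 0"
  and gvec_low: "u \<in> gvec n ds e \<Longrightarrow> e < ds ! a \<Longrightarrow> u a = 0"
  unfolding gvec_iff by (metis not_le)+

lemma gvec_0 [simp]: "0 \<in> gvec n ds e"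
  by (simp add: gvec_def)

lemma gvec_add: "u \<in> gvec n ds e \<Longrightarrow> v \<in> gvec n ds e \<Longrightarrow> u + v \<in> gvec n ds e"
  unfolding gvec_iff by (auto intro: forms_add split: if_splits)

lemma gvec_uminus: "u \<in> gvec n ds e \<Longrightarrow> - u \<in> gvec n ds e"
  unfolding gvec_iff by (auto intro: forms_uminus split: if_splits)

lemma gvec_diff: "u \<in> gvec n ds e \<Longrightarrow> v \<in> gvec n ds e \<Longrightarrow> u - v \<in> gvec n ds e"
  using gvec_add[of u n ds e "- v"] gvec_uminus[of v n ds e] by simp

lemma gvec_sum: "(\<And>i. i \<in> A \<Longrightarrow> f i \<in> gvec n ds e) \<Longrightarrow> sum f A \<in> gvec n ds e"
  by (induction A rule: infinite_finite_induct) (auto intro: gvec_add)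

lemma gvec_pscale: "p \<in> forms n e \<Longrightarrow> u \<in> gvec n ds e' \<Longrightarrow> p *\<^sub>p u \<in> gvec n ds (e + e')"
  unfolding gvec_def by (fastforce simp: forms_iff mdeg_add keys_add_nat dest: keys_mult_mpoly)

lemma gvec_bvec: "b < length ds \<Longrightarrow> bvec b \<in> gvec n ds (ds ! b)"
  by (auto simp: gvec_def bvec_def)

lemma gvec_mono: "n \<le> n' \<Longrightarrow> u \<in> gvec n ds e \<Longrightarrow> u \<in> gvec n' ds e"
  by (fastforce simp: gvec_def)

lemma gvec_Nil [simp]: "gvec n [] e = {0}"
  by (auto simp: gvec_iff fun_eq_iff)

lemma bvec_same [simp]: "bvec b b = 1"
  by (simp add: bvec_def)

lemma gvec_expand: "u \<in> gvec n ds e \<Longrightarrow> u = (\<Sum>b<length ds. u b *\<^sub>p bvec b)"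
proof
  fix a assume u: "u \<in> gvec n ds e"
  have "(\<Sum>b<length ds. u b *\<^sub>p bvec b) a = (\<Sum>b<length ds. if b = a then u b else 0)"
    unfolding sum_fun_apply by (rule sum.cong) (auto simp: bvec_def)
  also have "\<dots> = u a" using gvec_outside[OF u, of a] by (auto simp: not_less)
  finally show "u a = (\<Sum>b<length ds. u b *\<^sub>p bvec b) a" by simp
qed

lemma plinear_add: "plinear f \<Longrightarrow> f (u + v) = f u + f v"
  and plinear_pscale: "plinear f \<Longrightarrow> f (p *\<^sub>p u) = p *\<^sub>p f u"
  by (auto simp: plinear_def)

lemma plinear_0: "plinear f \<Longrightarrow> f 0 = 0"
  using plinear_pscale[of f 0 0] by simp

lemma plinear_uminus: "plinear f \<Longrightarrow> f (- u) = - f u"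
  using plinear_pscale[of f "-1" u] by simp

lemma plinear_diff: "plinear f \<Longrightarrow> f (u - v) = f u - f v"
  using plinear_add[of f u "- v"] plinear_uminus[of f v] by simp

lemma plinear_sum: "plinear f \<Longrightarrow> f (sum h A) = (\<Sum>i\<in>A. f (h i))"
  by (induction A rule: infinite_finite_induct) (auto simp: plinear_add plinear_0)

lemma plinear_id: "plinear (\<lambda>u. u)"
  and plinear_zero: "plinear (\<lambda>u. 0)"
  and plinear_comp: "plinear f \<Longrightarrow> plinear h \<Longrightarrow> plinear (\<lambda>u. f (h u))"
  and plinear_plus: "plinear f \<Longrightarrow> plinear h \<Longrightarrow> plinear (\<lambda>u. f u + h u)"
  and plinear_minus: "plinear f \<Longrightarrow> plinear h \<Longrightarrow> plinear (\<lambda>u. f u - h u)"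
  and plinear_neg: "plinear f \<Longrightarrow> plinear (\<lambda>u. - f u)"
  and plinear_mult: "plinear f \<Longrightarrow> plinear (\<lambda>u. p *\<^sub>p f u)"
  by (auto simp: plinear_def pscale_add_right pscale_diff_right pscale_pscale mult.commute)

lemma plinear_lin: "plinear (lin k c)"
  by (auto simp: plinear_def lin_def pscale_add_left sum.distrib pscale_sum_right pscale_pscale)

lemma lin_bvec: "b < k \<Longrightarrow> lin k c (bvec b) = c b"
proof -
  assume "b < k"
  have "lin k c (bvec b) = (\<Sum>b'<k. if b' = b then c b' else 0)"
    unfolding lin_def by (rule sum.cong) (auto simp: bvec_def)
  then show ?thesis using \<open>b < k\<close> by simp
qed

lemma lin_gvec:
  assumes "\<And>b. b < length es \<Longrightarrow> c b \<in> gvec n ds (es ! b)" "u \<in> gvec n es e"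
  shows "lin (length es) c u \<in> gvec n ds e"
  unfolding lin_def
proof (rule gvec_sum)
  fix b assume b: "b \<in> {..<length es}"
  show "u b *\<^sub>p c b \<in> gvec n ds e"
  proof (cases "es ! b \<le> e")
    case True
    then show ?thesis
      using gvec_pscale[OF gvec_forms[OF assms(2) _ True] assms(1)[of b]] b by simp
  next
    case False
    then show ?thesis using gvec_low[OF assms(2), of b] by simp
  qed
qed

lemma glin_lin: "(\<And>b. b < length es \<Longrightarrow> c b \<in> gvec n ds (es ! b)) \<Longrightarrow> glin n es ds (lin (length es) c)"
  unfolding glin_def using lin_gvec plinear_lin by blast

lemma plinear_eq_on_gvec:
  assumes "plinear f" "plinear h" "u \<in> gvec n ds e" "\<And>b. b < length ds \<Longrightarrow> f (bvec b) = h (bvec b)"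
  shows "f u = h u"
proof -
  have *: "u = (\<Sum>b<length ds. u b *\<^sub>p bvec b)" by (rule gvec_expand[OF assms(3)])
  have "f u = (\<Sum>b<length ds. u b *\<^sub>p f (bvec b))"
    by (subst *) (simp add: plinear_sum[OF assms(1)] plinear_pscale[OF assms(1)])
  also have "\<dots> = (\<Sum>b<length ds. u b *\<^sub>p h (bvec b))"
    using assms(4) by simp
  also have "\<dots> = h u"
    by (subst (2) *) (simp add: plinear_sum[OF assms(2)] plinear_pscale[OF assms(2)])
  finally show ?thesis .
qed

lemma plinear_eq_lin:
  assumes "plinear f" "u \<in> gvec n ds e"
  shows "f u = lin (length ds) (\<lambda>b. f (bvec b)) u"
  by (rule plinear_eq_on_gvec[OF assms(1) plinear_lin assms(2)]) (simp add: lin_bvec)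

lemma glin_plinear: "glin n es ds f \<Longrightarrow> plinear f"
  and glin_gvec: "glin n es ds f \<Longrightarrow> u \<in> gvec n es e \<Longrightarrow> f u \<in> gvec n ds e"
  by (auto simp: glin_def)

lemma glin_id: "glin n ds ds (\<lambda>u. u)"
  by (simp add: glin_def plinear_id)

lemma glin_comp: "glin n es ds f \<Longrightarrow> glin n fs es h \<Longrightarrow> glin n fs ds (\<lambda>u. f (h u))"
  by (simp add: glin_def plinear_comp)

lemma glin_minus: "glin n es ds f \<Longrightarrow> glin n es ds h \<Longrightarrow> glin n es ds (\<lambda>u. f u - h u)"
  by (simp add: glin_def plinear_minus gvec_diff)

text \<open>Free modules are projective: preimages under \<open>d\<close> of the images of the basis
  vectors, chosen in the right degree, define the lift. The inductive steps in the comparison of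
  resolutions rest on this.\<close>

lemma glin_lift:
  assumes "plinear f" "plinear d"
    and "\<And>b. b < length es \<Longrightarrow> \<exists>v\<in>gvec n ds (es ! b). f (bvec b) = d v"
  obtains h where "glin n es ds h" "\<And>e u. u \<in> gvec n es e \<Longrightarrow> f u = d (h u)"
proof -
  from assms(3) obtain c where c: "\<And>b. b < length es \<Longrightarrow> c b \<in> gvec n ds (es ! b)"
      "\<And>b. b < length es \<Longrightarrow> f (bvec b) = d (c b)"
    by metis
  let ?h = "lin (length es) c"
  have "f u = d (?h u)" if "u \<in> gvec n es e" for e u
    by (rule plinear_eq_on_gvec[OF assms(1) plinear_comp[OF assms(2) plinear_lin] that])
      (simp add: lin_bvec c(2))
  with glin_lin[OF c(1)] show thesis by (rule that)
qed

section \<open>Vector space dimensions and Hilbert functions\<close>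

text \<open>Scalars act as constant polynomials \<open>single 0 c\<close>, the same encoding as in
  \<open>residue_basis\<close>, so dimension theory over the field applies directly to polynomials
  and vectors.\<close>

interpretation kp: vector_space "\<lambda>(c::'k::field) (p::'k mpoly). single 0 c * p"
  by unfold_locales (simp_all add: algebra_simps single_add mult_single)

interpretation kv: vector_space "\<lambda>(c::'k::field) (u::'k pvec). single 0 c *\<^sub>p u"
  by unfold_locales (simp_all add: pscale_add_right pscale_add_left single_add pscale_pscale
      mult_single)

interpretation kvp: vector_space_pair "\<lambda>(c::'k::field) (u::'k pvec). single 0 c *\<^sub>p u"
  "\<lambda>(c::'k::field) (p::'k mpoly). single 0 c * p"
  by unfold_locales

interpretation kvv: vector_space_pair "\<lambda>(c::'k::field) (u::'k pvec). single 0 c *\<^sub>p u"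
  "\<lambda>(c::'k::field) (u::'k pvec). single 0 c *\<^sub>p u"
  by unfold_locales

text \<open>A basis of the subspace of \<open>V\<close> mapped into \<open>U\<close> is extended to
  a basis of \<open>V\<close>; the added vectors \<open>C\<close> map to a basis of the image of
  \<open>V\<close> modulo \<open>U\<close>. With \<open>U\<close> an ideal this yields residue
  bases, with \<open>U = {0}\<close> the rank-nullity theorem.\<close>

lemma (in vector_space_pair) relative_quotient_basis:
  assumes f: "Vector_Spaces.linear s1 s2 f" and V: "vs1.subspace V" "V \<subseteq> vs1.span A" "finite A"
    and U: "vs2.subspace U"
  obtains C where "finite C" "C \<subseteq> V" "card C + vs1.dim {v \<in> V. f v \<in> U} = vs1.dim V"
    "\<forall>v\<in>V. \<exists>c. f v - (\<Sum>x\<in>C. s2 (c x) (f x)) \<in> U"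
    "\<forall>c. (\<Sum>x\<in>C. s2 (c x) (f x)) \<in> U \<longrightarrow> (\<forall>x\<in>C. c x = 0)"
proof -
  interpret f: Vector_Spaces.linear s1 s2 f by (rule f)
  let ?W = "{v \<in> V. f v \<in> U}"
  have W: "vs1.subspace ?W"
    using V(1) U unfolding vs1.subspace_def vs2.subspace_def by (simp add: f.zero f.add f.scale)
  obtain B where B: "B \<subseteq> ?W" "vs1.independent B" "?W \<subseteq> vs1.span B" "card B = vs1.dim ?W"
    using vs1.basis_exists by blast
  obtain B' where B': "B \<subseteq> B'" "B' \<subseteq> V" "vs1.independent B'" "V \<subseteq> vs1.span B'"
    using vs1.maximal_independent_subset_extend[of B V] B
        by (metis (no_types, lifting) mem_Collect_eq subset_iff)
  have fin: "finite B'"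
    using vs1.independent_span_bound[OF V(3) B'(3)] B'(2) V(2) by blast
  then have finB: "finite B" using B'(1) finite_subset by blast
  let ?C = "B' - B"
  have dimV: "vs1.dim V = card B'"
    using vs1.basis_card_eq_dim[OF B'(2,4,3)] by simp
  show thesis
  proof
    show "finite ?C" using fin by simp
    show "?C \<subseteq> V" using B'(2) by blast
    show "card ?C + vs1.dim ?W = vs1.dim V"
      using dimV B(4) card_mono[OF fin B'(1)] card_Diff_subset[OF finB B'(1)] by simp
  next
    show "\<forall>v\<in>V. \<exists>c. f v - (\<Sum>x\<in>?C. s2 (c x) (f x)) \<in> U"
    proof
      fix v assume "v \<in> V"
      then obtain c where c: "v = (\<Sum>x\<in>B'. s1 (c x) x)"
        using B'(4) vs1.span_finite[OF fin] by blast
      have *: "v = (\<Sum>x\<in>?C. s1 (c x) x) + (\<Sum>x\<in>B. s1 (c x) x)"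
        unfolding c by (rule sum.subset_diff[OF B'(1) fin])
      have "(\<Sum>x\<in>B. s1 (c x) x) \<in> ?W"
        using B(1) W by (intro vs1.subspace_sum vs1.subspace_scale) auto
      moreover have "f v = (\<Sum>x\<in>?C. s2 (c x) (f x)) + f (\<Sum>x\<in>B. s1 (c x) x)"
        by (subst *) (simp add: f.add f.sum f.scale)
      ultimately show "\<exists>c. f v - (\<Sum>x\<in>?C. s2 (c x) (f x)) \<in> U"
        by (intro exI[of _ c]) simp
    qed
  next
    show "\<forall>c. (\<Sum>x\<in>?C. s2 (c x) (f x)) \<in> U \<longrightarrow> (\<forall>x\<in>?C. c x = 0)"
    proof (intro allI impI ballI)
      fix c x assume c: "(\<Sum>x\<in>?C. s2 (c x) (f x)) \<in> U" and x: "x \<in> ?C"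
      let ?v = "\<Sum>x\<in>?C. s1 (c x) x"
      have "?v \<in> V" using B'(2) V(1) by (intro vs1.subspace_sum vs1.subspace_scale) auto
      moreover have "f ?v \<in> U" using c by (simp add: f.sum f.scale)
      ultimately have "?v \<in> vs1.span B" using B(3) by blast
      then obtain b where b: "?v = (\<Sum>x\<in>B. s1 (b x) x)"
        using vs1.span_finite[OF finB] by blast
      \<comment> \<open>Two expressions for the same vector are merged into one vanishing
        combination of the independent set \<open>B'\<close>, with the sign reversed on
        \<open>B\<close>.\<close>
      let ?u = "\<lambda>x. if x \<in> B then - b x else c x"
      have "(\<Sum>x\<in>B'. s1 (?u x) x) = (\<Sum>x\<in>?C. s1 (?u x) x) + (\<Sum>x\<in>B. s1 (?u x) x)"
        by (rule sum.subset_diff[OF B'(1) fin])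
      also have "\<dots> = ?v - (\<Sum>x\<in>B. s1 (b x) x)"
        by (simp add: sum_negf)
      finally have "(\<Sum>x\<in>B'. s1 (?u x) x) = 0" using b by simp
      from vs1.independentD[OF B'(3) fin subset_refl this, of x] x have "?u x = 0"
        by blast
      then show "c x = 0" using x by (auto split: if_splits)
    qed
  qed
qed

lemma finite_monomials: "finite {m. keys m \<subseteq> {1..n} \<and> mdeg m = e}" (is "finite ?S")
proof -
  have "lookup ` ?S \<subseteq> {f. \<forall>v. (v \<in> {1..n} \<longrightarrow> f v \<in> {..e}) \<and> (v \<notin> {1..n} \<longrightarrow> f v = 0)}"
  proof clarify
    fix m :: "nat \<Rightarrow>\<^sub>0 nat" and v
    assume m: "keys m \<subseteq> {1..n}"
    have "lookup m v \<le> mdeg m"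
    proof (cases "v \<in> keys m")
      case True
      then show ?thesis unfolding mdeg_def by (intro member_le_sum) auto
    qed (simp add: in_keys_iff)
    with m show "(v \<in> {1..n} \<longrightarrow> lookup m v \<in> {..mdeg m}) \<and>
        (v \<notin> {1..n} \<longrightarrow> lookup m v = 0)"
      by (auto simp: in_keys_iff)
  qed
  then have "finite (lookup ` ?S)"
    by (rule finite_subset) (rule finite_set_of_finite_funs[OF finite_atLeastAtMost finite_atMost])
  then show ?thesis
    by (rule finite_imageD) (meson inj_onI poly_mapping_eq_iff)
qed

definition monomial_count :: "nat \<Rightarrow> nat \<Rightarrow> nat" where
  "monomial_count n e = card {m. keys m \<subseteq> {1..n} \<and> mdeg m = e}"

lemma subspace_forms: "kp.subspace (forms n e)"
  unfolding kp.subspace_def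
  using forms_mult[OF forms_const, of _ n e] by (auto intro: forms_add)

lemma subspace_gvec: "kv.subspace (gvec n ds e)"
  unfolding kv.subspace_def
  using gvec_pscale[OF forms_const, of _ n ds e] by (auto intro: gvec_add)

text \<open>The monomial multiples of basis vectors that have degree \<open>e\<close> form a basis
  of the strand. The spanning set and its finiteness are stated separately since the rank arguments
  ask for a finite spanning set.\<close>

lemma gvec_dim:
  fixes n e :: nat and ds :: "nat list"
  shows "(gvec n ds e :: 'k::field pvec set) \<subseteq> kv.span ((\<lambda>(a, m). single m 1 *\<^sub>p bvec a) `
      (SIGMA a:{..<length ds}. {m. keys m \<subseteq> {1..n} \<and> mdeg m + ds ! a = e}))" (is ?thesis1)
    and "finite ((\<lambda>(a, m). single m (1::'k) *\<^sub>p bvec a) `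
      (SIGMA a:{..<length ds}. {m. keys m \<subseteq> {1..n} \<and> mdeg m + ds ! a = e}))" (is ?thesis2)
    and "kv.dim (gvec n ds e :: 'k pvec set) =
      (\<Sum>a<length ds. if ds ! a \<le> e then monomial_count n (e - ds ! a) else 0)" (is ?thesis3)
proof -
  let ?M = "\<lambda>a. {m. keys m \<subseteq> {1..n} \<and> mdeg m + ds ! a = e}"
  let ?S = "SIGMA a:{..<length ds}. ?M a"
  let ?b = "\<lambda>(a, m). single m (1::'k) *\<^sub>p bvec a"
  have M: "?M a = (if ds ! a \<le> e then {m. keys m \<subseteq> {1..n} \<and> mdeg m = e - ds ! a} else {})" for a
    by auto
  have finM: "finite (?M a)" for a
    by (rule finite_subset[OF _ finite_monomials[of n "e - ds ! a"]]) auto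
  then have fin: "finite ?S" by simp
  then show ?thesis2 by simp
  have inj: "inj_on ?b ?S"
  proof (rule inj_onI, clarify)
    fix a m a' m'
    assume eq: "single m (1::'k) *\<^sub>p bvec a = single m' 1 *\<^sub>p bvec a'"
    have "single m (1::'k) = single m' 1 * (if a = a' then 1 else 0)"
      using fun_cong[OF eq, of a] by (simp add: bvec_def)
    then have "lookup (single m (1::'k)) m =
        lookup (single m' 1 * (if a = a' then 1 else 0)) m" by simp
    then show "a = a' \<and> m = m'"
      by (auto simp: lookup_single when_def split: if_splits)
  qed
  \<comment> \<open>Each pair of an entry and a monomial belongs to exactly one basis element, so a
    coefficient picks out one scalar. Independence and spanning both follow from this.\<close>
  have lk: "lookup ((\<Sum>x\<in>?S. single 0 (c x) *\<^sub>p ?b x) a) m = c (a, m)"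
    if "(a, m) \<in> ?S" for c :: "_ \<Rightarrow> 'k" and a m
  proof -
    have "lookup ((\<Sum>x\<in>?S. single 0 (c x) *\<^sub>p ?b x) a) m =
        (\<Sum>x\<in>?S. if x = (a, m) then c x else 0)"
      unfolding sum_fun_apply lookup_sum
      by (rule sum.cong) (auto simp: bvec_def mult_single lookup_single when_def split: if_splits)
    also have "\<dots> = c (a, m)" using that fin by simp
    finally show ?thesis .
  qed
  have ind: "kv.independent (?b ` ?S)"
  proof (rule kv.independent_if_scalars_zero)
    show "finite (?b ` ?S)" using fin by simp
    fix c x assume c: "(\<Sum>y\<in>?b ` ?S. single 0 (c y) *\<^sub>p y) = 0" and "x \<in> ?b ` ?S"
    then obtain a m where am: "(a, m) \<in> ?S" "x = ?b (a, m)" by blast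
    have "(\<Sum>y\<in>?S. single 0 (c (?b y)) *\<^sub>p ?b y) = 0"
      using c unfolding sum.reindex[OF inj] by (simp add: o_def)
    then have "lookup ((\<Sum>y\<in>?S. single 0 (c (?b y)) *\<^sub>p ?b y) a) m = 0"
      by simp
    then show "c x = 0" using lk[OF am(1), of "\<lambda>y. c (?b y)"] am(2) by simp
  qed
  have sub: "?b ` ?S \<subseteq> gvec n ds e"
  proof
    fix x assume "x \<in> ?b ` ?S"
    then obtain a m where "(a, m) \<in> ?S" and x: "x = ?b (a, m)" by blast
    then have am: "a < length ds" "keys m \<subseteq> {1..n}" "mdeg m + ds ! a = e" by auto
    with x show "x \<in> gvec n ds e"
      using gvec_pscale[OF forms_single[OF am(2), of 1] gvec_bvec[OF am(1)]] by simp
  qed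
  show span: ?thesis1
  proof
    fix u :: "'k pvec" assume u: "u \<in> gvec n ds e"
    have "u = (\<Sum>x\<in>?S. single 0 (lookup (u (fst x)) (snd x)) *\<^sub>p ?b x)"
    proof (intro ext poly_mapping_eqI)
      fix a m
      show "lookup (u a) m = lookup
        ((\<Sum>x\<in>?S. single 0 (lookup (u (fst x)) (snd x)) *\<^sub>p ?b x) a) m"
      proof (cases "(a, m) \<in> ?S")
        case True
        then show ?thesis by (subst lk[OF True]) simp
      next
        case False
        then have "m \<notin> keys (u a)" using gvecD[OF u, of m a] by auto
        then have "lookup (u a) m = 0" by (simp add: in_keys_iff)
        moreover have "(\<Sum>x\<in>?S. single 0 (lookup (u (fst x)) (snd x)) *\<^sub>p ?b x)
            \<in> gvec n ds e"
          using sub by (intro kv.subspace_sum[OF subspace_gvec] kv.subspace_scale[OF subspace_gvec])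
              auto
        from gvecD[OF this, of m a] False have "m \<notin> keys
          ((\<Sum>x\<in>?S. single 0 (lookup (u (fst x)) (snd x)) *\<^sub>p ?b x) a)" by auto
        ultimately show ?thesis by (simp add: in_keys_iff)
      qed
    qed
    also have "\<dots> \<in> kv.span (?b ` ?S)"
      by (intro kv.span_sum kv.span_scale kv.span_base) simp
    finally show "u \<in> kv.span (?b ` ?S)" .
  qed
  have "kv.dim (gvec n ds e :: 'k pvec set) = card (?b ` ?S)"
    using kv.basis_card_eq_dim[OF sub span ind] by simp
  also have "\<dots> = card ?S" by (rule card_image[OF inj])
  also have "\<dots> = (\<Sum>a<length ds. card (?M a))" using finM by simp
  also have "\<dots> = (\<Sum>a<length ds. if ds ! a \<le> e then monomial_count n (e - ds ! a) else 0)"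
    unfolding M by (rule sum.cong) (auto simp: monomial_count_def)
  finally show ?thesis3 .
qed

lemma forms_span: "forms n e \<subseteq> kp.span ((\<lambda>m. single m 1) `
    {m. keys m \<subseteq> {1..n} \<and> mdeg m = e})"
proof
  fix p :: "'k::field mpoly" assume p: "p \<in> forms n e"
  have "p = (\<Sum>m\<in>keys p. single 0 (lookup p m) * single m 1)"
    using poly_mapping_sum_single[of "keys p" p] by (simp add: mult_single)
  also have "\<dots> \<in> kp.span ((\<lambda>m. single m 1) `
      {m. keys m \<subseteq> {1..n} \<and> mdeg m = e})"
    using p by (intro kp.span_sum kp.span_scale kp.span_base) (auto simp: forms_iff)
  finally show "p \<in> kp.span ((\<lambda>m. single m 1) `
    {m. keys m \<subseteq> {1..n} \<and> mdeg m = e})" .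
qed

text \<open>Two representations of one form differ by a relation modulo \<open>L\<close> among the
  elements of \<open>B\<close>. Coefficient functions are 0 off \<open>B\<close>, which makes them
  unique as total functions.\<close>

lemma residue_basisI:
  assumes "finite B" "B \<subseteq> forms n d" "kp.subspace L"
    and span: "\<And>p. p \<in> forms n d \<Longrightarrow> \<exists>c. p - (\<Sum>b\<in>B. single 0 (c b) * b) \<in> L"
    and ind: "\<And>c b. (\<Sum>b\<in>B. single 0 (c b) * b) \<in> L \<Longrightarrow> b \<in> B \<Longrightarrow> c b = 0"
  shows "residue_basis n L d B"
  unfolding residue_basis_def
proof (intro conjI ballI)
  fix p :: "'a mpoly" assume "p \<in> forms n d"
  then obtain c where c: "p - (\<Sum>b\<in>B. single 0 (c b) * b) \<in> L" using span[OF \<open>p \<in> forms n d\<close>] by blast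
  let ?c = "\<lambda>b. if b \<in> B then c b else 0"
  show "\<exists>!c. (\<forall>b. b \<notin> B \<longrightarrow> c b = 0) \<and> p - (\<Sum>b\<in>B. single 0 (c b) * b) \<in> L"
  proof (rule ex1I[of _ ?c])
    show "(\<forall>b. b \<notin> B \<longrightarrow> ?c b = 0) \<and> p - (\<Sum>b\<in>B. single 0 (?c b) * b) \<in> L"
      using c by simp
  next
    fix c' assume c': "(\<forall>b. b \<notin> B \<longrightarrow> c' b = 0) \<and> p - (\<Sum>b\<in>B. single 0 (c' b) * b) \<in> L"
    have "(p - (\<Sum>b\<in>B. single 0 (c b) * b)) - (p - (\<Sum>b\<in>B. single 0 (c' b) * b)) \<in> L"
      using kp.subspace_diff[OF assms(3)] c c' by blast
    also have "(p - (\<Sum>b\<in>B. single 0 (c b) * b)) - (p - (\<Sum>b\<in>B. single 0 (c' b) * b))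
      = (\<Sum>b\<in>B. single 0 (c' b - c b) * b)"
      by (simp add: single_diff left_diff_distrib sum_subtractf)
    finally have "c' b - c b = 0" if "b \<in> B" for b using ind[of "\<lambda>b. c' b - c b"] that by blast
    then show "c' = ?c" using c' by (auto simp: fun_eq_iff)
  qed
qed (use assms in auto)

text \<open>A residue basis together with a basis of \<open>L \<inter> forms n d\<close> is a basis
  of all forms of degree \<open>d\<close>. Hence all residue bases have the same cardinality, and
  the description in \<open>hilbert_function\<close> is well defined.\<close>

lemma residue_basis_card:
  fixes L :: "'a::field mpoly set"
  assumes L: "kp.subspace L" and B: "residue_basis n L d B"
  shows "card B + kp.dim (L \<inter> forms n d) = kp.dim (forms n d :: 'a mpoly set)"
proof -
  let ?W = "L \<inter> forms n d"
  have finB: "finite B" and Bf: "B \<subseteq> forms n d"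
    and u: "\<And>p. p \<in> forms n d \<Longrightarrow> \<exists>!c. (\<forall>b. b \<notin> B \<longrightarrow> c b = 0) \<and> p - (\<Sum>b\<in>B. single 0 (c b) * b) \<in> L"
    using B by (auto simp: residue_basis_def)
  \<comment> \<open>Independence modulo \<open>L\<close> is the uniqueness clause for the form 0,
    which the zero coefficients also represent.\<close>
  have ind: "c b = 0" if c: "(\<Sum>b\<in>B. single 0 (c b) * b) \<in> L" and b: "b \<in> B" for c b
  proof -
    let ?c = "\<lambda>b. if b \<in> B then c b else 0"
    have "(\<forall>b. b \<notin> B \<longrightarrow> ?c b = 0) \<and> 0 - (\<Sum>b\<in>B. single 0 (?c b) * b) \<in> L"
      using kp.subspace_neg[OF L c] by simp
    moreover have "(\<forall>b. b \<notin> B \<longrightarrow> (\<lambda>_. 0::'a) b = 0) \<and> 0 - (\<Sum>b\<in>B. single 0 ((\<lambda>_. 0) b) * b) \<in> L"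
      using kp.subspace_0[OF L] by simp
    ultimately have "?c = (\<lambda>_. 0)" using Uniq_D[OF conjunct2[OF ex1_iff_ex_Uniq[THEN iffD1,
        OF u[OF forms_0]]]] by simp
    from fun_cong[OF this, of b] show ?thesis using b by simp
  qed
  obtain D where D: "D \<subseteq> ?W" "kp.independent D" "?W \<subseteq> kp.span D" "card D = kp.dim ?W"
    using kp.basis_exists by blast
  have finD: "finite D"
  proof -
    have "D \<subseteq> kp.span ((\<lambda>m. single m 1) ` {m. keys m \<subseteq> {1..n} \<and> mdeg m = d})"
      using D(1) forms_span[of n d] by blast
    from kp.independent_span_bound[OF finite_imageI[OF finite_monomials] D(2) this] show ?thesis ..
  qed
  have comb: "(\<Sum>x\<in>D. single 0 (c x) * x) \<in> L" for c
    using D(1) L by (intro kp.subspace_sum kp.subspace_scale) auto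
  have disj: "B \<inter> D = {}"
  proof (rule ccontr)
    assume "B \<inter> D \<noteq> {}"
    then obtain x where x: "x \<in> B" "x \<in> D" by blast
    have "(\<Sum>b\<in>B. single 0 (if b = x then 1 else 0) * b) = (\<Sum>b\<in>B. if b = x then b else 0)"
      by (rule sum.cong) auto
    also have "\<dots> = x" using x finB by simp
    finally have "(\<Sum>b\<in>B. single 0 (if b = x then 1 else 0) * b) \<in> L" using x D(1) by auto
    from ind[OF this x(1)] show False by simp
  qed
  have "kp.independent (B \<union> D)"
  proof (rule kp.independent_if_scalars_zero)
    show "finite (B \<union> D)" using finB finD by simp
    fix c x assume c: "(\<Sum>x\<in>B \<union> D. single 0 (c x) * x) = 0" and x: "x \<in> B \<union> D"
    have s: "(\<Sum>x\<in>B. single 0 (c x) * x) + (\<Sum>x\<in>D. single 0 (c x) * x) = 0"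
      using c by (subst (asm) sum.union_disjoint[OF finB finD disj])
    then have "(\<Sum>x\<in>B. single 0 (c x) * x) = - (\<Sum>x\<in>D. single 0 (c x) * x)"
      by (simp add: eq_neg_iff_add_eq_0)
    then have "(\<Sum>x\<in>B. single 0 (c x) * x) \<in> L"
      using kp.subspace_neg[OF L comb[of c]] by simp
    then have cB: "c b = 0" if "b \<in> B" for b by (rule ind[of c, OF _ that])
    with s have "(\<Sum>x\<in>D. single 0 (c x) * x) = 0" by simp
    from kp.independentD[OF D(2) finD subset_refl this] have "c b = 0" if "b \<in> D" for b
      using that by blast
    with cB x show "c x = 0" by blast
  qed
  moreover have "B \<union> D \<subseteq> forms n d" using Bf D(1) by blast
  moreover have "forms n d \<subseteq> kp.span (B \<union> D)"
  proof
    fix p :: "'a mpoly" assume p: "p \<in> forms n d"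
    then obtain c where c: "p - (\<Sum>b\<in>B. single 0 (c b) * b) \<in> L" using ex1_implies_ex[OF u[OF p]]
        by blast
    have s: "(\<Sum>b\<in>B. single 0 (c b) * b) \<in> kp.span (B \<union> D)"
      by (intro kp.span_sum kp.span_scale kp.span_base) simp
    have "(\<Sum>b\<in>B. single 0 (c b) * b) \<in> forms n d"
      using Bf by (intro kp.subspace_sum kp.subspace_scale subspace_forms) auto
    with p c have "p - (\<Sum>b\<in>B. single 0 (c b) * b) \<in> ?W" by (simp add: forms_diff)
    then have "p - (\<Sum>b\<in>B. single 0 (c b) * b) \<in> kp.span (B \<union> D)"
      using D(3) kp.span_mono[of D "B \<union> D"] by blast
    from kp.span_add[OF this s] show "p \<in> kp.span (B \<union> D)" by simp
  qed
  ultimately have "card (B \<union> D) = kp.dim (forms n d :: 'a mpoly set)"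
    by (intro kp.basis_card_eq_dim)
  then show ?thesis using card_Un_disjoint[OF finB finD disj] D(4) by simp
qed

lemma hilbert_function_eq:
  assumes "kp.subspace L" "residue_basis n L d B"
  shows "hilbert_function n L d = card B"
  unfolding hilbert_function_def
proof (rule the_equality)
  show "\<exists>B'. residue_basis n L d B' \<and> card B' = card B" using assms(2) by blast
next
  fix h assume "\<exists>B'. residue_basis n L d B' \<and> card B' = h"
  then obtain B' where B': "residue_basis n L d B'" "card B' = h" by blast
  show "h = card B"
    using residue_basis_card[OF assms(1) B'(1)] residue_basis_card[OF assms] B'(2) by linarith
qed

section \<open>Existence of minimal graded free resolutions\<close>

text \<open>Induction on the set of coordinates. \<open>T0\<close> serves all of \<open>S\<close>
  once \<open>x\<close> is forgotten; its \<open>x\<close>-entries are at most \<open>N\<close>, so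
  a vector whose \<open>x\<close>-entry is at least \<open>N\<close> lies above an element of
  \<open>T0\<close>. Each of the finitely many slices with a smaller \<open>x\<close>-entry has its
  own finite set.\<close>

lemma dickson:
  assumes "finite A"
  shows "\<exists>T\<subseteq>S. finite T \<and> (\<forall>s\<in>S. \<exists>t\<in>T. \<forall>v\<in>A. t v \<le> (s v :: nat))"
  using assms
proof (induction A arbitrary: S)
  case empty
  show ?case
  proof (cases "S = {}")
    case False
    then obtain s where "s \<in> S" by blast
    then show ?thesis by (intro exI[of _ "{s}"]) auto
  qed simp
next
  case (insert x A)
  obtain T0 where T0: "T0 \<subseteq> S" "finite T0" "\<And>s. s \<in> S \<Longrightarrow> \<exists>t\<in>T0. \<forall>v\<in>A. t v \<le> s v"
    using insert.IH[of S] by blast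
  define N where "N = (\<Sum>t\<in>T0. t x)"
  have "\<exists>T. T \<subseteq> {s \<in> S. s x = k} \<and> finite T \<and> (\<forall>s\<in>{s \<in> S. s x = k}. \<exists>t\<in>T. \<forall>v\<in>A. t v \<le> s v)" for k
    using insert.IH[of "{s \<in> S. s x = k}"] by simp
  then have "\<forall>k. \<exists>T. T \<subseteq> {s \<in> S. s x = k} \<and> finite T \<and> (\<forall>s\<in>{s \<in> S. s x = k}. \<exists>t\<in>T. \<forall>v\<in>A. t v \<le> s v)"
    by (rule allI)
  from choice[OF this] obtain T where "\<And>k. T k \<subseteq> {s \<in> S. s x = k} \<and> finite (T k) \<and>
      (\<forall>s\<in>{s \<in> S. s x = k}. \<exists>t\<in>T k. \<forall>v\<in>A. t v \<le> s v)"
    by (elim exE) (erule meta_allE, erule meta_mp, erule spec)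
  then have T: "\<And>k. T k \<subseteq> {s \<in> S. s x = k}" "\<And>k. finite (T k)"
      "\<And>k s. s \<in> S \<Longrightarrow> s x = k \<Longrightarrow> \<exists>t\<in>T k. \<forall>v\<in>A. t v \<le> s v"
    by simp_all
  show ?case
  proof (intro exI conjI ballI)
    show "T0 \<union> (\<Union>k<N. T k) \<subseteq> S" using T0(1) T(1) by blast
    show "finite (T0 \<union> (\<Union>k<N. T k))" using T0(2) T(2) by simp
    fix s assume s: "s \<in> S"
    show "\<exists>t\<in>T0 \<union> (\<Union>k<N. T k). \<forall>v\<in>insert x A. t v \<le> s v"
    proof (cases "s x < N")
      case True
      obtain t where t: "t \<in> T (s x)" "\<forall>v\<in>A. t v \<le> s v" using T(3)[OF s refl] by blast
      then have "t x = s x" using T(1) by blast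
      with t True show ?thesis by (intro bexI[of _ t]) auto
    next
      case False
      obtain t where t: "t \<in> T0" "\<forall>v\<in>A. t v \<le> s v" using T0(3)[OF s] by blast
      have "t x \<le> N" unfolding N_def using t(1) T0(2) by (intro member_le_sum) auto
      with t False show ?thesis by (intro bexI[of _ t]) auto
    qed
  qed
qed

lemma dickson_monomials:
  assumes "\<And>m. m \<in> M \<Longrightarrow> keys m \<subseteq> {1..n}"
  shows "\<exists>T\<subseteq>M. finite T \<and> (\<forall>m\<in>M. \<exists>t\<in>T. \<exists>r. m = t + (r :: nat \<Rightarrow>\<^sub>0 nat))"
proof -
  obtain T where T: "T \<subseteq> lookup ` M" "finite T"
      "\<And>s. s \<in> lookup ` M \<Longrightarrow> \<exists>t\<in>T. \<forall>v\<in>{1..n}. t v \<le> s v"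
    using dickson[of "{1..n}" "lookup ` M"] by auto
  from T(1,2) obtain T' where T': "T' \<subseteq> M" "finite T'" "T = lookup ` T'"
    by (meson finite_subset_image)
  have "\<exists>t\<in>T'. \<exists>r. m = t + r" if m: "m \<in> M" for m
  proof -
    obtain t where t: "t \<in> T'" "\<forall>v\<in>{1..n}. lookup t v \<le> lookup m v"
      using T(3)[of "lookup m"] T'(3) m by blast
    have "lookup t v \<le> lookup m v" for v
    proof (cases "v \<in> {1..n}")
      case False
      then have "v \<notin> keys t" using assms t(1) T'(1) by blast
      then show ?thesis by (simp add: in_keys_iff)
    qed (use t in blast)
    then have "m = t + (m - t)"
      by (intro poly_mapping_eqI) (simp add: lookup_add lookup_minus)
    with t(1) show ?thesis by blast
  qed
  with T' show ?thesis by blast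
qed

section \<open>Finite generation of graded submodules\<close>

definition gsub :: "nat \<Rightarrow> nat list \<Rightarrow> (nat \<Rightarrow> 'k::field pvec set) \<Rightarrow> bool" where
  "gsub n ds Z \<longleftrightarrow> (\<forall>e. Z e \<subseteq> gvec n ds e \<and> 0 \<in> Z e \<and> (\<forall>u\<in>Z e. \<forall>v\<in>Z e. u + v \<in> Z e) \<and>
     (\<forall>u\<in>Z e. \<forall>e'. \<forall>p\<in>forms n e'. p *\<^sub>p u \<in> Z (e' + e)))"

text \<open>Combinations in which every summand has total degree \<open>e\<close>; the degree is
  tracked by the derivation, so no homogeneous components have to be extracted.\<close>

inductive hspan :: "nat \<Rightarrow> (nat \<times> 'k::field pvec) set \<Rightarrow> nat \<Rightarrow> 'k pvec \<Rightarrow> bool" for n G where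
  hspan_zero: "hspan n G e 0"
| hspan_step: "hspan n G e u \<Longrightarrow> (e', g) \<in> G \<Longrightarrow> p \<in> forms n e'' \<Longrightarrow> e = e'' + e' \<Longrightarrow>
    hspan n G e (u + p *\<^sub>p g)"

lemma hspan_add: "hspan n G e v \<Longrightarrow> hspan n G e u \<Longrightarrow> hspan n G e (u + v)"
  by (induction rule: hspan.induct) (auto simp: add.assoc[symmetric] intro: hspan_step)

lemma hspan_gen: "(e, g) \<in> G \<Longrightarrow> p \<in> forms n e' \<Longrightarrow> hspan n G (e' + e) (p *\<^sub>p g)"
  using hspan_step[OF hspan_zero, of e g G p n e'] by simp

lemma hspan_pscale: "hspan n G e u \<Longrightarrow> q \<in> forms n e0 \<Longrightarrow> hspan n G (e0 + e) (q *\<^sub>p u)"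
proof (induction rule: hspan.induct)
  case (hspan_zero e)
  show ?case unfolding pscale_simps by (rule hspan.hspan_zero)
next
  case (hspan_step e u e' g p e'')
  have "hspan n G (e0 + e) (q *\<^sub>p u + (q * p) *\<^sub>p g)"
    by (rule hspan.hspan_step[OF hspan_step.IH[OF hspan_step.prems] hspan_step.hyps(2)
          forms_mult[OF hspan_step.prems hspan_step.hyps(3)]]) (simp add: hspan_step.hyps(4))
  then show ?case unfolding pscale_add_right pscale_pscale .
qed

lemma hspan_sum: "(\<And>i. i \<in> A \<Longrightarrow> hspan n G e (f i)) \<Longrightarrow> hspan n G e (sum f A)"
  by (induction A rule: infinite_finite_induct) (auto intro: hspan_zero hspan_add)

lemma hspan_trans: "hspan n G e u \<Longrightarrow> (\<And>x. x \<in> G \<Longrightarrow> hspan n G' (fst x) (snd x)) \<Longrightarrow> hspan n G' e u"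
proof (induction rule: hspan.induct)
  case (hspan_step e u e' g p e'')
  then show ?case using hspan_add[OF hspan_pscale[of n G' e' g p e'']] by fastforce
qed (simp add: hspan_zero)

lemma hspan_mono: "hspan n G e u \<Longrightarrow> G \<subseteq> G' \<Longrightarrow> hspan n G' e u"
  using hspan_gen[of _ _ G' 1 n 0] by (elim hspan_trans) auto

lemma gsub_minus:
  assumes "gsub n ds Z" "u \<in> Z e" "v \<in> Z e'" "p \<in> forms n e''" "e = e'' + e'"
  shows "u - p *\<^sub>p v \<in> Z e"
proof -
  have "(- p) *\<^sub>p v \<in> Z (e'' + e')"
    using assms(1,3) forms_uminus[OF assms(4)] unfolding gsub_def by blast
  then have "u + (- p) *\<^sub>p v \<in> Z e"
    using assms(1,2,5) unfolding gsub_def by blast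
  then show ?thesis by simp
qed

text \<open>The order on exponent vectors is compatible with addition, so the subtracted multiple of
  \<open>q\<close> has the same leading monomial as \<open>p\<close>, and the coefficient is chosen
  to cancel it.\<close>

lemma lead_reduce:
  fixes p q :: "'k::field mpoly"
  assumes "p \<noteq> 0" "q \<noteq> 0" "Max (keys p) = Max (keys q) + r"
    and "p' = p - single r (lookup p (Max (keys p)) /
        lookup q (Max (keys q))) * q"
    and "p' \<noteq> 0"
  shows "Max (keys p') < Max (keys p)"
proof -
  let ?m = "Max (keys p)" and ?t = "Max (keys q)"
  let ?c = "lookup p ?m / lookup q ?t"
  have t: "?t \<in> keys q" using assms(2) by (intro Max_in) auto
  have "x < ?m" if x: "x \<in> keys p'" for x
  proof -
    have "x \<in> keys p \<union> keys (single r ?c * q)"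
      using x keys_diff[of p "single r ?c * q"] unfolding assms(4) by (rule rev_subsetD)
    then have "x \<le> ?m"
    proof
      assume "x \<in> keys (single r ?c * q)"
      then obtain b where "b \<in> keys q" "x = r + b"
        by (auto dest!: keys_mult_mpoly split: if_splits)
      then show ?thesis using assms(3) by (simp add: add.commute[of _ r] add_left_mono)
    qed simp
    moreover have "lookup p' ?m = 0"
      using t unfolding assms(4) lookup_minus
      by (subst (3) assms(3), subst add.commute, subst lookup_single_mult) (simp add: in_keys_iff)
    then have "x \<noteq> ?m" using x by (auto simp: in_keys_iff)
    ultimately show ?thesis by simp
  qed
  then show ?thesis using assms(5) by simp
qed

text \<open>The Hilbert basis theorem for graded submodules, by induction on the number
  \<open>k\<close> of entries that may be nonzero. Elements with vanishing last entry are covered by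
  the induction hypothesis; the leading monomials of the last entries are multiples of finitely many
  by Dickson's lemma, and reduction by vectors with these leading monomials kills the last
  entry.\<close>

lemma gsub_finitely_generated:
  assumes "gsub n ds Z" "\<And>e u a. u \<in> Z e \<Longrightarrow> k \<le> a \<Longrightarrow> u a = 0"
  shows "\<exists>G. finite G \<and> (\<forall>x\<in>G. snd x \<in> Z (fst x)) \<and> (\<forall>e. \<forall>u\<in>Z e. hspan n G e u)"
  using assms
proof (induction k arbitrary: Z)
  case 0
  then have "u = 0" if "u \<in> Z e" for u e using that by (auto simp: fun_eq_iff)
  then show ?case by (intro exI[of _ "{}"]) (auto intro: hspan_zero)
next
  case (Suc k)
  let ?Z' = "\<lambda>e. {u \<in> Z e. u k = 0}"
  have "gsub n ds ?Z'" using Suc.prems(1) by (auto simp: gsub_def)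
  moreover have "u a = 0" if "u \<in> ?Z' e" "k \<le> a" for e u a
    using that Suc.prems(2)[of u e a] by (cases "a = k") auto
  ultimately have "\<exists>G. finite G \<and> (\<forall>x\<in>G. snd x \<in> ?Z' (fst x)) \<and> (\<forall>e. \<forall>u\<in>?Z' e. hspan n G e u)"
    by (rule Suc.IH)
  then obtain G' where "finite G' \<and> (\<forall>x\<in>G'. snd x \<in> ?Z' (fst x)) \<and> (\<forall>e. \<forall>u\<in>?Z' e. hspan n G' e u)"
    by (rule exE)
  then have G': "finite G'" "\<And>x. x \<in> G' \<Longrightarrow> snd x \<in> ?Z' (fst x)"
      "\<And>e u. u \<in> ?Z' e \<Longrightarrow> hspan n G' e u"
    by blast+
  have Zg: "u \<in> gvec n ds e" if "u \<in> Z e" for u e using Suc.prems(1) that by (auto simp: gsub_def)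
  let ?lm = "\<lambda>u::'a pvec. Max (keys (u k))"
  let ?M = "{?lm u | u. \<exists>e. u \<in> Z e \<and> u k \<noteq> 0}"
  have lm_keys: "?lm u \<in> keys (u k)" if "u k \<noteq> 0" for u
    using that by (intro Max_in) auto
  have lm: "keys (?lm u) \<subseteq> {1..n} \<and> mdeg (?lm u) + ds ! k = e" if "u \<in> Z e" "u k \<noteq> 0" for u e
    using gvecD[OF Zg[OF that(1)] lm_keys[of u, OF that(2)]] by blast
  have lmM: "keys m \<subseteq> {1..n}" if "m \<in> ?M" for m
    using that lm by blast
  have "\<exists>T\<subseteq>?M. finite T \<and> (\<forall>m\<in>?M. \<exists>t\<in>T. \<exists>r. m = t + r)"
    by (rule dickson_monomials) (rule lmM)
  then obtain T where T_all: "T \<subseteq> ?M \<and> finite T \<and> (\<forall>m\<in>?M. \<exists>t\<in>T. \<exists>r. m = t + r)" by (rule exE)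
  then have T: "T \<subseteq> ?M" "finite T" by (rule conjunct1, elim conjE)
  have T3: "\<exists>t\<in>T. \<exists>r. m = t + r" if "m \<in> ?M" for m
    using conjunct2[OF conjunct2[OF T_all]] that by (rule bspec)
  have "\<forall>t\<in>T. \<exists>x. snd x \<in> Z (fst x) \<and> snd x k \<noteq> 0 \<and> t = ?lm (snd x)"
    using T(1) by fastforce
  then obtain h where h: "\<And>t. t \<in> T \<Longrightarrow> snd (h t) \<in> Z (fst (h t)) \<and> snd (h t) k \<noteq> 0 \<and> t = ?lm (snd (h t))"
    by metis
  let ?G = "G' \<union> h ` T"
  have "hspan n ?G e u" if "u \<in> Z e" for e u
    using that
  \<comment> \<open>Termination uses the degree: finitely many monomials of degree
    \<open>e - ds ! k\<close> can be leading monomials, so the number of those below the current one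
    is a measure.\<close>
  proof (induction "card {m. keys m \<subseteq> {1..n} \<and> mdeg m = e - ds ! k \<and> m < ?lm u}"
      arbitrary: u rule: less_induct)
    case less
    show ?case
    proof (cases "u k = 0")
      case True
      then have "hspan n G' e u" using less.prems G'(3) by blast
      then show ?thesis by (rule hspan_mono) simp
    next
      case False
      then obtain t r where tr: "t \<in> T" "?lm u = t + r"
        using T3[of "?lm u"] less.prems by blast
      obtain e' g where g: "h t = (e', g)" by (cases "h t")
      then have ht: "g \<in> Z e'" "g k \<noteq> 0" "t = ?lm g" using h[OF tr(1)] by auto
      let ?c = "lookup (u k) (?lm u) / lookup (g k) (?lm g)"
      let ?p = "single r ?c"
      let ?u = "u - ?p *\<^sub>p g"
      have r: "?p \<in> forms n (mdeg r)"
        using lm[OF less.prems False] tr(2) by (intro forms_single) (simp add: keys_add_nat)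
      have e: "e = mdeg r + e'"
        using lm[OF less.prems False] lm[OF ht(1,2)] tr(2) ht(3) by (simp add: mdeg_add)
      have u': "?u \<in> Z e" by (rule gsub_minus[OF Suc.prems(1) less.prems ht(1) r e])
      have "hspan n ?G e ?u"
      proof (cases "?u k = 0")
        case True
        then have "hspan n G' e ?u" using u' G'(3) by blast
        then show ?thesis by (rule hspan_mono) simp
      next
        case False': False
        have lt: "?lm ?u < ?lm u"
          using lead_reduce[OF False ht(2) _ _ False', of r] tr(2) ht(3) by simp
        have "{m. keys m \<subseteq> {1..n} \<and> mdeg m = e - ds ! k \<and> m < ?lm ?u} \<subset>
            {m. keys m \<subseteq> {1..n} \<and> mdeg m = e - ds ! k \<and> m < ?lm u}"
          using lt lm[OF u' False'] by (intro psubsetI) (auto dest: order.strict_trans)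
        moreover have "finite {m. keys m \<subseteq> {1..n} \<and> mdeg m = e - ds ! k \<and> m < ?lm u}"
          by (rule finite_subset[OF _ finite_monomials[of n "e - ds ! k"]]) blast
        ultimately show ?thesis
          using less.hyps[OF psubset_card_mono u'] by blast
      qed
      moreover have "hspan n ?G e (?p *\<^sub>p g)"
        using hspan_gen[OF _ r, of e' g ?G] tr(1) g e by (metis UnCI imageI)
      ultimately have "hspan n ?G e (?u + ?p *\<^sub>p g)" using hspan_add by blast
      then show ?thesis by simp
    qed
  qed
  then show ?case using G'(1,2) T(2) h by (intro exI[of _ ?G]) auto
qed

section \<open>Minimal systems of homogeneous generators\<close>

definition generates :: "nat \<Rightarrow> (nat \<Rightarrow> 'k::field pvec set) \<Rightarrow> nat list \<Rightarrow> (nat \<Rightarrow> 'k pvec) \<Rightarrow> bool" where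
  "generates n Z es c \<longleftrightarrow> (\<forall>b<length es. c b \<in> Z (es ! b)) \<and>
     (\<forall>e. \<forall>u\<in>Z e. \<exists>v\<in>gvec n es e. u = lin (length es) c v)"

text \<open>The kernel lies in the maximal ideal times the free module. For the map onto chosen
  generators this expresses their minimality, and it keeps the next differential of a resolution
  free of constant terms.\<close>

definition const_free_kernel :: "nat \<Rightarrow> nat list \<Rightarrow> ('k::field pvec \<Rightarrow> 'k pvec) \<Rightarrow> bool" where
  "const_free_kernel n es f \<longleftrightarrow>
     (\<forall>e. \<forall>v\<in>gvec n es e. f v = 0 \<longrightarrow> (\<forall>b. lookup (v b) 0 = 0))"

lemma hspan_lin:
  assumes "hspan n (set xs) e u"
  shows "\<exists>v\<in>gvec n (map fst xs) e. u = lin (length xs) (\<lambda>b. snd (xs ! b)) v"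
  using assms
proof (induction rule: hspan.induct)
  case (hspan_zero e)
  show ?case by (rule bexI[of _ 0]) (rule plinear_0[OF plinear_lin, symmetric], rule gvec_0)
next
  case (hspan_step e u e' g p e'')
  then obtain v b where v: "v \<in> gvec n (map fst xs) e" "u = lin (length xs) (\<lambda>b. snd (xs ! b)) v"
    and b: "b < length xs" "xs ! b = (e', g)" by (auto simp: in_set_conv_nth)
  have "p *\<^sub>p bvec b \<in> gvec n (map fst xs) (e'' + map fst xs ! b)"
    using hspan_step(3) b by (intro gvec_pscale gvec_bvec) auto
  then have "v + p *\<^sub>p bvec b \<in> gvec n (map fst xs) e"
    using v(1) b hspan_step(4) by (intro gvec_add) auto
  moreover have "u + p *\<^sub>p g = lin (length xs) (\<lambda>b. snd (xs ! b)) (v + p *\<^sub>p bvec b)"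
    using v(2) b by (simp add: plinear_add[OF plinear_lin] plinear_pscale[OF plinear_lin] lin_bvec)
  ultimately show ?case by blast
qed

text \<open>In a generating set of least cardinality no element lies in the span of the others. A
  relation with a nonzero constant coefficient would violate this, because that coefficient is a
  unit of the ring.\<close>

lemma minimal_generators:
  assumes "gsub n ds Z"
  obtains es c where "generates n Z es c" "const_free_kernel n es (lin (length es) c)"
proof -
  let ?P = "\<lambda>G. finite G \<and> (\<forall>x\<in>G. snd x \<in> Z (fst x)) \<and> (\<forall>e. \<forall>u\<in>Z e. hspan n G e u)"
  have "u a = 0" if "u \<in> Z e" "length ds \<le> a" for e u a
    using assms gvec_outside[OF _ that(2), of u n e] that(1) unfolding gsub_def by blast
  then have "\<exists>G. ?P G" by (rule gsub_finitely_generated[OF assms])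
  then obtain G0 where "?P G0" by (rule exE)
  from ex_has_least_nat[of ?P G0 card, OF this]
  obtain G where "?P G \<and> (\<forall>G'. ?P G' \<longrightarrow> card G \<le> card G')" by (rule exE)
  then have G: "?P G" and least: "\<forall>G'. ?P G' \<longrightarrow> card G \<le> card G'" by (rule conjunct1, rule conjunct2)
  have irred: "\<not> hspan n (G - {x}) (fst x) (snd x)" if x: "x \<in> G" for x
  proof
    assume *: "hspan n (G - {x}) (fst x) (snd x)"
    have gen: "hspan n (G - {x}) (fst y) (snd y)" if "y \<in> G" for y
    proof (cases "y = x")
      case False
      then show ?thesis using hspan_gen[of "fst y" "snd y" "G - {x}" 1 n 0] that by simp
    qed (use * in simp)
    have "hspan n (G - {x}) e u" if "u \<in> Z e" for e u
      using hspan_trans[OF _ gen] G that by blast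
    moreover have "\<forall>y\<in>G - {x}. snd y \<in> Z (fst y)" using G by (intro ballI) simp
    ultimately have "?P (G - {x})" using G by (intro conjI allI ballI) simp_all
    from least[rule_format, OF this] card_Diff1_less[OF _ x] G show False by simp
  qed
  obtain xs where xs: "set xs = G" "distinct xs"
    using finite_distinct_list[OF conjunct1[OF G]] by blast
  let ?c = "\<lambda>b. snd (xs ! b)" and ?es = "map fst xs"
  have "generates n Z ?es ?c"
    unfolding generates_def
  proof (intro conjI allI impI ballI)
    fix b assume "b < length ?es"
    then show "?c b \<in> Z (?es ! b)" using G xs(1) by auto
  next
    fix e u assume "u \<in> Z e"
    then have "hspan n (set xs) e u" using G xs(1) by blast
    from hspan_lin[OF this] show "\<exists>v\<in>gvec n ?es e. u = lin (length ?es) ?c v" by simp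
  qed
  moreover have "const_free_kernel n ?es (lin (length ?es) ?c)"
    unfolding const_free_kernel_def
  proof (intro allI ballI impI, rule ccontr)
    fix e v b
    assume v: "v \<in> gvec n ?es e" and 0: "lin (length ?es) ?c v = 0"
      and k: "lookup (v b) 0 \<noteq> 0"
    let ?k = "lookup (v b) 0"
    have b: "b < length xs" "fst (xs ! b) = e"
      using gvecD[OF v, of 0 b] k by (auto simp: in_keys_iff)
    \<comment> \<open>A constant term in entry \<open>b\<close> forces the degree of the generator
      \<open>xs ! b\<close> to be \<open>e\<close>, so the whole entry is a nonzero constant and can
      be inverted.\<close>
    have "v b \<in> forms n 0" using gvec_forms[OF v, of b] b by simp
    then have vb: "v b = single 0 ?k" by (rule forms_zero_const)
    let ?S = "\<Sum>a\<in>{..<length xs} - {b}. v a *\<^sub>p ?c a"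
    have "v b *\<^sub>p ?c b + ?S = 0"
      using 0 b(1) by (simp add: lin_def sum.remove[of "{..<length xs}" b])
    then have S: "v b *\<^sub>p ?c b = - ?S" by (simp add: eq_neg_iff_add_eq_0)
    have "?c b = single 0 (1 / ?k) *\<^sub>p v b *\<^sub>p ?c b"
      using k by (subst vb) (simp add: pscale_pscale mult_single)
    also have "\<dots> = single 0 (- 1 / ?k) *\<^sub>p ?S"
      unfolding S by (simp add: single_uminus)
    finally have cb: "?c b = single 0 (- 1 / ?k) *\<^sub>p ?S" .
    have "hspan n (G - {xs ! b}) e ?S"
    proof (rule hspan_sum)
      fix a assume a: "a \<in> {..<length xs} - {b}"
      show "hspan n (G - {xs ! b}) e (v a *\<^sub>p ?c a)"
      proof (cases "?es ! a \<le> e")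
        case True
        have "(fst (xs ! a), snd (xs ! a)) \<in> G - {xs ! b}"
          using a b(1) xs nth_eq_iff_index_eq[OF xs(2)] by auto
        from hspan_gen[OF this gvec_forms[OF v _ True]] show ?thesis using a True by simp
      next
        case False
        then show ?thesis using gvec_low[OF v, of a] by (simp add: hspan_zero)
      qed
    qed
    from hspan_pscale[OF this forms_const, of "- 1 / ?k"] cb
    have "hspan n (G - {xs ! b}) e (?c b)" by simp
    then have "hspan n (G - {xs ! b}) (fst (xs ! b)) (snd (xs ! b))" using b(2) by (cases "xs ! b") simp
    then show False using irred[of "xs ! b"] b(1) xs(1) by auto
  qed
  ultimately show thesis by (rule that)
qed

text \<open>The closure laws of a homogeneous ideal in terms of the operations of the type.
  Containment in the carrier is kept apart and added where the ring-theoretic predicate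
  \<open>ideal\<close> has to be established.\<close>

definition hideal :: "nat \<Rightarrow> 'k::field mpoly set \<Rightarrow> bool" where
  "hideal n L \<longleftrightarrow> 0 \<in> L \<and> (\<forall>p\<in>L. \<forall>q\<in>L. p + q \<in> L) \<and>
     (\<forall>q\<in>carrier (polyring n). \<forall>p\<in>L. q * p \<in> L) \<and> (\<forall>p\<in>L. \<forall>d. hcomponent d p \<in> L)"

definition aug :: "nat \<Rightarrow> (nat \<Rightarrow> 'k::field mpoly) \<Rightarrow> 'k pvec \<Rightarrow> 'k mpoly" where
  "aug k g u = (\<Sum>a<k. u a * g a)"

text \<open>Exactness is formulated strand by strand on homogeneous vectors, where all spaces have
  finite dimension and induction on the degree is possible. Each equivalence contains both the
  complex property and exactness; minimality is split off into \<open>gmin\<close>.\<close>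

definition gres :: "nat \<Rightarrow> 'k::field mpoly set \<Rightarrow> (nat \<Rightarrow> nat list) \<Rightarrow> (nat \<Rightarrow> 'k mpoly) \<Rightarrow>
    (nat \<Rightarrow> 'k pvec \<Rightarrow> 'k pvec) \<Rightarrow> bool" where
  "gres n L F g d \<longleftrightarrow>
     (\<forall>a<length (F 0). g a \<in> forms n (F 0 ! a)) \<and>
     (\<forall>i. glin n (F (Suc i)) (F i) (d i)) \<and>
     (\<forall>e. \<forall>p\<in>forms n e. \<exists>u\<in>gvec n (F 0) e. p - aug (length (F 0)) g u \<in> L) \<and>
     (\<forall>e. \<forall>u\<in>gvec n (F 0) e. aug (length (F 0)) g u \<in> L \<longleftrightarrow> (\<exists>v\<in>gvec n (F 1) e. u = d 0 v)) \<and>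
     (\<forall>i e. \<forall>u\<in>gvec n (F (Suc i)) e. d i u = 0 \<longleftrightarrow> (\<exists>v\<in>gvec n (F (Suc (Suc i))) e. u = d (Suc i) v))"

definition gmin :: "(nat \<Rightarrow> nat list) \<Rightarrow> (nat \<Rightarrow> 'k::field pvec \<Rightarrow> 'k pvec) \<Rightarrow> bool" where
  "gmin F d \<longleftrightarrow> (\<forall>i. \<forall>b<length (F (Suc i)). \<forall>a. lookup (d i (bvec b) a) 0 = 0)"

lemma forms_carrier: "p \<in> forms n e \<Longrightarrow> p \<in> carrier (polyring n)"
  by (simp add: forms_def)

lemma hideal_0: "hideal n L \<Longrightarrow> 0 \<in> L"
  and hideal_add: "hideal n L \<Longrightarrow> p \<in> L \<Longrightarrow> q \<in> L \<Longrightarrow> p + q \<in> L"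
  and hideal_mult: "hideal n L \<Longrightarrow> q \<in> carrier (polyring n) \<Longrightarrow> p \<in> L \<Longrightarrow> q * p \<in> L"
  and hideal_hcomponent: "hideal n L \<Longrightarrow> p \<in> L \<Longrightarrow> hcomponent d p \<in> L"
  by (auto simp: hideal_def)

lemma hideal_uminus: "hideal n L \<Longrightarrow> p \<in> L \<Longrightarrow> - p \<in> L"
  using hideal_mult[of n L "- 1" p] forms_carrier[OF forms_uminus[OF forms_1]] by fastforce

lemma hideal_diff: "hideal n L \<Longrightarrow> p \<in> L \<Longrightarrow> q \<in> L \<Longrightarrow> p - q \<in> L"
  using hideal_add[of n L p "- q"] hideal_uminus by fastforce

lemma hideal_sum: "hideal n L \<Longrightarrow> (\<And>i. i \<in> A \<Longrightarrow> f i \<in> L) \<Longrightarrow> sum f A \<in> L"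
  by (induction A rule: infinite_finite_induct) (auto intro: hideal_add hideal_0)

lemma hideal_subspace: "hideal n L \<Longrightarrow> kp.subspace L"
  unfolding kp.subspace_def by (auto intro: hideal_add hideal_0 hideal_mult forms_carrier[OF
      forms_const])

text \<open>The ideal as a graded submodule of the free module of rank one with its generator in
  degree 0; a vector carries its polynomial in entry 0.\<close>

definition ideal_gvec :: "nat \<Rightarrow> 'k::field mpoly set \<Rightarrow> nat \<Rightarrow> 'k pvec set" where
  "ideal_gvec n L e = {u \<in> gvec n [0] e. u 0 \<in> L}"

lemma gsub_ideal: "hideal n L \<Longrightarrow> gsub n [0] (ideal_gvec n L)"
  by (auto simp: gsub_def ideal_gvec_def hideal_0 hideal_add hideal_mult forms_carrier
      intro: gvec_add gvec_pscale)

text \<open>Iterated syzygies with minimal generators at each step. The first generators are an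
  argument, so that a known minimal generating set of \<open>L\<close> can be imposed as
  \<open>F 1\<close>; for face ideals this gives the first Betti numbers.\<close>

lemma minimal_resolution_extends:
  fixes L :: "'k::field mpoly set"
  assumes L: "hideal n L" "1 \<notin> L"
    and gen: "generates n (ideal_gvec n L) es c" "const_free_kernel n es (lin (length es) c)"
  obtains F d where "gres n L F (\<lambda>_. 1) d" "gmin F d" "F 0 = [0]" "F 1 = es"
proof -
  \<comment> \<open>A state consists of the generator degrees of \<open>F (Suc i)\<close> and the
    differential out of it; the clause for \<open>i = 0\<close> fixes the given generators.\<close>
  let ?P = "\<lambda>i (x :: nat list \<times> ('k pvec \<Rightarrow> 'k pvec)).
    const_free_kernel n (fst x) (snd x) \<and> plinear (snd x) \<and> (i = 0 \<longrightarrow> x = (es, lin (length es) c))"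
  let ?Q = "\<lambda>(i::nat) (x :: nat list \<times> ('k pvec \<Rightarrow> 'k pvec)) y. glin n (fst y) (fst x) (snd y) \<and>
    (\<forall>e. \<forall>u\<in>gvec n (fst x) e. snd x u = 0 \<longleftrightarrow> (\<exists>v\<in>gvec n (fst y) e. u = snd y v))"
  have "\<exists>s. \<forall>i. ?P i (s i) \<and> ?Q i (s i) (s (Suc i))"
  proof (rule dependent_nat_choice)
    show "\<exists>x. ?P 0 x" using gen(2) plinear_lin by auto
  next
    fix x :: "nat list \<times> ('k pvec \<Rightarrow> 'k pvec)" and i :: nat
    assume x: "?P i x"
    let ?Z = "\<lambda>e. {u \<in> gvec n (fst x) e. snd x u = 0}"
    have lin: "plinear (snd x)" using x by blast
    have "gsub n (fst x) ?Z"
      by (auto simp: gsub_def plinear_0[OF lin] plinear_add[OF lin] plinear_pscale[OF lin] intro: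
          gvec_add gvec_pscale)
    then obtain fs c' where fs: "generates n ?Z fs c'" "const_free_kernel n fs (lin (length fs) c')"
      by (rule minimal_generators)
    have c': "c' b \<in> gvec n (fst x) (fs ! b)" "snd x (c' b) = 0" if "b < length fs" for b
      using fs(1) that by (auto simp: generates_def)
    have "snd x (lin (length fs) c' v) = 0" if "v \<in> gvec n fs e" for v e
      using plinear_eq_on_gvec[OF plinear_comp[OF lin plinear_lin] plinear_zero that] c'(2)
          by (simp add: lin_bvec)
    moreover have "\<exists>v\<in>gvec n fs e. u = lin (length fs) c' v" if "u \<in> gvec n (fst x) e" "snd x u = 0"
        for u e
      using fs(1) that by (auto simp: generates_def)
    ultimately have "?Q i x (fs, lin (length fs) c')"
      using glin_lin[OF c'(1)] by auto
    then show "\<exists>y. ?P (Suc i) y \<and> ?Q i x y"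
      using fs(2) plinear_lin by (intro exI[of _ "(fs, lin (length fs) c')"]) auto
  qed
  then obtain s where "\<forall>i. ?P i (s i) \<and> ?Q i (s i) (s (Suc i))" by (rule exE)
  note s = spec[OF this, THEN conjunct1] spec[OF this, THEN conjunct2]
  define F where "F i = (case i of 0 \<Rightarrow> [0] | Suc j \<Rightarrow> fst (s j))" for i
  define d where "d i = snd (s i)" for i
  have F: "F 0 = [0]" "F (Suc 0) = es" "F (Suc i) = fst (s i)" for i
    using s(1)[of 0] by (auto simp: F_def)
  have d0: "d 0 = lin (length es) c" using s(1)[of 0] by (simp add: d_def)
  have cL: "c b \<in> gvec n [0] (es ! b)" "c b 0 \<in> L" if "b < length es" for b
    using gen(1) that by (auto simp: generates_def ideal_gvec_def)
  have glin: "glin n (F (Suc i)) (F i) (d i)" for i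
  proof (cases i)
    case 0
    then show ?thesis using glin_lin[OF cL(1)] by (simp add: F(1,2) d0)
  next
    case (Suc j)
    then show ?thesis using s(2)[of j] by (simp add: F d_def)
  qed
  have aug: "aug (length (F 0)) (\<lambda>_. 1) u = u 0" for u :: "'k pvec"
    by (simp add: aug_def F)
  have ex0: "u 0 \<in> L \<longleftrightarrow> (\<exists>v\<in>gvec n es e. u = lin (length es) c v)" if "u \<in> gvec n [0] e" for u e
  proof
    assume "u 0 \<in> L"
    then show "\<exists>v\<in>gvec n es e. u = lin (length es) c v"
      using that gen(1) by (auto simp: generates_def ideal_gvec_def)
  next
    assume "\<exists>v\<in>gvec n es e. u = lin (length es) c v"
    then obtain v where v: "v \<in> gvec n es e" "u = lin (length es) c v" by blast
    have "v b * c b 0 \<in> L" if "b < length es" for b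
    proof (cases "es ! b \<le> e")
      case True
      then show ?thesis using hideal_mult[OF L(1) forms_carrier[OF gvec_forms[OF v(1)]] cL(2)] that
          by blast
    next
      case False
      then show ?thesis using gvec_low[OF v(1), of b] hideal_0[OF L(1)] by simp
    qed
    then show "u 0 \<in> L" unfolding v(2) lin_def sum_fun_apply by (intro hideal_sum[OF L(1)]) simp
  qed
  have "gres n L F (\<lambda>_. 1) d"
    unfolding gres_def
  proof (intro conjI allI ballI impI)
    fix a assume "a < length (F 0)"
    then show "1 \<in> forms n (F 0 ! a)" by (simp add: F)
  next
    fix e and p :: "'k mpoly" assume "p \<in> forms n e"
    then show "\<exists>u\<in>gvec n (F 0) e. p - aug (length (F 0)) (\<lambda>_. 1) u \<in> L"
      using hideal_0[OF L(1)]
      by (intro bexI[of _ "\<lambda>a. if a = 0 then p else 0"]) (auto simp: aug_def F gvec_iff)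
  next
    fix e and u :: "'k pvec" assume "u \<in> gvec n (F 0) e"
    then show "aug (length (F 0)) (\<lambda>_. 1) u \<in> L \<longleftrightarrow> (\<exists>v\<in>gvec n (F 1) e. u = d 0 v)"
      using ex0[of u e] unfolding aug One_nat_def F(2) d0 by (simp add: F(1))
  next
    fix i e and u :: "'k pvec" assume "u \<in> gvec n (F (Suc i)) e"
    then show "d i u = 0 \<longleftrightarrow> (\<exists>v\<in>gvec n (F (Suc (Suc i))) e. u = d (Suc i) v)"
      using s(2)[of i] by (simp add: F(3) d_def)
  qed (rule glin)
  moreover have "gmin F d"
    unfolding gmin_def
  proof (intro allI impI)
    fix i b a assume b: "b < length (F (Suc i))"
    have db: "d i (bvec b) \<in> gvec n (F i) (F (Suc i) ! b)"
      using glin_gvec[OF glin gvec_bvec[OF b]] .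
    show "lookup (d i (bvec b) a) 0 = 0"
    proof (cases i)
      case 0
      then have b': "b < length es" using b F by simp
      have dcb: "d i (bvec b) = c b" using 0 b' by (simp add: d0 lin_bvec)
      show ?thesis
      proof (rule ccontr)
        \<comment> \<open>A constant term makes this generator of \<open>L\<close> a nonzero
          constant, and multiplication by its inverse would put 1 into \<open>L\<close>.\<close>
        assume *: "lookup (d i (bvec b) a) 0 \<noteq> 0"
        let ?k = "lookup (c b 0) 0"
        have a: "a = 0" "es ! b = 0"
          using gvecD[OF cL(1)[OF b'], of 0 a] * dcb by (auto simp: in_keys_iff)
        have "c b 0 = single 0 ?k"
          using gvec_forms[OF cL(1)[OF b'], of 0] a(2) by (intro forms_zero_const[of _ n]) simp
        then have "single 0 (1 / ?k) * c b 0 = single 0 (1 / ?k) * single 0 ?k"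
          by simp
        also have "\<dots> = 1" using * a dcb by (simp add: mult_single)
        finally show False
          using hideal_mult[OF L(1) forms_carrier[OF forms_const] cL(2)[OF b'], of "1 / ?k"] L(2)
              by simp
      qed
    next
      case (Suc j)
      \<comment> \<open>The column is a cycle for the previous map, whose kernel has no constant
        terms by the choice of generators.\<close>
      have "d j (d i (bvec b)) = 0"
        using s(2)[of j] db gvec_bvec[OF b, of n] Suc by (auto simp: F(3) d_def)
      then show ?thesis
        using s(1)[of j] db Suc unfolding const_free_kernel_def by (auto simp: F(3) d_def)
    qed
  qed
  moreover have "F 1 = es" using F(2) by simp
  ultimately show thesis using F(1) by (intro that[of F d])
qed

lemma minimal_resolution_exists:
  assumes "hideal n L" "1 \<notin> L"
  obtains F d where "gres n L F (\<lambda>_. 1) d" "gmin F d" "F 0 = [0]"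
  using minimal_generators[OF gsub_ideal[OF assms(1)]] minimal_resolution_extends[OF assms] by metis

section \<open>Comparison of resolutions\<close>

lemma aug_lin: "aug r g (lin k c u) = (\<Sum>b<k. u b * aug r g (c b))"
proof -
  have "aug r g (lin k c u) = (\<Sum>a<r. \<Sum>b<k. u b * (c b a * g a))"
    by (simp add: aug_def lin_def sum_fun_apply sum_distrib_right mult.assoc)
  also have "\<dots> = (\<Sum>b<k. \<Sum>a<r. u b * (c b a * g a))" by (rule sum.swap)
  also have "\<dots> = (\<Sum>b<k. u b * aug r g (c b))" by (simp add: aug_def sum_distrib_left)
  finally show ?thesis .
qed

lemma aug_add: "aug r g (u + v) = aug r g u + aug r g v"
  and aug_diff: "aug r g (u - v) = aug r g u - aug r g v"
  and aug_pscale: "aug r g (p *\<^sub>p u) = p * aug r g u"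
  by (auto simp: aug_def sum.distrib sum_subtractf sum_distrib_left algebra_simps)

lemma gresD:
  assumes "gres n L F g d"
  shows "a < length (F 0) \<Longrightarrow> g a \<in> forms n (F 0 ! a)"
    and "glin n (F (Suc i)) (F i) (d i)"
    and "p \<in> forms n e \<Longrightarrow> \<exists>u\<in>gvec n (F 0) e. p - aug (length (F 0)) g u \<in> L"
    and "u \<in> gvec n (F 0) e \<Longrightarrow> aug (length (F 0)) g u \<in> L \<Longrightarrow> \<exists>v\<in>gvec n (F (Suc 0)) e. u = d 0 v"
    and "v \<in> gvec n (F (Suc 0)) e \<Longrightarrow> aug (length (F 0)) g (d 0 v) \<in> L"
    and "u \<in> gvec n (F (Suc i)) e \<Longrightarrow> d i u = 0 \<Longrightarrow> \<exists>v\<in>gvec n (F (Suc (Suc i))) e. u = d (Suc i) v"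
    and "v \<in> gvec n (F (Suc (Suc i))) e \<Longrightarrow> d i (d (Suc i) v) = 0"
proof -
  have glin: "glin n (F (Suc i)) (F i) (d i)" for i using assms by (simp add: gres_def)
  show "a < length (F 0) \<Longrightarrow> g a \<in> forms n (F 0 ! a)"
    and "glin n (F (Suc i)) (F i) (d i)"
    and "p \<in> forms n e \<Longrightarrow> \<exists>u\<in>gvec n (F 0) e. p - aug (length (F 0)) g u \<in> L"
    and "u \<in> gvec n (F 0) e \<Longrightarrow> aug (length (F 0)) g u \<in> L \<Longrightarrow> \<exists>v\<in>gvec n (F (Suc 0)) e. u = d 0 v"
    and "u \<in> gvec n (F (Suc i)) e \<Longrightarrow> d i u = 0 \<Longrightarrow> \<exists>v\<in>gvec n (F (Suc (Suc i))) e. u = d (Suc i) v"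
    using assms by (simp_all add: gres_def)
  show "v \<in> gvec n (F (Suc 0)) e \<Longrightarrow> aug (length (F 0)) g (d 0 v) \<in> L"
    using assms glin_gvec[OF glin, of v 0 e] unfolding gres_def by (metis One_nat_def)
  show "v \<in> gvec n (F (Suc (Suc i))) e \<Longrightarrow> d i (d (Suc i) v) = 0"
    using assms glin_gvec[OF glin, of v "Suc i" e] unfolding gres_def by metis
qed

text \<open>\<open>F\<close> is free and \<open>G\<close> is exact, so the projection of
  \<open>R/L\<close> onto \<open>R/L'\<close> lifts index by index. Equal ideals serve the
  uniqueness of Betti numbers; an inclusion that may be strict occurs in the mapping cone.\<close>

lemma comparison_map:
  fixes L L' :: "'k::field mpoly set"
  assumes F: "gres n L F gF dF" and G: "gres n L' G gG dG" and L': "hideal n L'" "L \<subseteq> L'"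
  obtains P where "\<And>i. glin n (F i) (G i) (P i)"
    "\<And>e u. u \<in> gvec n (F 0) e \<Longrightarrow> aug (length (G 0)) gG (P 0 u) - aug (length (F 0)) gF u \<in> L'"
    "\<And>i e u. u \<in> gvec n (F (Suc i)) e \<Longrightarrow> P i (dF i u) = dG i (P (Suc i) u)"
proof -
  \<comment> \<open>The middle conjunct is what the next step consumes: composed with the
    differential of \<open>F\<close>, the map takes values in the image of the differential of
    \<open>G\<close>.\<close>
  let ?inv = "\<lambda>i (P :: 'k pvec \<Rightarrow> 'k pvec). glin n (F i) (G i) P \<and>
    (\<forall>e. \<forall>u\<in>gvec n (F (Suc i)) e. \<exists>v\<in>gvec n (G (Suc i)) e. P (dF i u) = dG i v) \<and>
    (i = 0 \<longrightarrow> (\<forall>e. \<forall>u\<in>gvec n (F 0) e. aug (length (G 0)) gG (P u) - aug (length (F 0)) gF u \<in> L'))"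
  let ?step = "\<lambda>i P P'. \<forall>e. \<forall>u\<in>gvec n (F (Suc i)) e. P (dF i u) = dG i (P' u)"
  have "\<exists>P. \<forall>i. ?inv i (P i) \<and> ?step i (P i) (P (Suc i))"
  proof (rule dependent_nat_choice)
    have "\<exists>u\<in>gvec n (G 0) (F 0 ! b). gF b - aug (length (G 0)) gG u \<in> L'" if "b < length (F 0)" for b
      using gresD(3)[OF G gresD(1)[OF F that]] .
    then obtain c where c: "\<And>b. b < length (F 0) \<Longrightarrow> c b \<in> gvec n (G 0) (F 0 ! b)"
        "\<And>b. b < length (F 0) \<Longrightarrow> gF b - aug (length (G 0)) gG (c b) \<in> L'"
      by metis
    let ?P = "lin (length (F 0)) c"
    have P: "glin n (F 0) (G 0) ?P" by (rule glin_lin[OF c(1)])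
    have augP: "aug (length (G 0)) gG (?P u) - aug (length (F 0)) gF u \<in> L'"
        if u: "u \<in> gvec n (F 0) e" for u e
    proof -
      have "aug (length (G 0)) gG (?P u) - aug (length (F 0)) gF u =
          (\<Sum>b<length (F 0). u b * (- (gF b - aug (length (G 0)) gG (c b))))"
        unfolding aug_lin by (simp add: aug_def[of "length (F 0)" gF] sum_subtractf right_diff_distrib)
      also have "\<dots> \<in> L'"
      proof (rule hideal_sum[OF L'(1)])
        fix b assume b: "b \<in> {..<length (F 0)}"
        show "u b * (- (gF b - aug (length (G 0)) gG (c b))) \<in> L'"
        proof (cases "F 0 ! b \<le> e")
          case True
          then show ?thesis using b
            by (intro hideal_mult[OF L'(1)] hideal_uminus[OF L'(1)] forms_carrier[OF gvec_forms[OF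
                u]] c(2)) auto
        next
          case False
          then show ?thesis using gvec_low[OF u, of b] hideal_0[OF L'(1)] by simp
        qed
      qed
      finally show ?thesis .
    qed
    have "\<exists>v\<in>gvec n (G (Suc 0)) e. ?P (dF 0 u) = dG 0 v" if u: "u \<in> gvec n (F (Suc 0)) e" for u e
    proof (rule gresD(4)[OF G])
      have u': "dF 0 u \<in> gvec n (F 0) e" by (rule glin_gvec[OF gresD(2)[OF F] u])
      then show "?P (dF 0 u) \<in> gvec n (G 0) e" by (rule glin_gvec[OF P])
      have "aug (length (F 0)) gF (dF 0 u) \<in> L'" using gresD(5)[OF F u] L'(2) by blast
      from hideal_add[OF L'(1) augP[OF u'] this]
      show "aug (length (G 0)) gG (?P (dF 0 u)) \<in> L'" by simp
    qed
    then show "\<exists>P. ?inv 0 P" using P augP by (intro exI[of _ ?P]) blast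
  next
    fix P i assume P: "?inv i P"
    have gP: "glin n (F i) (G i) P" using P by blast
    have PdF: "plinear (\<lambda>u. P (dF i u))"
      by (rule plinear_comp[OF glin_plinear[OF gP] glin_plinear[OF gresD(2)[OF F]]])
    have ex: "\<exists>v\<in>gvec n (G (Suc i)) (F (Suc i) ! b). P (dF i (bvec b)) = dG i v"
        if "b < length (F (Suc i))" for b
      using P gvec_bvec[OF that, of n] by blast
    obtain P' where P': "glin n (F (Suc i)) (G (Suc i)) P'"
        "\<And>e u. u \<in> gvec n (F (Suc i)) e \<Longrightarrow> P (dF i u) = dG i (P' u)"
      using glin_lift[OF PdF glin_plinear[OF gresD(2)[OF G]] ex] by metis
    have "\<exists>v\<in>gvec n (G (Suc (Suc i))) e. P' (dF (Suc i) u) = dG (Suc i) v"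
        if u: "u \<in> gvec n (F (Suc (Suc i))) e" for u e
    proof (rule gresD(6)[OF G])
      have u': "dF (Suc i) u \<in> gvec n (F (Suc i)) e" by (rule glin_gvec[OF gresD(2)[OF F] u])
      then show "P' (dF (Suc i) u) \<in> gvec n (G (Suc i)) e" by (rule glin_gvec[OF P'(1)])
      show "dG i (P' (dF (Suc i) u)) = 0"
        using P'(2)[OF u'] gresD(7)[OF F u] plinear_0[OF glin_plinear[OF gP]] by simp
    qed
    then show "\<exists>P'. ?inv (Suc i) P' \<and> ?step i P P'" using P' by (intro exI[of _ P']) blast
  qed
  then obtain P where "\<forall>i. ?inv i (P i) \<and> ?step i (P i) (P (Suc i))" by (rule exE)
  note P = spec[OF this, THEN conjunct1] spec[OF this, THEN conjunct2]
  show thesis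
  proof (rule that)
    show "glin n (F i) (G i) (P i)" for i using P(1) by blast
    show "aug (length (G 0)) gG (P 0 u) - aug (length (F 0)) gF u \<in> L'" if "u \<in> gvec n (F 0) e" for e u
      using P(1)[of 0] that by blast
    show "P i (dF i u) = dG i (P (Suc i) u)" if "u \<in> gvec n (F (Suc i)) e" for i e u
      using P(2)[of i] that by blast
  qed
qed

text \<open>The chain map \<open>T\<close> induces 0 on \<open>R/L\<close>. Once \<open>h\<close> is
  known in one index, \<open>T - h d\<close> in the next index takes values in a kernel, hence in an
  image, and is lifted along the differential.\<close>

lemma null_homotopy:
  fixes L :: "'k::field mpoly set"
  assumes F: "gres n L F g d" and T: "\<And>i. glin n (F i) (F i) (T i)"
    and aug: "\<And>e u. u \<in> gvec n (F 0) e \<Longrightarrow> aug (length (F 0)) g (T 0 u) \<in> L"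
    and chain: "\<And>i e u. u \<in> gvec n (F (Suc i)) e \<Longrightarrow> T i (d i u) = d i (T (Suc i) u)"
  obtains h where "\<And>i. glin n (F i) (F (Suc i)) (h i)"
    "\<And>e u. u \<in> gvec n (F 0) e \<Longrightarrow> T 0 u = d 0 (h 0 u)"
    "\<And>i e u. u \<in> gvec n (F (Suc i)) e \<Longrightarrow> T (Suc i) u = d (Suc i) (h (Suc i) u) + h i (d i u)"
proof -
  \<comment> \<open>The middle conjunct states that \<open>T i - d i h\<close> vanishes on the image
    of \<open>d i\<close>, which makes the difference to be lifted next a cycle.\<close>
  let ?inv = "\<lambda>i (h :: 'k pvec \<Rightarrow> 'k pvec). glin n (F i) (F (Suc i)) h \<and>
    (\<forall>e. \<forall>u\<in>gvec n (F (Suc i)) e. d i (h (d i u)) = T i (d i u)) \<and>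
    (i = 0 \<longrightarrow> (\<forall>e. \<forall>u\<in>gvec n (F 0) e. T 0 u = d 0 (h u)))"
  let ?step = "\<lambda>i h h'. \<forall>e. \<forall>u\<in>gvec n (F (Suc i)) e. T (Suc i) u = d (Suc i) (h' u) + h (d i u)"
  have lind: "plinear (d i)" for i by (rule glin_plinear[OF gresD(2)[OF F]])
  have "\<exists>h. \<forall>i. ?inv i (h i) \<and> ?step i (h i) (h (Suc i))"
  proof (rule dependent_nat_choice)
    have ex: "\<exists>v\<in>gvec n (F (Suc 0)) (F 0 ! b). T 0 (bvec b) = d 0 v" if "b < length (F 0)" for b
      using gresD(4)[OF F glin_gvec[OF T gvec_bvec[OF that]]] aug[OF gvec_bvec[OF that]] by blast
    obtain h where h: "glin n (F 0) (F (Suc 0)) h"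
        "\<And>e u. u \<in> gvec n (F 0) e \<Longrightarrow> T 0 u = d 0 (h u)"
      using glin_lift[OF glin_plinear[OF T] lind ex] by metis
    have "d 0 (h (d 0 u)) = T 0 (d 0 u)" if "u \<in> gvec n (F (Suc 0)) e" for e u
      using h(2)[OF glin_gvec[OF gresD(2)[OF F] that]] by simp
    then show "\<exists>h. ?inv 0 h" using h by (intro exI[of _ h]) blast
  next
    fix h i assume h: "?inv i h"
    have gh: "glin n (F i) (F (Suc i)) h" using h by blast
    let ?f = "\<lambda>u. T (Suc i) u - h (d i u)"
    have gf: "glin n (F (Suc i)) (F (Suc i)) ?f"
      by (rule glin_minus[OF T glin_comp[OF gh gresD(2)[OF F]]])
    have ex: "\<exists>v\<in>gvec n (F (Suc (Suc i))) (F (Suc i) ! b). ?f (bvec b) = d (Suc i) v"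
        if "b < length (F (Suc i))" for b
    proof (rule gresD(6)[OF F])
      have b: "bvec b \<in> gvec n (F (Suc i)) (F (Suc i) ! b)" by (rule gvec_bvec[OF that])
      then show "?f (bvec b) \<in> gvec n (F (Suc i)) (F (Suc i) ! b)" by (rule glin_gvec[OF gf])
      have "d i (h (d i (bvec b))) = T i (d i (bvec b))" using h b by blast
      then show "d i (?f (bvec b)) = 0" using chain[OF b] by (simp add: plinear_diff[OF lind])
    qed
    obtain h' where h': "glin n (F (Suc i)) (F (Suc (Suc i))) h'"
        "\<And>e u. u \<in> gvec n (F (Suc i)) e \<Longrightarrow> ?f u = d (Suc i) (h' u)"
      using glin_lift[OF glin_plinear[OF gf] lind ex] by metis
    have "d (Suc i) (h' (d (Suc i) u)) = T (Suc i) (d (Suc i) u)"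
        if u: "u \<in> gvec n (F (Suc (Suc i))) e" for e u
      using h'(2)[OF glin_gvec[OF gresD(2)[OF F] u]] gresD(7)[OF F u]
      by (simp add: plinear_0[OF glin_plinear[OF gh]])
    moreover have "T (Suc i) u = d (Suc i) (h' u) + h (d i u)" if "u \<in> gvec n (F (Suc i)) e" for e u
      using h'(2)[OF that] by (simp add: algebra_simps)
    ultimately show "\<exists>h'. ?inv (Suc i) h' \<and> ?step i h h'" using h'(1) by (intro exI[of _ h']) blast
  qed
  then obtain h where "\<forall>i. ?inv i (h i) \<and> ?step i (h i) (h (Suc i))" by (rule exE)
  note h = spec[OF this, THEN conjunct1] spec[OF this, THEN conjunct2]
  show thesis
  proof (rule that)
    show "glin n (F i) (F (Suc i)) (h i)" for i using h(1) by blast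
    show "T 0 u = d 0 (h 0 u)" if "u \<in> gvec n (F 0) e" for e u
      using h(1)[of 0] that by blast
    show "T (Suc i) u = d (Suc i) (h (Suc i) u) + h i (d i u)" if "u \<in> gvec n (F (Suc i)) e" for i e u
      using h(2)[of i] that by blast
  qed
qed

lemma lookup_lin_0: "lookup (lin k c u a) 0 =
    (\<Sum>b<k. lookup (u b) 0 * lookup (c b a) 0)"
  by (simp add: lin_def sum_fun_apply lookup_sum lookup_mult_0)

text \<open>Reduction modulo the variables turns a graded map into a matrix over the field, with the
  constant terms of the images of basis vectors as columns.\<close>

lemma glin_lookup_0:
  assumes "glin n es ds f" "u \<in> gvec n es e"
  shows "lookup (f u a) 0 =
    (\<Sum>b<length es. lookup (u b) 0 * lookup (f (bvec b) a) 0)"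
  by (subst plinear_eq_lin[OF glin_plinear[OF assms(1)] assms(2)]) (rule lookup_lin_0)

text \<open>Two indices with equal values would give a relation with coefficients 1 and -1. The
  indexed form is convenient for columns of a matrix, which might repeat a priori.\<close>

lemma (in vector_space) independent_family:
  assumes J: "finite J" and ind: "\<forall>k. (\<Sum>b\<in>J. scale (k b) (x b)) = 0 \<longrightarrow> (\<forall>b\<in>J. k b = 0)"
  shows "inj_on x J" "independent (x ` J)"
proof -
  show inj: "inj_on x J"
  proof (rule inj_onI, rule ccontr)
    fix b b' assume b: "b \<in> J" "b' \<in> J" "x b = x b'" "b \<noteq> b'"
    let ?k = "\<lambda>a. (if a = b then 1 else 0) - (if a = b' then 1 else 0)"
    have "(\<Sum>a\<in>J. scale (?k a) (x a)) = (\<Sum>a\<in>J. (if a = b then x a else 0) - (if a = b' then x a else 0))"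
      by (rule sum.cong) (auto simp: scale_left_diff_distrib)
    also have "\<dots> = 0" using b J by (simp add: sum_subtractf)
    finally show False using ind[rule_format, of ?k b, OF _ b(1)] b(4) by simp
  qed
  show "independent (x ` J)"
  proof (rule independent_if_scalars_zero)
    show "finite (x ` J)" using J by simp
    fix f y assume f: "(\<Sum>y\<in>x ` J. scale (f y) y) = 0" and "y \<in> x ` J"
    then obtain b where b: "b \<in> J" "y = x b" by blast
    have "(\<Sum>b\<in>J. scale (f (x b)) (x b)) = 0" using f by (simp add: sum.reindex[OF inj])
    from ind[rule_format, OF this b(1)] b(2) show "f y = 0" by simp
  qed
qed

lemma (in vector_space) independent_family_card_le:
  assumes "finite J" "finite S" "x ` J \<subseteq> span S"
    and ind: "\<forall>k. (\<Sum>b\<in>J. scale (k b) (x b)) = 0 \<longrightarrow> (\<forall>b\<in>J. k b = 0)"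
  shows "card J \<le> card S"
proof -
  have "card (x ` J) \<le> card S"
    using independent_span_bound[OF assms(2) independent_family(2)[OF assms(1) ind] assms(3)] by blast
  then show ?thesis using card_image[OF independent_family(1)[OF assms(1) ind]] by simp
qed

lemma count_list_eq_card: "count_list xs j = card {b. b < length xs \<and> xs ! b = j}"
  by (simp add: count_list_eq_length_filter length_filter_conv_card eq_commute)

lemma gmin_lookup_0:
  assumes "gres n L F g d" "gmin F d" "v \<in> gvec n (F (Suc i)) e"
  shows "lookup (d i v a) 0 = 0"
  using assms(2) unfolding glin_lookup_0[OF gresD(2)[OF assms(1)] assms(3)] gmin_def by simp

text \<open>
  If the chain maps \<open>P : F \<rightarrow> G\<close> and \<open>Q : G \<rightarrow> F\<close> lift the identity of \<open>R/L\<close>, then \<open>Q P - 1 = d h + h d\<close>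
  vanishes modulo \<open>(x\<^sub>1,\<dots>,x\<^sub>n)\<close>, since \<open>F\<close> is minimal.
\<close>

lemma minimal_resolution_count_le:
  fixes L :: "'k::field mpoly set"
  assumes L: "hideal n L" and F: "gres n L F gF dF" "gmin F dF" and G: "gres n L G gG dG"
  shows "count_list (F i) j \<le> count_list (G i) j"
proof -
  obtain P where P: "\<And>i. glin n (F i) (G i) (P i)"
    "\<And>e u. u \<in> gvec n (F 0) e \<Longrightarrow> aug (length (G 0)) gG (P 0 u) - aug (length (F 0)) gF u \<in> L"
    "\<And>i e u. u \<in> gvec n (F (Suc i)) e \<Longrightarrow> P i (dF i u) = dG i (P (Suc i) u)"
    using comparison_map[OF F(1) G L subset_refl] by blast
  obtain Q where Q: "\<And>i. glin n (G i) (F i) (Q i)"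
    "\<And>e u. u \<in> gvec n (G 0) e \<Longrightarrow> aug (length (F 0)) gF (Q 0 u) - aug (length (G 0)) gG u \<in> L"
    "\<And>i e u. u \<in> gvec n (G (Suc i)) e \<Longrightarrow> Q i (dG i u) = dF i (Q (Suc i) u)"
    using comparison_map[OF G F(1) L subset_refl] by blast
  let ?T = "\<lambda>i u. Q i (P i u) - u"
  have T: "glin n (F i) (F i) (?T i)" for i
    by (rule glin_minus[OF glin_comp[OF Q(1) P(1)] glin_id])
  have lind: "plinear (dF i)" for i by (rule glin_plinear[OF gresD(2)[OF F(1)]])
  have aT: "aug (length (F 0)) gF (?T 0 u) \<in> L" if "u \<in> gvec n (F 0) e" for u e
    using hideal_add[OF L Q(2)[OF glin_gvec[OF P(1) that]] P(2)[OF that]] by (simp add: aug_diff)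
  have cT: "?T i (dF i u) = dF i (?T (Suc i) u)" if "u \<in> gvec n (F (Suc i)) e" for i u e
    using P(3)[OF that] Q(3)[OF glin_gvec[OF P(1) that]] by (simp add: plinear_diff[OF lind])
  obtain h where h: "\<And>i. glin n (F i) (F (Suc i)) (h i)"
    "\<And>e u. u \<in> gvec n (F 0) e \<Longrightarrow> ?T 0 u = dF 0 (h 0 u)"
    "\<And>i e u. u \<in> gvec n (F (Suc i)) e \<Longrightarrow> ?T (Suc i) u = dF (Suc i) (h (Suc i) u) + h i (dF i u)"
    by (rule null_homotopy[of n L F gF dF ?T, OF F(1) T]) (erule aT, erule cT, rule that)
  note d0 = gmin_lookup_0[OF F]
  have hd0: "lookup (h i (dF i v) a) 0 = 0" if "v \<in> gvec n (F (Suc i)) e" for i v e a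
    unfolding glin_lookup_0[OF h(1) glin_gvec[OF gresD(2)[OF F(1)] that]] by (simp add: d0[OF that])
  have T0: "lookup (?T i u a) 0 = 0" if u: "u \<in> gvec n (F i) e" for u e a
  proof (cases i)
    case 0
    then show ?thesis using h(2) u d0[OF glin_gvec[OF h(1)], of u 0 e a] by metis
  next
    case (Suc k)
    with u have u': "u \<in> gvec n (F (Suc k)) e" by simp
    show ?thesis
      unfolding Suc h(3)[OF u'] plus_fun_apply lookup_add
      using hd0[OF u'] d0[OF glin_gvec[OF h(1) u']] by simp
  qed
  let ?JF = "{b. b < length (F i) \<and> F i ! b = j}" and ?JG = "{c. c < length (G i) \<and> G i ! c = j}"
  let ?A = "\<lambda>c b. lookup (P i (bvec b) c) 0" and ?B = "\<lambda>a c. lookup (Q i (bvec c) a) 0"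
  \<comment> \<open>For a basis vector of degree \<open>j\<close>, constant terms occur only at
    generators of degree \<open>j\<close>; there the constant matrix of \<open>Q i\<close> is left
    inverse to that of \<open>P i\<close>.\<close>
  have BA: "(\<Sum>c\<in>?JG. ?A c b * ?B a c) = (if a = b then 1 else 0)" if b: "b \<in> ?JF" for a b
  proof -
    have bv: "bvec b \<in> gvec n (F i) j" using gvec_bvec[of b "F i" n] b by simp
    have Pb: "P i (bvec b) \<in> gvec n (G i) j" by (rule glin_gvec[OF P(1) bv])
    have "lookup (Q i (P i (bvec b)) a) 0 = (\<Sum>c<length (G i). ?A c b * ?B a c)"
      by (rule glin_lookup_0[OF Q(1) Pb])
    also have "\<dots> = (\<Sum>c\<in>?JG. ?A c b * ?B a c)"
    proof (rule sum.mono_neutral_right)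
      show "\<forall>c\<in>{..<length (G i)} - ?JG. ?A c b * ?B a c = 0"
      proof
        fix c assume c: "c \<in> {..<length (G i)} - ?JG"
        then have "0 \<notin> keys (P i (bvec b) c)" using gvecD[OF Pb, of 0 c] by auto
        then show "?A c b * ?B a c = 0" by (simp add: in_keys_iff)
      qed
    qed auto
    finally show ?thesis using T0[OF bv, of a] by (simp add: lookup_minus bvec_def split: if_splits)
  qed
  \<comment> \<open>The columns of \<open>?A\<close>, encoded as constant vectors in a space spanned
    by one basis vector for each generator of degree \<open>j\<close> of \<open>G i\<close>; their
    independence gives the bound.\<close>
  let ?x = "\<lambda>b c. if c \<in> ?JG then single 0 (?A c b) else (0 :: 'k mpoly)"
  have "card ?JF \<le> card (bvec ` ?JG :: 'k pvec set)"
  proof (rule kv.independent_family_card_le[where x = ?x])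
    show "?x ` ?JF \<subseteq> kv.span (bvec ` ?JG)"
    proof
      fix y assume "y \<in> ?x ` ?JF"
      then obtain b where y: "y = ?x b" by blast
      have "y = (\<Sum>c\<in>?JG. single 0 (?A c b) *\<^sub>p bvec c)"
      proof
        fix a
        have "(\<Sum>c\<in>?JG. single 0 (?A c b) *\<^sub>p bvec c) a =
            (\<Sum>c\<in>?JG. if c = a then single 0 (?A c b) else 0)"
          unfolding sum_fun_apply by (rule sum.cong) (auto simp: bvec_def)
        then show "y a = (\<Sum>c\<in>?JG. single 0 (?A c b) *\<^sub>p bvec c) a"
          unfolding y by (subst (asm) sum.delta) auto
      qed
      also have "\<dots> \<in> kv.span (bvec ` ?JG)"
        by (intro kv.span_sum kv.span_scale kv.span_base) auto
      finally show "y \<in> kv.span (bvec ` ?JG)" .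
    qed
  next
    show "\<forall>k. (\<Sum>b\<in>?JF. single 0 (k b) *\<^sub>p ?x b) = 0 \<longrightarrow> (\<forall>b\<in>?JF. k b = 0)"
    proof (intro allI impI ballI)
      fix k b assume k: "(\<Sum>b\<in>?JF. single 0 (k b) *\<^sub>p ?x b) = 0" and b: "b \<in> ?JF"
      have kc: "(\<Sum>b\<in>?JF. k b * ?A c b) = 0" if c: "c \<in> ?JG" for c
      proof -
        have "lookup ((\<Sum>b\<in>?JF. single 0 (k b) *\<^sub>p ?x b) c) 0 = (\<Sum>b\<in>?JF. k b * ?A c b)"
          using c by (simp add: sum_fun_apply lookup_sum mult_single)
        then show ?thesis using k by simp
      qed
      have "k b = (\<Sum>b'\<in>?JF. if b = b' then k b' else 0)"
        using b by (subst sum.delta') auto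
      also have "\<dots> = (\<Sum>b'\<in>?JF. k b' * (if b = b' then 1 else 0))"
        by (rule sum.cong) auto
      also have "\<dots> = (\<Sum>b'\<in>?JF. \<Sum>c\<in>?JG. k b' * ?A c b' * ?B b c)"
        by (rule sum.cong) (simp_all add: BA[symmetric] sum_distrib_left mult.assoc)
      also have "\<dots> = (\<Sum>c\<in>?JG. (\<Sum>b'\<in>?JF. k b' * ?A c b') * ?B b c)"
        by (subst sum.swap) (simp add: sum_distrib_right)
      also have "\<dots> = 0" using kc by simp
      finally show "k b = 0" .
    qed
  qed auto
  also have "\<dots> \<le> card ?JG" by (rule card_image_le) simp
  finally show ?thesis by (simp add: count_list_eq_card)
qed

section \<open>Graded Betti numbers\<close>

definition fmod :: "nat \<Rightarrow> nat list \<Rightarrow> 'k::field pvec \<Rightarrow> bool" where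
  "fmod n ds u \<longleftrightarrow> (\<forall>a. if a < length ds then u a \<in> carrier (polyring n) else u a = 0)"

definition hvec :: "nat list \<Rightarrow> nat \<Rightarrow> 'k::field pvec \<Rightarrow> 'k pvec" where
  "hvec ds e u = (\<lambda>a. if a < length ds \<and> ds ! a \<le> e then hcomponent (e - ds ! a) (u a) else 0)"

lemma carrier_polyring_0: "0 \<in> carrier (polyring n)"
  by (rule forms_carrier[OF forms_0])

lemma gvec_fmod: "u \<in> gvec n ds e \<Longrightarrow> fmod n ds u"
  unfolding gvec_iff fmod_def by (metis carrier_polyring_0 forms_carrier)

lemma hvec_gvec: "fmod n ds u \<Longrightarrow> hvec ds e u \<in> gvec n ds e"
  unfolding gvec_iff fmod_def hvec_def by (auto intro: hcomponent_in_forms split: if_splits)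

lemma hvec_on_gvec:
  assumes u: "u \<in> gvec n ds e'"
  shows "hvec ds e u = (if e = e' then u else 0)"
proof
  fix a
  show "hvec ds e u a = (if e = e' then u else 0) a"
  proof (cases "a < length ds \<and> ds ! a \<le> e'")
    case True
    then show ?thesis using hcomponent_forms[OF gvec_forms[OF u]] by (auto simp: hvec_def)
  next
    case False
    then have "u a = 0" using gvec_outside[OF u] gvec_low[OF u] by (meson not_le)
    then show ?thesis by (simp add: hvec_def)
  qed
qed

lemma hvec_0 [simp]: "hvec ds e 0 = 0"
  by (auto simp: hvec_def)

lemma hvec_sum:
  fixes f :: "'i \<Rightarrow> 'k::field pvec"
  shows "hvec ds e (sum f A) = (\<Sum>i\<in>A. hvec ds e (f i))"
proof
  fix a
  show "hvec ds e (sum f A) a = (\<Sum>i\<in>A. hvec ds e (f i)) a"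
  proof (cases "a < length ds \<and> ds ! a \<le> e")
    case False
    then have "hvec ds e v a = 0" for v :: "'k pvec" by (auto simp: hvec_def)
    then show ?thesis by (simp add: sum_fun_apply)
  qed (simp add: hvec_def sum_fun_apply hcomponent_sum)
qed

lemma sum_hvec:
  assumes u: "fmod n ds (u :: 'k::field pvec)"
  obtains N where "u = (\<Sum>e\<le>N. hvec ds e u)"
proof -
  have "\<forall>a. \<exists>K. \<forall>m\<in>keys (u a). mdeg m \<le> K" using ex_degree_bound by blast
  then obtain K where K: "\<And>a m. m \<in> keys (u a) \<Longrightarrow> mdeg m \<le> K a" by metis
  \<comment> \<open>At least every shifted degree that occurs in an entry of \<open>u\<close>, so
    that no component is cut off.\<close>
  define N where "N = (\<Sum>a<length ds. K a + ds ! a)"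
  have "u a = (\<Sum>e\<le>N. hvec ds e u) a" for a
  proof (cases "a < length ds")
    case True
    have le: "K a + ds ! a \<le> N"
      unfolding N_def by (rule member_le_sum[where f = "\<lambda>a. K a + ds ! a"]) (use True in auto)
    show ?thesis
    proof (rule poly_mapping_eqI)
      fix m
      have "lookup ((\<Sum>e\<le>N. hvec ds e u) a) m =
          (\<Sum>e\<le>N. if e = mdeg m + ds ! a then lookup (u a) m else 0)"
        unfolding sum_fun_apply lookup_sum using True
        by (intro sum.cong) (auto simp: hvec_def lookup_hcomponent)
      also have "\<dots> = lookup (u a) m"
        using K[of m a] le by (cases "m \<in> keys (u a)") (auto simp: in_keys_iff)
      finally show "lookup (u a) m = lookup ((\<Sum>e\<le>N. hvec ds e u) a) m" by simp
    qed
  next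
    case False
    then show ?thesis using u by (simp add: sum_fun_apply hvec_def fmod_def)
  qed
  then have "u = (\<Sum>e\<le>N. hvec ds e u)" by (rule ext)
  then show thesis by (rule that)
qed

lemma carrier_polyring_add:
  "p \<in> carrier (polyring n) \<Longrightarrow> q \<in> carrier (polyring n) \<Longrightarrow> p + q \<in> carrier (polyring n)"
  using keys_add[of p q] by (fastforce simp: polyring_def)

lemma fmod_add: "fmod n ds u \<Longrightarrow> fmod n ds v \<Longrightarrow> fmod n ds (u + v)"
  by (simp add: fmod_def carrier_polyring_add)

lemma fmod_sum: "(\<And>i. i \<in> A \<Longrightarrow> fmod n ds (f i)) \<Longrightarrow> fmod n ds (sum f A)"
  by (induction A rule: infinite_finite_induct) (auto intro: fmod_add gvec_fmod[OF gvec_0])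

lemma glin_fmod:
  assumes "glin n es ds f" "fmod n es u"
  shows "fmod n ds (f u)"
proof -
  obtain N where N: "u = (\<Sum>e\<le>N. hvec es e u)" using sum_hvec[OF assms(2)] .
  have "f u = (\<Sum>e\<le>N. f (hvec es e u))"
    by (subst N) (rule plinear_sum[OF glin_plinear[OF assms(1)]])
  then show ?thesis
    using gvec_fmod[OF glin_gvec[OF assms(1) hvec_gvec[OF assms(2)]]] by (simp add: fmod_sum)
qed

lemma glin_hvec:
  assumes "glin n es ds f" "fmod n es u"
  shows "hvec ds e (f u) = f (hvec es e u)"
proof -
  obtain N where N: "u = (\<Sum>e\<le>N. hvec es e u)" using sum_hvec[OF assms(2)] .
  note lin = glin_plinear[OF assms(1)]
  have "hvec ds e (f u) = (\<Sum>e'\<le>N. hvec ds e (f (hvec es e' u)))"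
    by (subst N) (simp only: plinear_sum[OF lin] hvec_sum)
  also have "\<dots> = (\<Sum>e'\<le>N. if e = e' then f (hvec es e' u) else 0)"
    using hvec_on_gvec[OF glin_gvec[OF assms(1) hvec_gvec[OF assms(2)]]] by simp
  also have "\<dots> = (\<Sum>e'\<le>N. f (hvec es e (hvec es e' u)))"
    using hvec_on_gvec[OF hvec_gvec[OF assms(2)]] plinear_0[OF lin] by (intro sum.cong) auto
  also have "\<dots> = f (hvec es e (\<Sum>e'\<le>N. hvec es e' u))"
    by (simp only: plinear_sum[OF lin] hvec_sum)
  finally show ?thesis using N by simp
qed

lemma aug_sum: "aug r g (sum f A) = (\<Sum>i\<in>A. aug r g (f i))"
  by (simp add: aug_def sum_fun_apply sum_distrib_right sum.swap[of _ A])

lemma aug_forms: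
  assumes "\<And>a. a < length ds \<Longrightarrow> g a \<in> forms n (ds ! a)" "u \<in> gvec n ds e"
  shows "aug (length ds) g u \<in> forms n e"
  unfolding aug_def
proof (rule forms_sum)
  fix a assume a: "a \<in> {..<length ds}"
  show "u a * g a \<in> forms n e"
  proof (cases "ds ! a \<le> e")
    case True
    then show ?thesis using forms_mult[OF gvec_forms[OF assms(2) _ True] assms(1)[of a]] a by simp
  next
    case False
    then show ?thesis using gvec_low[OF assms(2), of a] by simp
  qed
qed

lemma hcomponent_aug:
  assumes "\<And>a. a < length ds \<Longrightarrow> g a \<in> forms n (ds ! a)" "fmod n ds u"
  shows "hcomponent e (aug (length ds) g u) = aug (length ds) g (hvec ds e u)"
proof -
  obtain N where N: "u = (\<Sum>e\<le>N. hvec ds e u)" using sum_hvec[OF assms(2)] .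
  have "hcomponent e (aug (length ds) g u) = (\<Sum>e'\<le>N. hcomponent e (aug (length ds) g (hvec ds e' u)))"
    by (subst N) (simp only: aug_sum hcomponent_sum)
  also have "\<dots> = (\<Sum>e'\<le>N. if e = e' then aug (length ds) g (hvec ds e' u) else 0)"
    using hcomponent_forms[OF aug_forms[OF assms(1) hvec_gvec[OF assms(2)]]] by simp
  also have "\<dots> = (\<Sum>e'\<le>N. aug (length ds) g (hvec ds e (hvec ds e' u)))"
    using hvec_on_gvec[OF hvec_gvec[OF assms(2)]] by (intro sum.cong) (auto simp: aug_def)
  also have "\<dots> = aug (length ds) g (hvec ds e (\<Sum>e'\<le>N. hvec ds e' u))"
    by (simp only: aug_sum hvec_sum)
  finally show ?thesis using N by simp
qed

text \<open>Preimages of the homogeneous components add up to a preimage of the vector, and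
  components of a preimage are preimages of the components. Here \<open>C\<close> stands for lying
  in a kernel or being mapped into the ideal.\<close>

lemma graded_image_iff:
  assumes d: "glin n es ds d" and C: "\<And>u. fmod n ds u \<Longrightarrow> C u \<longleftrightarrow> (\<forall>e. C (hvec ds e u))"
  shows "(\<forall>e. \<forall>u\<in>gvec n ds e. C u \<longleftrightarrow> (\<exists>v\<in>gvec n es e. u = d v)) \<longleftrightarrow>
    (\<forall>u. fmod n ds u \<longrightarrow> (C u \<longleftrightarrow> (\<exists>v. fmod n es v \<and> u = d v)))" (is "?L \<longleftrightarrow> ?R")
proof
  assume L: ?L
  show ?R
  proof (intro allI impI iffI)
    fix u assume u: "fmod n ds u" "C u"
    have "\<exists>v\<in>gvec n es e. hvec ds e u = d v" for e
      using L C[OF u(1)] u(2) hvec_gvec[OF u(1)] by blast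
    then obtain v where v: "\<And>e. v e \<in> gvec n es e" "\<And>e. hvec ds e u = d (v e)" by metis
    obtain N where N: "u = (\<Sum>e\<le>N. hvec ds e u)" using sum_hvec[OF u(1)] .
    have "u = d (\<Sum>e\<le>N. v e)"
      by (subst N) (simp only: v(2) plinear_sum[OF glin_plinear[OF d]])
    then show "\<exists>v. fmod n es v \<and> u = d v"
      using fmod_sum[of "{..N}" n es v] gvec_fmod[OF v(1)] by blast
  next
    fix u assume u: "fmod n ds u" "\<exists>v. fmod n es v \<and> u = d v"
    then obtain v where v: "fmod n es v" "u = d v" by blast
    have "C (hvec ds e u)" for e
      using L glin_hvec[OF d v(1)] hvec_gvec[OF v(1), of e] hvec_gvec[OF u(1), of e] v(2) by metis
    then show "C u" using C[OF u(1)] by blast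
  qed
next
  assume R: ?R
  show ?L
  proof (intro allI ballI iffI)
    fix e u assume u: "u \<in> gvec n ds e" "C u"
    then obtain v where v: "fmod n es v" "u = d v" using R gvec_fmod by blast
    have "u = d (hvec es e v)" using hvec_on_gvec[OF u(1), of e] glin_hvec[OF d v(1), of e] v(2) by simp
    then show "\<exists>v\<in>gvec n es e. u = d v" using hvec_gvec[OF v(1)] by blast
  next
    fix e u assume "u \<in> gvec n ds e" "\<exists>v\<in>gvec n es e. u = d v"
    then show "C u" using R gvec_fmod by blast
  qed
qed

lemma kernel_hvec:
  assumes d: "glin n ds cs d" and u: "fmod n ds u"
  shows "d u = 0 \<longleftrightarrow> (\<forall>e. d (hvec ds e u) = 0)"
proof
  assume "d u = 0"
  then show "\<forall>e. d (hvec ds e u) = 0"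
    by (simp flip: glin_hvec[OF d u])
next
  assume *: "\<forall>e. d (hvec ds e u) = 0"
  obtain N where N: "u = (\<Sum>e\<le>N. hvec ds e u)" using sum_hvec[OF u] .
  show "d u = 0" by (subst N) (simp only: plinear_sum[OF glin_plinear[OF d]] * sum.neutral_const)
qed

lemma aug_hvec:
  assumes "hideal n L" "\<And>a. a < length ds \<Longrightarrow> g a \<in> forms n (ds ! a)" "fmod n ds u"
  shows "aug (length ds) g u \<in> L \<longleftrightarrow> (\<forall>e. aug (length ds) g (hvec ds e u) \<in> L)"
proof
  assume "aug (length ds) g u \<in> L"
  then show "\<forall>e. aug (length ds) g (hvec ds e u) \<in> L"
    using hideal_hcomponent[OF assms(1)] hcomponent_aug[OF assms(2,3)] by metis
next
  assume *: "\<forall>e. aug (length ds) g (hvec ds e u) \<in> L"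
  obtain N where N: "u = (\<Sum>e\<le>N. hvec ds e u)" using sum_hvec[OF assms(3)] .
  show "aug (length ds) g u \<in> L"
    by (subst N) (simp only: aug_sum, rule hideal_sum[OF assms(1)], use * in blast)
qed

text \<open>All maps preserve degree and \<open>L\<close> is closed under homogeneous components, so
  exactness may be tested strand by strand. This links the working definition to
  \<open>minimal_graded_free_resolution\<close>, which speaks of all vectors.\<close>

lemma gres_iff_fmod:
  fixes L :: "'k::field mpoly set"
  assumes L: "hideal n L"
  shows "gres n L F g d \<longleftrightarrow>
     (\<forall>a<length (F 0). g a \<in> forms n (F 0 ! a)) \<and>
     (\<forall>i. glin n (F (Suc i)) (F i) (d i)) \<and>
     (\<forall>p\<in>carrier (polyring n). \<exists>u. fmod n (F 0) u \<and> p - aug (length (F 0)) g u \<in> L) \<and>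
     (\<forall>u. fmod n (F 0) u \<longrightarrow> (aug (length (F 0)) g u \<in> L \<longleftrightarrow> (\<exists>v. fmod n (F 1) v \<and> u = d 0 v))) \<and>
     (\<forall>i u. fmod n (F (Suc i)) u \<longrightarrow> (d i u = 0 \<longleftrightarrow> (\<exists>v. fmod n (F (Suc (Suc i))) v \<and> u = d (Suc i) v)))"
proof (cases "(\<forall>a<length (F 0). g a \<in> forms n (F 0 ! a)) \<and> (\<forall>i. glin n (F (Suc i)) (F i) (d i))")
  case True
  then have g: "\<And>a. a < length (F 0) \<Longrightarrow> g a \<in> forms n (F 0 ! a)"
      and d: "\<And>i. glin n (F (Suc i)) (F i) (d i)"
    by auto
  have d0: "glin n (F 1) (F 0) (d 0)" using d[of 0] by simp
  have "(\<forall>e. \<forall>p\<in>forms n e. \<exists>u\<in>gvec n (F 0) e. p - aug (length (F 0)) g u \<in> L) \<longleftrightarrow>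
      (\<forall>p\<in>carrier (polyring n). \<exists>u. fmod n (F 0) u \<and> p - aug (length (F 0)) g u \<in> L)" (is "?A \<longleftrightarrow> ?B")
  proof
    assume A: ?A
    show ?B
    proof
      fix p :: "'k mpoly" assume p: "p \<in> carrier (polyring n)"
      have "\<exists>u\<in>gvec n (F 0) e. hcomponent e p - aug (length (F 0)) g u \<in> L" for e
        using A hcomponent_in_forms[OF p] by blast
      then obtain u where u: "\<And>e. u e \<in> gvec n (F 0) e"
          "\<And>e. hcomponent e p - aug (length (F 0)) g (u e) \<in> L" by metis
      obtain N where N: "\<And>m. m \<in> keys p \<Longrightarrow> mdeg m \<le> N" using ex_degree_bound[of p] by blast
      have "p - aug (length (F 0)) g (\<Sum>e\<le>N. u e) = (\<Sum>e\<le>N. hcomponent e p - aug (length (F 0)) g (u e))"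
        using sum_hcomponent[of p N, OF N] by (simp add: aug_sum sum_subtractf)
      also have "\<dots> \<in> L" by (rule hideal_sum[OF L u(2)])
      finally show "\<exists>u. fmod n (F 0) u \<and> p - aug (length (F 0)) g u \<in> L"
        using fmod_sum[of "{..N}" n "F 0" u] gvec_fmod[OF u(1)] by blast
    qed
  next
    assume B: ?B
    show ?A
    proof (intro allI ballI)
      fix e and p :: "'k mpoly" assume p: "p \<in> forms n e"
      then obtain u where u: "fmod n (F 0) u" "p - aug (length (F 0)) g u \<in> L"
        using B forms_carrier by blast
      have "p - aug (length (F 0)) g (hvec (F 0) e u) = hcomponent e (p - aug (length (F 0)) g u)"
        by (simp add: hcomponent_diff hcomponent_aug[OF g u(1)] hcomponent_forms[OF p])
      also have "\<dots> \<in> L" by (rule hideal_hcomponent[OF L u(2)])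
      finally show "\<exists>u\<in>gvec n (F 0) e. p - aug (length (F 0)) g u \<in> L"
        using hvec_gvec[OF u(1)] by blast
    qed
  qed
  moreover note graded_image_iff[OF d0 aug_hvec[OF L g]] graded_image_iff[OF d kernel_hvec[OF d]]
  ultimately show ?thesis
    unfolding gres_def using True by (simp only:)
qed (auto simp: gres_def)

section \<open>Matrices and vectors as functions\<close>

definition fun_of_vec :: "'k::field mpoly vec \<Rightarrow> 'k pvec" where
  "fun_of_vec v = (\<lambda>a. if a < dim_vec v then v $ a else 0)"

definition fun_of_mat :: "'k::field mpoly mat \<Rightarrow> 'k pvec \<Rightarrow> 'k pvec" where
  "fun_of_mat M u = (\<lambda>a. if a < dim_row M then (\<Sum>b<dim_col M. M $$ (a, b) * u b) else 0)"

lemma fun_of_vec_inject: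
  "u \<in> carrier_vec k \<Longrightarrow> v \<in> carrier_vec k \<Longrightarrow> fun_of_vec u = fun_of_vec v \<longleftrightarrow> u = v"
  by (auto simp: fun_of_vec_def fun_eq_iff)

lemma fun_of_vec_0: "fun_of_vec (0\<^sub>v k) = 0"
  by (auto simp: fun_of_vec_def)

lemma fmod_iff_free_module: "fmod n ds u \<longleftrightarrow> (\<exists>v\<in>free_module n ds. u = fun_of_vec v)"
proof
  assume "fmod n ds u"
  then have "vec (length ds) u \<in> free_module n ds" "u = fun_of_vec (vec (length ds) u)"
    unfolding free_module_def fmod_def fun_of_vec_def by (auto simp: fun_eq_iff split: if_splits)
  then show "\<exists>v\<in>free_module n ds. u = fun_of_vec v" by blast
qed (auto simp: free_module_def fmod_def fun_of_vec_def)

lemma free_module_carrier: "v \<in> free_module n ds \<Longrightarrow> v \<in> carrier_vec (length ds)"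
  by (simp add: free_module_def)

lemma fun_of_mat_mult:
  "M \<in> carrier_mat r k \<Longrightarrow> v \<in> carrier_vec k \<Longrightarrow> fun_of_vec (M *\<^sub>v v) = fun_of_mat M (fun_of_vec v)"
  by (auto simp: fun_of_vec_def fun_of_mat_def scalar_prod_def fun_eq_iff atLeast0LessThan intro!:
      sum.cong)

lemma scalar_prod_eq_aug:
  "v \<in> carrier_vec k \<Longrightarrow> g \<bullet> v = aug k (fun_of_vec g) (fun_of_vec v)" if "g \<in> carrier_vec k"
  using that by (auto simp: fun_of_vec_def aug_def scalar_prod_def atLeast0LessThan mult.commute
      intro!: sum.cong)

lemma plinear_fun_of_mat: "plinear (fun_of_mat M)"
  by (auto simp: plinear_def fun_of_mat_def fun_eq_iff sum_distrib_left sum.distrib algebra_simps)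

lemma fun_of_mat_bvec:
  "M \<in> carrier_mat r k \<Longrightarrow> b < k \<Longrightarrow> fun_of_mat M (bvec b) = (\<lambda>a. if a < r then M $$ (a, b) else 0)"
  by (auto simp: fun_of_mat_def bvec_def fun_eq_iff if_distrib[of "\<lambda>x. _ * x"] cong: if_cong)

lemma glin_fun_of_mat:
  assumes "graded_map n es ds M"
  shows "glin n es ds (fun_of_mat M)"
proof -
  have M: "M \<in> carrier_mat (length ds) (length es)" using assms by (simp add: graded_map_def)
  let ?c = "\<lambda>b. fun_of_mat M (bvec b)"
  have c: "?c b \<in> gvec n ds (es ! b)" if "b < length es" for b
    using assms that unfolding fun_of_mat_bvec[OF M that] gvec_def graded_map_def polyring_def
    by (auto split: if_splits)
  have "fun_of_mat M u \<in> gvec n ds e" if "u \<in> gvec n es e" for u e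
    using plinear_eq_lin[OF plinear_fun_of_mat that, of M] lin_gvec[of es ?c n ds, OF c that] by simp
  then show ?thesis by (simp add: glin_def plinear_fun_of_mat)
qed

definition mat_of_fun :: "nat list \<Rightarrow> nat list \<Rightarrow> ('k::field pvec \<Rightarrow> 'k pvec) \<Rightarrow> 'k mpoly mat" where
  "mat_of_fun es ds d = mat (length ds) (length es) (\<lambda>(a, b). d (bvec b) a)"

lemma mat_of_fun_carrier: "mat_of_fun es ds d \<in> carrier_mat (length ds) (length es)"
  by (simp add: mat_of_fun_def)

lemma graded_map_mat_of_fun:
  assumes "glin n es ds d"
  shows "graded_map n es ds (mat_of_fun es ds d)"
  unfolding graded_map_def
proof (intro conjI allI impI mat_of_fun_carrier)
  fix a b assume ab: "a < length ds" "b < length es"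
  note db = glin_gvec[OF assms gvec_bvec[OF ab(2)]]
  show "mat_of_fun es ds d $$ (a, b) \<in> carrier (polyring n)"
    using gvecD[OF db] ab by (auto simp: mat_of_fun_def polyring_def)
  show "\<forall>m\<in>keys (mat_of_fun es ds d $$ (a, b)). mdeg m + ds ! a = es ! b"
    using gvecD[OF db] ab by (auto simp: mat_of_fun_def)
qed

lemma plinear_eq_on_fmod:
  assumes "plinear f" "plinear h" "fmod n es u" "\<And>b. b < length es \<Longrightarrow> f (bvec b) = h (bvec b)"
  shows "f u = h u"
proof -
  obtain N where N: "u = (\<Sum>e\<le>N. hvec es e u)" using sum_hvec[OF assms(3)] .
  have "f (hvec es e u) = h (hvec es e u)" for e
    by (rule plinear_eq_on_gvec[OF assms(1,2) hvec_gvec[OF assms(3)] assms(4)])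
  then show ?thesis
    by (subst (1 2) N) (simp only: plinear_sum[OF assms(1)] plinear_sum[OF assms(2)])
qed

lemma fun_of_mat_of_fun:
  assumes "glin n es ds d" "fmod n es u"
  shows "fun_of_mat (mat_of_fun es ds d) u = d u"
proof (rule plinear_eq_on_fmod[OF plinear_fun_of_mat glin_plinear[OF assms(1)] assms(2)])
  fix b assume b: "b < length es"
  have "d (bvec b) a = 0" if "length ds \<le> a" for a
    by (rule gvec_outside[OF glin_gvec[OF assms(1) gvec_bvec[OF b]] that])
  then show "fun_of_mat (mat_of_fun es ds d) (bvec b) = d (bvec b)"
    unfolding fun_of_mat_bvec[OF mat_of_fun_carrier b] using b by (auto simp: mat_of_fun_def fun_eq_iff)
qed

lemma free_module_image_eq_iff:
  assumes "M \<in> carrier_mat (length ds) (length es)" and "\<And>v. v \<in> free_module n es \<Longrightarrow>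
      M *\<^sub>v v \<in> free_module n ds"
    and C: "\<And>v. v \<in> free_module n ds \<Longrightarrow> P v \<longleftrightarrow> C (fun_of_vec v)"
  shows "{v \<in> free_module n ds. P v} = (\<lambda>v. M *\<^sub>v v) ` free_module n es \<longleftrightarrow>
    (\<forall>u. fmod n ds u \<longrightarrow> (C u \<longleftrightarrow> (\<exists>v. fmod n es v \<and> u = fun_of_mat M v)))"
proof -
  have im: "u \<in> (\<lambda>v. M *\<^sub>v v) ` free_module n es \<longleftrightarrow> (\<exists>v. fmod n es v \<and> fun_of_vec u = fun_of_mat M v)"
    if u: "u \<in> free_module n ds" for u
  proof -
    have *: "u = M *\<^sub>v v \<longleftrightarrow> fun_of_vec u = fun_of_mat M (fun_of_vec v)" if v: "v \<in> free_module n es"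
        for v
      using fun_of_vec_inject[OF free_module_carrier[OF u] free_module_carrier[OF assms(2)[OF v]]]
        fun_of_mat_mult[OF assms(1) free_module_carrier[OF v]] by simp
    show ?thesis unfolding fmod_iff_free_module using * by blast
  qed
  have "{v \<in> free_module n ds. P v} = (\<lambda>v. M *\<^sub>v v) ` free_module n es \<longleftrightarrow>
      (\<forall>u\<in>free_module n ds. P u \<longleftrightarrow> u \<in> (\<lambda>v. M *\<^sub>v v) ` free_module n es)"
    using assms(2) by blast
  also have "\<dots> \<longleftrightarrow> (\<forall>u. fmod n ds u \<longrightarrow> (C u \<longleftrightarrow> (\<exists>v. fmod n es v \<and> u = fun_of_mat M v)))"
    unfolding fmod_iff_free_module[of n ds] using im C by auto
  finally show ?thesis .
qed

lemma graded_map_free_module: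
  assumes "graded_map n es ds M" "v \<in> free_module n es"
  shows "M *\<^sub>v v \<in> free_module n ds"
proof -
  have M: "M \<in> carrier_mat (length ds) (length es)" using assms(1) by (simp add: graded_map_def)
  have "fmod n ds (fun_of_vec (M *\<^sub>v v))"
    unfolding fun_of_mat_mult[OF M free_module_carrier[OF assms(2)]]
    using assms fmod_iff_free_module by (intro glin_fmod[OF glin_fun_of_mat]) blast+
  then have "\<forall>a<length ds. (M *\<^sub>v v) $ a \<in> carrier (polyring n)"
    using M by (auto simp: fmod_def fun_of_vec_def split: if_splits)
  moreover have "M *\<^sub>v v \<in> carrier_vec (length ds)"
    by (rule mult_mat_vec_carrier[OF M free_module_carrier[OF assms(2)]])
  ultimately show ?thesis by (simp only: free_module_def mem_Collect_eq simp_thms)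
qed

lemma minimal_resolution_iff_gres:
  assumes L: "hideal n L" and g: "g \<in> carrier_vec (length (F 0))"
    and D: "\<And>i. graded_map n (F (Suc i)) (F i) (D i)"
  shows "minimal_graded_free_resolution n L F g D \<longleftrightarrow>
    gres n L F (fun_of_vec g) (\<lambda>i. fun_of_mat (D i)) \<and> gmin F (\<lambda>i. fun_of_mat (D i))"
proof -
  have Dc: "D i \<in> carrier_mat (length (F i)) (length (F (Suc i)))" for i
    using D[of i] by (simp add: graded_map_def)
  have gd: "(\<forall>a<length (F 0). g $ a \<in> forms n (F 0 ! a)) \<longleftrightarrow>
      (\<forall>a<length (F 0). fun_of_vec g a \<in> forms n (F 0 ! a))"
    using g by (auto simp: fun_of_vec_def)
  have sur: "(\<forall>p\<in>carrier (polyring n). \<exists>u\<in>free_module n (F 0). p - g \<bullet> u \<in> L) \<longleftrightarrow>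
     (\<forall>p\<in>carrier (polyring n). \<exists>u. fmod n (F 0) u \<and> p - aug (length (F 0)) (fun_of_vec g) u \<in> L)"
    unfolding fmod_iff_free_module
    using scalar_prod_eq_aug[OF g free_module_carrier] by (intro ball_cong refl) metis
  have ex0: "{u \<in> free_module n (F 0). g \<bullet> u \<in> L} = (\<lambda>u. D 0 *\<^sub>v u) ` free_module n (F 1) \<longleftrightarrow>
     (\<forall>u. fmod n (F 0) u \<longrightarrow> (aug (length (F 0)) (fun_of_vec g) u \<in> L \<longleftrightarrow> (\<exists>v. fmod n
         (F 1) v \<and> u = fun_of_mat (D 0) v)))"
    using Dc[of 0] graded_map_free_module[OF D, of _ 0] scalar_prod_eq_aug[OF g free_module_carrier]
    by (intro free_module_image_eq_iff) auto
  have ker: "D i *\<^sub>v u = 0\<^sub>v (length (F i)) \<longleftrightarrow> fun_of_mat (D i) (fun_of_vec u) = 0"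
      if "u \<in> free_module n (F (Suc i))" for u i
    using fun_of_vec_inject[OF mult_mat_vec_carrier[OF Dc free_module_carrier[OF that]]
        zero_carrier_vec]
    by (simp add: fun_of_vec_0 fun_of_mat_mult[OF Dc free_module_carrier[OF that]])
  have exi: "{u \<in> free_module n (F (Suc i)). D i *\<^sub>v u = 0\<^sub>v (length (F i))} =
       (\<lambda>u. D (Suc i) *\<^sub>v u) ` free_module n (F (Suc (Suc i))) \<longleftrightarrow>
     (\<forall>u. fmod n (F (Suc i)) u \<longrightarrow> (fun_of_mat (D i) u = 0 \<longleftrightarrow> (\<exists>v. fmod n (F (Suc
         (Suc i))) v \<and> u = fun_of_mat (D (Suc i)) v)))" for i
    by (rule free_module_image_eq_iff[where C = "\<lambda>u. fun_of_mat (D i) u = 0"])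
      (rule Dc, erule graded_map_free_module[OF D], erule ker)
  have mn: "(\<forall>i. \<forall>a<length (F i). \<forall>b<length (F (Suc i)). lookup (D i $$ (a, b)) 0 = 0) \<longleftrightarrow>
      gmin F (\<lambda>i. fun_of_mat (D i))"
    unfolding gmin_def using fun_of_mat_bvec[OF Dc] by auto
  show ?thesis
    unfolding minimal_graded_free_resolution_def gres_iff_fmod[OF L] gd sur ex0 exi mn
    using g D glin_fun_of_mat[OF D] by blast
qed

text \<open>A matrix remembers a differential only on the free module, not on vectors with further
  entries. Agreement on basis vectors is enough, since it fixes a linear map on every
  strand.\<close>

lemma gres_cong:
  assumes "gres n L F g d" "\<And>a. a < length (F 0) \<Longrightarrow> g' a = g a"
    and "\<And>i. plinear (d' i)" "\<And>i b. b < length (F (Suc i)) \<Longrightarrow> d' i (bvec b) = d i (bvec b)"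
  shows "gres n L F g' d'"
proof -
  have d: "d' i u = d i u" if "u \<in> gvec n (F (Suc i)) e" for i u e
    by (rule plinear_eq_on_gvec[OF assms(3) glin_plinear[OF gresD(2)[OF assms(1)]] that assms(4)])
  have a: "aug (length (F 0)) g' u = aug (length (F 0)) g u" for u
    using assms(2) by (simp add: aug_def)
  have "glin n (F (Suc i)) (F i) (d' i)" for i
    using gresD(2)[OF assms(1), of i] assms(3) by (simp add: glin_def d)
  then show ?thesis
    using assms(1) unfolding gres_def a by (simp add: assms(2) d)
qed

lemma gres_minimal_resolution:
  assumes L: "hideal n L" and F: "gres n L F g d" "gmin F d"
  shows "minimal_graded_free_resolution n L F (vec (length (F 0)) g) (\<lambda>i. mat_of_fun (F (Suc i)) (F
      i) (d i))"
proof -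
  have eq: "fun_of_mat (mat_of_fun (F (Suc i)) (F i) (d i)) (bvec b) = d i (bvec b)"
      if "b < length (F (Suc i))" for i b
    by (rule fun_of_mat_of_fun[OF gresD(2)[OF F(1)] gvec_fmod[OF gvec_bvec[OF that]]])
  have "gres n L F (fun_of_vec (vec (length (F 0)) g)) (\<lambda>i. fun_of_mat (mat_of_fun (F (Suc i)) (F i)
      (d i)))"
    by (rule gres_cong[OF F(1)]) (simp_all add: eq fun_of_vec_def plinear_fun_of_mat)
  moreover have "gmin F (\<lambda>i. fun_of_mat (mat_of_fun (F (Suc i)) (F i) (d i)))"
    using F(2) eq by (simp add: gmin_def)
  ultimately show ?thesis
    using minimal_resolution_iff_gres[of n L "vec (length (F 0)) g" F
        "\<lambda>i. mat_of_fun (F (Suc i)) (F i) (d i)", OF L vec_carrier graded_map_mat_of_fun[OF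
            gresD(2)[OF F(1)]]]
    by blast
qed

text \<open>Two minimal resolutions bound each other's counts in every index and degree, so the
  definite description denotes the count in any one of them.\<close>

lemma graded_betti_eq:
  assumes L: "hideal n L" and F: "gres n L F g d" "gmin F d"
  shows "graded_betti n L i j = count_list (F i) j"
  unfolding graded_betti_def
proof (rule the_equality)
  show "\<exists>F' g D. minimal_graded_free_resolution n L F' g D \<and> count_list (F' i) j = count_list (F i) j"
    using gres_minimal_resolution[OF assms] by blast
next
  fix r assume "\<exists>F' g D. minimal_graded_free_resolution n L F' g D \<and> count_list (F' i) j = r"
  then obtain F' g' D where F': "minimal_graded_free_resolution n L F' g' D" "count_list (F' i) j =
      r" by blast
  then have "gres n L F' (fun_of_vec g') (\<lambda>i. fun_of_mat (D i)) \<and> gmin F' (\<lambda>i. fun_of_mat (D i))"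
    using minimal_resolution_iff_gres[of n L g' F' D, OF L]
    by (simp add: minimal_graded_free_resolution_def)
  then show "r = count_list (F i) j"
    using minimal_resolution_count_le[OF L F] minimal_resolution_count_le[OF L _ _ F(1)] F'(2)
    by (metis le_antisym)
qed

lemma betti_eq:
  assumes "hideal n L" "gres n L F g d" "gmin F d"
  shows "betti n L i = length (F i)"
proof -
  have "betti n L i = (\<Sum>j | count_list (F i) j \<noteq> 0. count_list (F i) j)"
    by (simp add: betti_def graded_betti_eq[OF assms])
  also have "\<dots> = (\<Sum>j\<in>set (F i). count_list (F i) j)"
    by (rule sum.cong) (auto simp: count_list_0_iff)
  also have "\<dots> = length (F i)" by (rule sum_count_set) auto
  finally show ?thesis .
qed

lemma hideal_if_homogeneous_ideal:
  assumes "homogeneous_ideal n L"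
  shows "hideal n L"
proof -
  interpret ideal L "polyring n" using assms by (simp add: homogeneous_ideal_def)
  have add: "additive_subgroup L (polyring n)" by unfold_locales
  show ?thesis
    unfolding hideal_def
  proof (intro conjI ballI allI)
    show "0 \<in> L" using additive_subgroup.zero_closed[OF add] by (simp add: polyring_def)
    show "p + q \<in> L" if "p \<in> L" "q \<in> L" for p q using additive_subgroup.a_closed[OF add that]
        by (simp add: polyring_def)
    show "q * p \<in> L" if "q \<in> carrier (polyring n)" "p \<in> L" for p q
      using I_l_closed[OF that(2,1)] by (simp add: polyring_def)
    show "hcomponent d p \<in> L" if "p \<in> L" for p d using assms that by (simp add: homogeneous_ideal_def)
  qed
qed

section \<open>The Euler characteristic of a resolution\<close>

lemma (in vector_space_pair) rank_nullity:
  assumes f: "Vector_Spaces.linear s1 s2 f" and V: "vs1.subspace V" "V \<subseteq> vs1.span A" "finite A"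
  shows "vs2.dim (f ` V) + vs1.dim {v \<in> V. f v = 0} = vs1.dim V"
proof -
  interpret f: Vector_Spaces.linear s1 s2 f by (rule f)
  obtain C where C: "finite C" "C \<subseteq> V" "card C + vs1.dim {v \<in> V. f v \<in> {0}} = vs1.dim V"
    "\<forall>v\<in>V. \<exists>c. f v - (\<Sum>x\<in>C. s2 (c x) (f x)) \<in> {0}"
    "\<forall>c. (\<Sum>x\<in>C. s2 (c x) (f x)) \<in> {0} \<longrightarrow> (\<forall>x\<in>C. c x = 0)"
    by (rule relative_quotient_basis[OF f V vs2.subspace_single_0])
  have ind: "\<forall>c. (\<Sum>x\<in>C. s2 (c x) (f x)) = 0 \<longrightarrow> (\<forall>x\<in>C. c x = 0)"
    using C(5) by simp
  have "f ` V \<subseteq> vs2.span (f ` C)"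
  proof
    fix y assume "y \<in> f ` V"
    then obtain v c where "v \<in> V" "y = f v" "f v = (\<Sum>x\<in>C. s2 (c x) (f x))" using C(4) by fastforce
    then have "y = (\<Sum>x\<in>C. s2 (c x) (f x))" by simp
    also have "\<dots> \<in> vs2.span (f ` C)" by (intro vs2.span_sum vs2.span_scale vs2.span_base) simp
    finally show "y \<in> vs2.span (f ` C)" .
  qed
  then have "vs2.dim (f ` V) = card (f ` C)"
    using vs2.basis_card_eq_dim[of "f ` C" "f ` V"] vs2.independent_family(2)[OF C(1) ind] C(2) by force
  then show ?thesis using C(3) card_image[OF vs2.independent_family(1)[OF C(1) ind]] by simp
qed

text \<open>Each differential of a minimal resolution raises degrees: a column
  \<open>d i (bvec b)\<close> is nonzero, as otherwise \<open>bvec b\<close> with its constant term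
  1 would be a boundary, and its entries have no constant term. In a fixed degree the resolution
  therefore ends.\<close>

lemma gres_degree_ge:
  assumes F: "gres n L F g d" "gmin F d" "F 0 = [0]"
  shows "b < length (F i) \<Longrightarrow> i \<le> F i ! b"
proof (induction i arbitrary: b)
  case (Suc i)
  note db = glin_gvec[OF gresD(2)[OF F(1)] gvec_bvec[OF Suc.prems]]
  have "d i (bvec b) \<noteq> 0"
  proof
    assume "d i (bvec b) = 0"
    then obtain v where "v \<in> gvec n (F (Suc (Suc i))) (F (Suc i) ! b)" "bvec b = d (Suc i) v"
      using gresD(6)[OF F(1) gvec_bvec[OF Suc.prems]] by blast
    then have "lookup (bvec b b :: 'a mpoly) 0 = 0" using gmin_lookup_0[OF F(1,2)] by metis
    then show False by simp
  qed
  then obtain a m where m: "m \<in> keys (d i (bvec b) a)"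
    by (metis ext keys_eq_empty all_not_in_conv zero_fun_apply)
  then have "m \<noteq> 0" using gmin_lookup_0[OF F(1,2) gvec_bvec[OF Suc.prems], of a]
      by (auto simp: in_keys_iff)
  then have "mdeg m > 0" by (simp flip: neq0_conv)
  moreover have "a < length (F i)" "mdeg m + F i ! a = F (Suc i) ! b" using gvecD[OF db m] by auto
  ultimately show ?case using Suc.IH[of a] by simp
qed simp

lemma gvec_high_degree: "(\<And>b. b < length ds \<Longrightarrow> e < ds ! b) \<Longrightarrow> gvec n ds e = {0}"
  by (auto simp: gvec_iff fun_eq_iff not_le)

text \<open>Rank-nullity along the strand of degree \<open>e\<close> makes the alternating sum
  telescope up to the rank of the last differential. That rank is 0 at index \<open>e\<close>,
  because generators of \<open>F (Suc e)\<close> have degree greater than \<open>e\<close>.\<close>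

lemma hilbert_function_euler:
  fixes L :: "'k::field mpoly set"
  assumes L: "hideal n L" and F: "gres n L F g d" "gmin F d" "F 0 = [0]"
  shows "int (hilbert_function n L e) = (\<Sum>i\<le>e. (-1) ^ i * int (kv.dim (gvec n (F i) e :: 'k pvec set)))"
proof -
  let ?V = "\<lambda>i. gvec n (F i) e :: 'k pvec set"
  let ?r = "\<lambda>i. int (kv.dim (d i ` ?V (Suc i)))"
  have d: "glin n (F (Suc i)) (F i) (d i)" for i by (rule gresD(2)[OF F(1)])
  have lind: "Vector_Spaces.linear (\<lambda>c u. single 0 c *\<^sub>p u) (\<lambda>c u. single 0 c *\<^sub>p u) (d i)" for i
    unfolding Vector_Spaces.linear_iff using kv.vector_space_axioms
    by (simp add: plinear_add[OF glin_plinear[OF d]] plinear_pscale[OF glin_plinear[OF d]])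
  have lina: "Vector_Spaces.linear (\<lambda>c u. single 0 c *\<^sub>p u) (\<lambda>c p. single 0 c * p)
      (aug (length (F 0)) g)"
    unfolding Vector_Spaces.linear_iff using kv.vector_space_axioms kp.vector_space_axioms
    by (simp add: aug_add aug_pscale)
  have im0: "{u \<in> ?V 0. aug (length (F 0)) g u \<in> L} = d 0 ` ?V (Suc 0)"
    using gresD(4,5)[OF F(1)] glin_gvec[OF d[of 0]] by blast
  have imS: "{u \<in> ?V (Suc i). d i u = 0} = d (Suc i) ` ?V (Suc (Suc i))" for i
    using gresD(6,7)[OF F(1)] glin_gvec[OF d[of "Suc i"]] by blast
  have H: "int (hilbert_function n L e) = int (kv.dim (?V 0)) - ?r 0"
  proof -
    \<comment> \<open>Vectors of \<open>F 0\<close> whose augmentations represent a basis of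
      \<open>R/L\<close> in degree \<open>e\<close>; their number is the dimension of the strand
      minus the rank of \<open>d 0\<close>.\<close>
    obtain C where C: "finite C" "C \<subseteq> ?V 0"
      "card C + kv.dim {u \<in> ?V 0. aug (length (F 0)) g u \<in> L} = kv.dim (?V 0)"
      "\<forall>v\<in>?V 0. \<exists>c. aug (length (F 0)) g v - (\<Sum>x\<in>C. single 0 (c x) * aug (length (F 0)) g x) \<in> L"
      "\<forall>c. (\<Sum>x\<in>C. single 0 (c x) * aug (length (F 0)) g x) \<in> L \<longrightarrow> (\<forall>x\<in>C. c x = 0)"
      by (rule kvp.relative_quotient_basis[OF lina subspace_gvec gvec_dim(1,2) hideal_subspace[OF L]])
    let ?B = "aug (length (F 0)) g ` C"
    have ind: "\<forall>c. (\<Sum>x\<in>C. single 0 (c x) * aug (length (F 0)) g x) = 0 \<longrightarrow> (\<forall>x\<in>C. c x = 0)"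
      using C(5) hideal_0[OF L] by simp
    note inj = kp.independent_family(1)[OF C(1) ind]
    have "residue_basis n L e ?B"
    proof (rule residue_basisI[OF _ _ hideal_subspace[OF L]])
      show "finite ?B" using C(1) by simp
      show "?B \<subseteq> forms n e" using C(2) aug_forms[OF gresD(1)[OF F(1)]] by blast
    next
      fix p :: "'k mpoly" assume "p \<in> forms n e"
      then obtain u where u: "u \<in> ?V 0" "p - aug (length (F 0)) g u \<in> L" using gresD(3)[OF F(1)]
          by blast
      obtain c where c: "aug (length (F 0)) g u - (\<Sum>x\<in>C. single 0 (c x) * aug (length (F 0)) g x) \<in> L"
        using bspec[OF C(4) u(1)] by blast
      let ?c = "\<lambda>b. c (the_inv_into C (aug (length (F 0)) g) b)"
      have "(\<Sum>b\<in>?B. single 0 (?c b) * b) = (\<Sum>x\<in>C. single 0 (c x) * aug (length (F 0)) g x)"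
        by (simp add: sum.reindex[OF inj] the_inv_into_f_f[OF inj])
      then have "p - (\<Sum>b\<in>?B. single 0 (?c b) * b) \<in> L"
        using hideal_add[OF L u(2) c] by simp
      then show "\<exists>c. p - (\<Sum>b\<in>?B. single 0 (c b) * b) \<in> L" by (rule exI[of _ ?c])
    next
      fix c b assume c: "(\<Sum>b\<in>?B. single 0 (c b) * b) \<in> L" and "b \<in> ?B"
      then obtain x where x: "x \<in> C" "b = aug (length (F 0)) g x" by blast
      have "(\<Sum>x\<in>C. single 0 (c (aug (length (F 0)) g x)) * aug (length (F 0)) g x) \<in> L"
        using c by (simp add: sum.reindex[OF inj])
      from C(5)[rule_format, OF this x(1)] x(2) show "c b = 0" by simp
    qed
    then have "hilbert_function n L e = card C"
      using hilbert_function_eq[OF hideal_subspace[OF L]] card_image[OF inj] by metis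
    then show ?thesis using C(3) im0 by simp
  qed
  have dimS: "int (kv.dim (?V (Suc i))) = ?r i + ?r (Suc i)" for i
    using kvv.rank_nullity[OF lind[of i] subspace_gvec gvec_dim(1,2), of n "F (Suc i)" e] imS[of i]
        by simp
  define v r where "v i = int (kv.dim (?V i))" and "r i = ?r i" for i
  have euler: "int (hilbert_function n L e) = (\<Sum>i\<le>k. (-1) ^ i * v i) - (-1) ^ k * r k" for k
  proof (induction k)
    case (Suc k)
    have "v (Suc k) = r k + r (Suc k)" using dimS by (simp add: v_def r_def)
    with Suc show ?case by (simp add: algebra_simps)
  qed (simp add: H v_def r_def)
  have "gvec n (F (Suc e)) e = ({0} :: 'k pvec set)"
    using gres_degree_ge[OF F] by (intro gvec_high_degree) fastforce
  moreover have "kv.dim ({0} :: 'k pvec set) = 0"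
    using kv.dim_span[of "{} :: 'k pvec set"]
    by (simp add: kv.dim_eq_card_independent[OF kv.independent_empty])
  ultimately have "r e = 0"
    using plinear_0[OF glin_plinear[OF d[of e]]] by (simp add: r_def)
  then show ?thesis using euler[of e] by (simp add: v_def)
qed

section \<open>The Hilbert series of the polynomial ring and numerators\<close>

lemma monomial_count_0: "monomial_count 0 e = (if e = 0 then 1 else 0)"
proof -
  have "{m :: nat \<Rightarrow>\<^sub>0 nat. keys m \<subseteq> {1..0} \<and> mdeg m = e} = (if e = 0 then {0} else {})"
    by auto
  then show ?thesis by (simp add: monomial_count_def)
qed

lemma monomial_count_degree_0: "monomial_count n 0 = 1"
proof -
  have "{m :: nat \<Rightarrow>\<^sub>0 nat. keys m \<subseteq> {1..n} \<and> mdeg m = 0} = {0}"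
    by auto
  then show ?thesis by (simp add: monomial_count_def)
qed

lemma minus_single_add: "lookup m v > 0 \<Longrightarrow>
    m - single v 1 + single v (1::nat) = m"
  by (rule poly_mapping_eqI) (auto simp: lookup_add lookup_minus lookup_single when_def)

text \<open>A monomial either avoids the last variable or is the last variable times a monomial of
  degree one less.\<close>

lemma monomial_count_Suc: "monomial_count (Suc n) (Suc e) =
    monomial_count n (Suc e) + monomial_count (Suc n) e"
proof -
  let ?S = "\<lambda>n e. {m :: nat \<Rightarrow>\<^sub>0 nat. keys m \<subseteq> {1..n} \<and> mdeg m = e}"
  let ?f = "\<lambda>m. m + single (Suc n) (1::nat)"
  have "?S (Suc n) (Suc e) = ?S n (Suc e) \<union> ?f ` ?S (Suc n) e"
  proof (intro equalityI subsetI)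
    fix m assume m: "m \<in> ?S (Suc n) (Suc e)"
    show "m \<in> ?S n (Suc e) \<union> ?f ` ?S (Suc n) e"
    proof (cases "Suc n \<in> keys m")
      case True
      let ?m = "m - single (Suc n) 1"
      have eq: "m = ?f ?m" using minus_single_add[of m "Suc n"] True by (simp add: in_keys_iff)
      have "mdeg m = mdeg ?m + 1" by (subst eq) (simp add: mdeg_add)
      moreover have "keys ?m \<subseteq> keys m"
        by (auto simp: in_keys_iff lookup_minus)
      ultimately have "?m \<in> ?S (Suc n) e" using m by auto
      with eq show ?thesis by blast
    next
      case False
      then have "keys m \<subseteq> {1..n}" using m by (fastforce simp: le_Suc_eq)
      then show ?thesis using m by blast
    qed
  next
    fix m assume "m \<in> ?S n (Suc e) \<union> ?f ` ?S (Suc n) e"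
    then show "m \<in> ?S (Suc n) (Suc e)"
      by (fastforce simp: mdeg_add keys_add_nat)
  qed
  moreover have "?S n (Suc e) \<inter> ?f ` ?S (Suc n) e = {}"
    by (auto simp: keys_add_nat)
  moreover have "inj_on ?f (?S (Suc n) e)" by (simp add: inj_on_def)
  ultimately show ?thesis
    unfolding monomial_count_def
    by (simp only: card_Un_disjoint[OF finite_monomials finite_imageI[OF finite_monomials]] card_image)
qed

lemma fps_mult_1_minus_X_nth: "fps_nth (f * (1 - fps_X)) k = fps_nth f k - (if k =
    0 then 0 else fps_nth f (k - 1))" for f :: "int fps"
  by (simp add: right_diff_distrib)

text \<open>The recursion says that multiplication by \<open>1 - fps_X\<close> removes one variable.
  The inverse is expressed through a product, which stays within integer coefficients.\<close>

lemma monomial_count_fps: "Abs_fps (\<lambda>e. int (monomial_count n e)) * (1 - fps_X) ^ n = 1"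
proof (induction n)
  case 0
  show ?case by (rule fps_ext) (simp add: monomial_count_0)
next
  case (Suc n)
  have "Abs_fps (\<lambda>e. int (monomial_count (Suc n) e)) * (1 - fps_X) =
      Abs_fps (\<lambda>e. int (monomial_count n e))"
  proof (rule fps_ext)
    fix k
    show "fps_nth (Abs_fps (\<lambda>e. int (monomial_count (Suc n) e)) * (1 - fps_X)) k =
        fps_nth (Abs_fps (\<lambda>e. int (monomial_count n e))) k"
      unfolding fps_mult_1_minus_X_nth
      by (cases k) (simp_all add: monomial_count_degree_0 monomial_count_Suc)
  qed
  then show ?case using Suc by (simp add: mult.assoc[symmetric])
qed

lemma sum_nth_count_list:
  "(\<Sum>a<length xs. if xs ! a \<le> e then h (xs ! a) else 0) = (\<Sum>j\<le>e. count_list xs j * h j)"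
      for h :: "nat \<Rightarrow> nat"
proof -
  let ?h = "\<lambda>x. if x \<le> e then h x else 0"
  have "(\<Sum>a<length xs. ?h (xs ! a)) = sum_list (map ?h xs)"
    by (simp add: sum_list_sum_nth atLeast0LessThan)
  also have "\<dots> = (\<Sum>j\<le>e. count_list xs j * h j)"
  proof (induction xs)
    case (Cons x xs)
    have "(\<Sum>j\<le>e. count_list (x # xs) j * h j) = (\<Sum>j\<le>e. count_list xs j * h j + (if j =
        x then h j else 0))"
      by (rule sum.cong) auto
    also have "\<dots> = (\<Sum>j\<le>e. count_list xs j * h j) + ?h x"
      by (simp add: sum.distrib)
    finally show ?case using Cons by simp
  qed simp
  finally show ?thesis .
qed

text \<open>A generator of degree \<open>j\<close> contributes \<open>fps_X ^ j\<close> times the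
  Hilbert series of the ring, with the sign of its index. The sum over \<open>i\<close> stops at
  \<open>j\<close>, since a generator of index \<open>i\<close> has degree at least
  \<open>i\<close>.\<close>

lemma hilbert_series_numerator:
  fixes L :: "'k::field mpoly set"
  assumes L: "hideal n L" and F: "gres n L F g d" "gmin F d" "F 0 = [0]"
  shows "Abs_fps (\<lambda>e. int (hilbert_function n L e)) * (1 - fps_X) ^ n =
    Abs_fps (\<lambda>j. \<Sum>i\<le>j. (-1) ^ i * int (count_list (F i) j))" (is "?H * _ = ?C")
proof -
  let ?M = "Abs_fps (\<lambda>e. int (monomial_count n e))"
  have "?H = ?C * ?M"
  proof (rule fps_ext)
    fix e
    have zero: "count_list (F i) j = 0" if "j < i" for i j
    proof -
      have "j \<notin> set (F i)" using gres_degree_ge[OF F] that by (fastforce simp: in_set_conv_nth)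
      then show ?thesis by (simp add: count_list_0_iff)
    qed
    have "fps_nth ?H e = (\<Sum>i\<le>e. (-1) ^ i * (\<Sum>j\<le>e. int (count_list (F i) j) * int (monomial_count n
        (e - j))))"
      unfolding fps_nth_Abs_fps hilbert_function_euler[OF assms] gvec_dim(3)
      by (simp add: sum_nth_count_list[of "F _" e "\<lambda>j. monomial_count n (e - j)"])
    also have "\<dots> = (\<Sum>j\<le>e. (\<Sum>i\<le>e. (-1) ^ i * int (count_list (F i) j)) * int (monomial_count n (e - j)))"
      unfolding sum_distrib_left sum_distrib_right mult.assoc by (rule sum.swap)
    also have "\<dots> = (\<Sum>j\<le>e. (\<Sum>i\<le>j. (-1) ^ i * int (count_list (F i) j)) * int (monomial_count n (e - j)))"
    proof (rule sum.cong[OF refl])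
      fix j assume "j \<in> {..e}"
      then have "(\<Sum>i\<le>e. (-1) ^ i * int (count_list (F i) j)) = (\<Sum>i\<le>j. (-1) ^ i * int (count_list (F
          i) j))"
        using zero by (intro sum.mono_neutral_right) auto
      then show "(\<Sum>i\<le>e. (-1) ^ i * int (count_list (F i) j)) * int (monomial_count n (e - j)) =
          (\<Sum>i\<le>j. (-1) ^ i * int (count_list (F i) j)) * int (monomial_count n (e - j))" by simp
    qed
    also have "\<dots> = fps_nth (?C * ?M) e" by (simp add: fps_mult_nth atLeast0AtMost)
    finally show "fps_nth ?H e = fps_nth (?C * ?M) e" .
  qed
  then show ?thesis using monomial_count_fps[of n] by (simp add: mult.assoc)
qed

text \<open>If 1 lay in \<open>L\<close>, the empty set would be a residue basis in degree
  0.\<close>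

lemma one_notin_if_hilbert_function_0:
  assumes L: "hideal n L" and H: "hilbert_function n L 0 = 1"
  shows "1 \<notin> L"
proof
  assume one: "1 \<in> L"
  have "residue_basis n L 0 {}"
  proof (rule residue_basisI[OF _ _ hideal_subspace[OF L]])
    fix p :: "'a mpoly" assume "p \<in> forms n 0"
    then show "\<exists>c. p - (\<Sum>b\<in>{}. single 0 (c b) * b) \<in> L"
      using hideal_mult[OF L forms_carrier one] by simp
  qed auto
  from hilbert_function_eq[OF hideal_subspace[OF L] this] H show False by simp
qed

lemma sum_count_list_le: "(\<Sum>j\<le>n::nat. count_list xs j) \<le> length xs"
proof -
  have "(\<Sum>j\<le>n. count_list xs j) \<le> (\<Sum>j\<in>{..n} \<union> set xs. count_list xs j)"
    by (rule sum_mono2) auto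
  also have "\<dots> = length xs" by (rule sum_count_set) auto
  finally show ?thesis .
qed

text \<open>
  Since \<open>\<beta>\<^sub>i\<^sub>,\<^sub>j(I)\<close> is concentrated in odd \<open>j - i\<close>,
      for \<open>j > 0\<close> the \<open>j\<close>-th coefficient of the numerator of
  the Hilbert series is \<open>\<plusminus> \<Sum>\<^sub>i \<beta>\<^sub>i\<^sub>,\<^sub>j(I)\<close>, so no ideal with this Hilbert function has a smaller sum.
\<close>

lemma betti_eq_if_le:
  fixes I L :: "'k::field mpoly set"
  assumes L: "hideal n L" and I: "hideal n I"
    and H: "hilbert_function n L = H" "hilbert_function n I = H" "H 0 = 1"
    and num: "\<And>j. n < j \<Longrightarrow> fps_nth (Abs_fps (\<lambda>e. int (H e)) * (1 - fps_X) ^ n) j = 0"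
    and parity: "\<And>i j. even (int j - int i) \<Longrightarrow> j > 0 \<Longrightarrow> graded_betti n I i j = 0"
    and le: "betti n L \<le> betti n I"
  shows "betti n L 1 = betti n I 1"
proof -
  have "1 \<notin> L" "1 \<notin> I"
    using one_notin_if_hilbert_function_0[OF L] one_notin_if_hilbert_function_0[OF I] H by simp_all
  then obtain FL dL FI dI
    where FL: "gres n L FL (\<lambda>_. 1) dL" "gmin FL dL" "FL 0 = [0]"
      and FI: "gres n I FI (\<lambda>_. 1) dI" "gmin FI dI" "FI 0 = [0]"
    using minimal_resolution_exists[OF L] minimal_resolution_exists[OF I] by metis
  define bL bI where "bL i j = count_list (FL i) j" and "bI i j = count_list (FI i) j" for i j
  define c where "c j = fps_nth (Abs_fps (\<lambda>e. int (H e)) * (1 - fps_X) ^ n) j" for j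
  have cL: "c j = (\<Sum>i\<le>j. (-1) ^ i * int (bL i j))" for j
    using hilbert_series_numerator[OF L FL] H(1) by (simp add: c_def bL_def)
  have cI: "c j = (\<Sum>i\<le>j. (-1) ^ i * int (bI i j))" for j
    using hilbert_series_numerator[OF I FI] H(2) by (simp add: c_def bI_def)
  have bI0: "bI i j = 0" if "even (int j - int i)" "j > 0" for i j
    using parity[OF that] graded_betti_eq[OF I FI(1,2)] by (simp add: bI_def)
  have cI': "\<bar>c j\<bar> = int (\<Sum>i\<le>j. bI i j)" if "j > 0" for j
  proof -
    \<comment> \<open>Terms with \<open>i\<close> and \<open>j\<close> of equal parity vanish; for
      all others the sign is the same, \<open>(-1) ^ Suc j\<close>.\<close>
    have "(-1) ^ i * int (bI i j) = (-1) ^ (Suc j) * int (bI i j)" for i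
    proof (cases "even (int j - int i)")
      case False
      then have "even i \<longleftrightarrow> even (Suc j)" by simp
      then have "(-1 :: int) ^ i = (-1) ^ Suc j" by (simp only: minus_one_power_iff)
      then show ?thesis by simp
    qed (simp add: bI0 that)
    then have "c j = (-1) ^ (Suc j) * int (\<Sum>i\<le>j. bI i j)"
      unfolding cI by (simp add: sum_distrib_left)
    then show ?thesis
      by (simp only: abs_mult power_abs abs_minus_cancel abs_one power_one mult_1_left abs_of_nat)
  qed
  have le_j: "(\<Sum>i\<le>j. bI i j) \<le> (\<Sum>i\<le>j. bL i j)" for j
  proof (cases "j = 0")
    case True
    then show ?thesis using cL[of 0] cI[of 0] by simp
  next
    case False
    have "\<bar>c j\<bar> \<le> (\<Sum>i\<le>j. \<bar>(-1) ^ i * int (bL i j)\<bar>)" unfolding cL by (rule sum_abs)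
    also have "\<dots> = int (\<Sum>i\<le>j. bL i j)" by (simp add: abs_mult power_abs)
    finally have "int (\<Sum>i\<le>j. bI i j) \<le> int (\<Sum>i\<le>j. bL i j)" using cI'[of j] False by simp
    then show ?thesis by (simp only: of_nat_le_iff)
  qed
  have low: "bI i j = 0" if "j < i" for i j
    using gres_degree_ge[OF FI] that by (fastforce simp: bI_def count_list_0_iff in_set_conv_nth)
  \<comment> \<open>Beyond degree \<open>n\<close> the numerator has coefficient 0, and without
    cancellation each summand for \<open>I\<close> is 0. This confines the sums for \<open>I\<close>
    to degrees at most \<open>n\<close>.\<close>
  have high: "bI i j = 0" if "n < j" for i j
  proof (cases "i \<le> j")
    case True
    have "c j = 0" using num[OF that] by (simp add: c_def)
    then have "int (\<Sum>i\<le>j. bI i j) = 0" using cI'[of j] that by linarith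
    then have "(\<Sum>i\<le>j. bI i j) = 0" by (simp only: of_nat_eq_0_iff)
    then show ?thesis using True by simp
  qed (simp add: low)
  have lenI: "length (FI i) = (\<Sum>j\<le>n. bI i j)" for i
  proof -
    have "set (FI i) \<subseteq> {..n}"
      using high by (force simp: bI_def count_list_0_iff not_le[symmetric])
    from sum_count_set[OF this] show ?thesis by (simp add: bI_def)
  qed
  have bet: "betti n L i = length (FL i)" "betti n I i = length (FI i)" for i
    using betti_eq[OF L FL(1,2)] betti_eq[OF I FI(1,2)] by simp_all
  have lt: "length (FL i) \<le> length (FI i)" for i
    using le bet by (simp add: le_fun_def)
  \<comment> \<open>The range up to \<open>n+1\<close> contains every index
    \<open>i \<le> j \<le> n\<close>, and it contains the index 1 even if
    \<open>n = 0\<close>.\<close>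
  have "(\<Sum>i\<le>n+1. length (FI i)) = (\<Sum>j\<le>n. \<Sum>i\<le>n+1. bI i j)"
    unfolding lenI by (rule sum.swap)
  also have "\<dots> = (\<Sum>j\<le>n. \<Sum>i\<le>j. bI i j)"
    using low by (intro sum.cong sum.mono_neutral_right) auto
  also have "\<dots> \<le> (\<Sum>j\<le>n. \<Sum>i\<le>j. bL i j)" by (rule sum_mono) (rule le_j)
  also have "\<dots> \<le> (\<Sum>j\<le>n. \<Sum>i\<le>n+1. bL i j)" by (intro sum_mono sum_mono2) auto
  also have "\<dots> = (\<Sum>i\<le>n+1. \<Sum>j\<le>n. bL i j)" by (rule sum.swap)
  also have "\<dots> \<le> (\<Sum>i\<le>n+1. length (FL i))" unfolding bL_def by (intro sum_mono sum_count_list_le)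
  finally have "(\<Sum>i\<le>n+1. length (FL i)) = (\<Sum>i\<le>n+1. length (FI i))"
    using sum_mono[of "{..n+1}" "\<lambda>i. length (FL i)" "\<lambda>i. length (FI i)"] lt by force
  \<comment> \<open>Equal sums of termwise comparable summands are equal term by term; the index 1
    is extracted.\<close>
  from sum_mono_inv[OF this lt, of 1] bet show ?thesis by simp
qed

section \<open>Squarefree monomial ideals\<close>

text \<open>Membership is tested on the supports of monomials. The family may be any set of sets:
  \<open>{{}}\<close> gives the ideal of polynomials without constant term, and \<open>{}\<close>
  the whole ring.\<close>

definition face_ideal :: "nat \<Rightarrow> nat set set \<Rightarrow> 'k::field mpoly set" where
  "face_ideal n \<Delta> = {p \<in> carrier (polyring n). \<forall>m\<in>keys p. keys m \<notin> \<Delta>}"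

definition down_closed :: "nat set set \<Rightarrow> bool" where
  "down_closed \<Delta> \<longleftrightarrow> (\<forall>\<sigma>\<in>\<Delta>. \<forall>\<tau>. \<tau> \<subseteq> \<sigma> \<longrightarrow> \<tau> \<in> \<Delta>)"

lemma down_closedD: "down_closed \<Delta> \<Longrightarrow> \<sigma> \<in> \<Delta> \<Longrightarrow> \<tau> \<subseteq> \<sigma> \<Longrightarrow> \<tau> \<in> \<Delta>"
  by (auto simp: down_closed_def)

lemma carrier_polyring_mult:
  "p \<in> carrier (polyring n) \<Longrightarrow> q \<in> carrier (polyring n) \<Longrightarrow> p * q \<in> carrier (polyring n)"
  by (fastforce simp: polyring_def keys_add_nat dest: keys_mult_mpoly)

lemma down_closed_avoiding: "down_closed {\<tau>. \<forall>\<sigma>\<in>S. \<not> \<sigma> \<subseteq> \<tau>}"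
  by (auto simp: down_closed_def)

lemma hideal_face_ideal:
  assumes "down_closed \<Delta>"
  shows "hideal n (face_ideal n \<Delta>)"
  unfolding hideal_def
proof (intro conjI ballI allI)
  show "0 \<in> face_ideal n \<Delta>" by (simp add: face_ideal_def polyring_def)
next
  fix p q :: "'a mpoly" assume "p \<in> face_ideal n \<Delta>" "q \<in> face_ideal n \<Delta>"
  then show "p + q \<in> face_ideal n \<Delta>"
    using keys_add[of p q] by (auto simp: face_ideal_def carrier_polyring_add)
next
  fix q p :: "'a mpoly" assume q: "q \<in> carrier (polyring n)" and p: "p \<in> face_ideal n \<Delta>"
  show "q * p \<in> face_ideal n \<Delta>"
    unfolding face_ideal_def
  proof (intro CollectI conjI ballI)
    show "q * p \<in> carrier (polyring n)" using p q by (simp add: face_ideal_def carrier_polyring_mult)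
    fix m assume "m \<in> keys (q * p)"
    then obtain a b where ab: "b \<in> keys p" "m = a + b" using keys_mult_mpoly by blast
    then have "keys b \<notin> \<Delta>" using p by (simp add: face_ideal_def)
    then show "keys m \<notin> \<Delta>"
      using down_closedD[OF assms, of "keys m" "keys b"] ab(2) by (auto simp: keys_add_nat)
  qed
next
  fix p :: "'a mpoly" and d assume p: "p \<in> face_ideal n \<Delta>"
  have "keys (hcomponent d p) \<subseteq> keys p"
    by (auto simp: in_keys_iff lookup_hcomponent split: if_splits)
  then show "hcomponent d p \<in> face_ideal n \<Delta>" using p by (auto simp: face_ideal_def polyring_def)
qed

lemma polyring_simps [simp]:
  "p \<oplus>\<^bsub>polyring n\<^esub> q = p + q" "p \<otimes>\<^bsub>polyring n\<^esub> q = p * q"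
  "\<one>\<^bsub>polyring n\<^esub> = 1" "\<zero>\<^bsub>polyring n\<^esub> = 0"
  by (simp_all add: polyring_def)

lemma ring_polyring: "ring (polyring n :: 'k::field mpoly ring)"
proof (rule ringI)
  have c: "- p \<in> carrier (polyring n)" if "p \<in> carrier (polyring n)" for p :: "'k mpoly"
    using that by (simp add: polyring_def)
  show "abelian_group (polyring n :: 'k mpoly ring)"
  proof (rule abelian_groupI)
    fix x :: "'k mpoly" assume x: "x \<in> carrier (polyring n)"
    show "\<exists>y\<in>carrier (polyring n). y \<oplus>\<^bsub>polyring n\<^esub> x = \<zero>\<^bsub>polyring n\<^esub>"
      using c[OF x] by (intro bexI[of _ "- x"]) simp_all
  qed (simp_all add: carrier_polyring_add carrier_polyring_0 algebra_simps)
  show "Group.monoid (polyring n :: 'k mpoly ring)"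
    by (rule Group.monoid.intro) (simp_all add: carrier_polyring_mult forms_carrier[OF forms_1]
        mult.assoc)
qed (simp_all add: algebra_simps)

lemma ideal_if_hideal:
  fixes L :: "'k::field mpoly set"
  assumes L: "hideal n L" "L \<subseteq> carrier (polyring n)"
  shows "ideal L (polyring n)"
proof (rule idealI[OF ring_polyring])
  interpret ring "polyring n :: 'k mpoly ring" by (rule ring_polyring)
  show "subgroup L (add_monoid (polyring n))"
  proof (rule add.subgroupI)
    show "L \<subseteq> carrier (polyring n)" by (rule L(2))
    show "L \<noteq> {}" using hideal_0[OF L(1)] by blast
    fix a assume a: "a \<in> L"
    have "\<ominus>\<^bsub>polyring n\<^esub> a = - a"
      using a L(2) hideal_uminus[OF L(1) a] by (intro minus_equality) auto
    then show "\<ominus>\<^bsub>polyring n\<^esub> a \<in> L" using hideal_uminus[OF L(1) a] by simp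
  next
    fix a b assume "a \<in> L" "b \<in> L"
    then show "a \<oplus>\<^bsub>polyring n\<^esub> b \<in> L" using hideal_add[OF L(1)] by simp
  qed
next
  fix a x :: "'k mpoly" assume "a \<in> L" "x \<in> carrier (polyring n)"
  then show "x \<otimes>\<^bsub>polyring n\<^esub> a \<in> L" "a \<otimes>\<^bsub>polyring n\<^esub> x \<in> L"
    using hideal_mult[OF L(1), of x a] by (simp_all add: mult.commute[of a x])
qed

lemma homogeneous_ideal_if_hideal:
  "hideal n L \<Longrightarrow> L \<subseteq> carrier (polyring n) \<Longrightarrow> homogeneous_ideal n L"
  by (simp add: homogeneous_ideal_def ideal_if_hideal hideal_hcomponent)

lemma face_ideal_subset: "face_ideal n \<Delta> \<subseteq> carrier (polyring n)"
  by (auto simp: face_ideal_def)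

definition indicator_exponent :: "nat set \<Rightarrow> (nat \<Rightarrow>\<^sub>0 nat)" where
  "indicator_exponent \<sigma> = (\<Sum>v\<in>\<sigma>. single v 1)"

lemma sqfree_monomial_eq: "sqfree_monomial \<sigma> = single (indicator_exponent \<sigma>) 1"
  by (simp add: sqfree_monomial_def indicator_exponent_def)

lemma lookup_indicator_exponent:
  "finite \<sigma> \<Longrightarrow> lookup (indicator_exponent \<sigma>) v = (if v \<in> \<sigma> then 1 else 0)"
  by (simp add: indicator_exponent_def lookup_sum lookup_single when_def)

lemma keys_indicator_exponent: "finite \<sigma> \<Longrightarrow> keys (indicator_exponent \<sigma>) = \<sigma>"
  by (auto simp: in_keys_iff lookup_indicator_exponent split: if_splits)

lemma mdeg_indicator_exponent: "finite \<sigma> \<Longrightarrow> mdeg (indicator_exponent \<sigma>) = card \<sigma>"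
  by (simp add: mdeg_def keys_indicator_exponent lookup_indicator_exponent)

lemma indicator_exponent_factor:
  assumes "finite \<sigma>" "\<sigma> \<subseteq> keys m"
  shows "m = (m - indicator_exponent \<sigma>) + indicator_exponent \<sigma>"
proof (rule poly_mapping_eqI)
  fix v
  show "lookup m v = lookup (m - indicator_exponent \<sigma> + indicator_exponent \<sigma>) v"
    using assms by (cases "v \<in> \<sigma>") (auto simp: lookup_add lookup_minus lookup_indicator_exponent
        in_keys_iff)
qed

text \<open>Divisibility by a squarefree monomial depends only on the support, so a polynomial lies
  in the ideal if the support of each of its monomials contains some \<open>\<sigma>\<close> in
  \<open>S\<close>. The other inclusion is minimality of the generated ideal.\<close>

lemma genideal_sqfree_monomials:
  fixes n :: nat
  assumes S: "S \<subseteq> Pow {1..n}"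
  shows "Idl\<^bsub>polyring n\<^esub> (sqfree_monomial ` S) = (face_ideal n {\<tau>. \<forall>\<sigma>\<in>S. \<not> \<sigma> \<subseteq> \<tau>} :: 'k::field mpoly
      set)"
    (is "?I = face_ideal n ?\<Delta>")
proof
  have fin: "finite \<sigma>" if "\<sigma> \<in> S" for \<sigma> using S that finite_subset by blast
  interpret ring "polyring n :: 'k mpoly ring" by (rule ring_polyring)
  have gens: "sqfree_monomial ` S \<subseteq> (face_ideal n ?\<Delta> :: 'k mpoly set)"
  proof (rule image_subsetI)
    fix \<sigma> assume "\<sigma> \<in> S"
    moreover from this S have "\<sigma> \<subseteq> {1..n}" by blast
    ultimately show "(sqfree_monomial \<sigma> :: 'k mpoly) \<in> face_ideal n ?\<Delta>"
      using fin by (auto simp: sqfree_monomial_eq face_ideal_def polyring_def keys_indicator_exponent)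
  qed
  show "?I \<subseteq> face_ideal n ?\<Delta>"
    by (rule genideal_minimal[OF ideal_if_hideal[OF hideal_face_ideal[OF down_closed_avoiding]
        face_ideal_subset] gens])
  show "face_ideal n ?\<Delta> \<subseteq> ?I"
  proof
    fix p :: "'k mpoly" assume p: "p \<in> face_ideal n ?\<Delta>"
    have sub: "sqfree_monomial ` S \<subseteq> carrier (polyring n :: 'k mpoly ring)"
      using gens by (auto simp: face_ideal_def)
    interpret I: ideal ?I "polyring n" by (rule genideal_ideal[OF sub])
    have add: "additive_subgroup ?I (polyring n)" by unfold_locales
    have mon: "single m (lookup p m) \<in> ?I" if m: "m \<in> keys p" for m
    proof -
      obtain \<sigma> where \<sigma>: "\<sigma> \<in> S" "\<sigma> \<subseteq> keys m" using p m by (auto simp: face_ideal_def)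
      let ?q = "single (m - indicator_exponent \<sigma>) (lookup p m)"
      have "keys (m - indicator_exponent \<sigma>) \<subseteq> keys m"
        by (auto simp: in_keys_iff lookup_minus)
      then have "?q \<in> carrier (polyring n)" using p m by (auto simp: face_ideal_def polyring_def)
      moreover have "sqfree_monomial \<sigma> \<in> ?I" using genideal_self[OF sub] \<sigma>(1) by blast
      ultimately have "?q \<otimes>\<^bsub>polyring n\<^esub> sqfree_monomial \<sigma> \<in> ?I" by (rule I.I_l_closed[rotated])
      then show ?thesis
        using indicator_exponent_factor[OF fin[OF \<sigma>(1)] \<sigma>(2)]
        by (simp add: polyring_def sqfree_monomial_eq mult_single)
    qed
    have "(\<Sum>m\<in>A. single m (lookup p m)) \<in> ?I" if "finite A" "A \<subseteq> keys p" for A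
      using that
    proof (induction A rule: finite_induct)
      case empty
      then show ?case using additive_subgroup.zero_closed[OF add] by (simp add: polyring_def)
    next
      case (insert m A)
      then show ?case using additive_subgroup.a_closed[OF add mon[of m]] by (simp add: polyring_def)
    qed
    from this[of "keys p"] show "p \<in> ?I"
      using poly_mapping_sum_single[of "keys p" p] by simp
  qed
qed

lemma face_ideal_cong:
  "(\<And>\<tau>. \<tau> \<subseteq> {1..n} \<Longrightarrow> \<tau> \<in> \<Delta> \<longleftrightarrow> \<tau> \<in> \<Delta>') \<Longrightarrow> face_ideal n \<Delta> = face_ideal n \<Delta>'"
  by (auto simp: face_ideal_def polyring_def)

lemma minimal_nonface_below:
  assumes "\<tau> \<subseteq> {1..n}" "\<tau> \<notin> \<Delta>"
  shows "\<exists>\<sigma>\<in>minimal_nonfaces n \<Delta>. \<sigma> \<subseteq> \<tau>"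
proof -
  have "finite \<tau>" using assms(1) finite_subset by blast
  then show ?thesis
    using assms
  proof (induction \<tau> rule: finite_psubset_induct)
    case (psubset \<tau>)
    show ?case
    proof (cases "\<tau> \<in> minimal_nonfaces n \<Delta>")
      case False
      then obtain \<tau>' where \<tau>': "\<tau>' \<subset> \<tau>" "\<tau>' \<notin> \<Delta>" using psubset.prems
          by (auto simp: minimal_nonfaces_def)
      then show ?thesis using psubset.IH[of \<tau>'] psubset.prems(1) by blast
    qed blast
  qed
qed

lemma stanley_reisner_ideal_eq:
  assumes "down_closed \<Delta>"
  shows "stanley_reisner_ideal n \<Delta> = face_ideal n \<Delta>"
proof -
  have "stanley_reisner_ideal n \<Delta> = face_ideal n {\<tau>. \<forall>\<sigma>\<in>minimal_nonfaces n \<Delta>. \<not> \<sigma> \<subseteq> \<tau>}"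
    unfolding stanley_reisner_ideal_def by (rule genideal_sqfree_monomials)
        (auto simp: minimal_nonfaces_def)
  also have "\<dots> = face_ideal n \<Delta>"
  proof (rule face_ideal_cong)
    fix \<tau> assume \<tau>: "\<tau> \<subseteq> {1..n}"
    show "\<tau> \<in> {\<tau>. \<forall>\<sigma>\<in>minimal_nonfaces n \<Delta>. \<not> \<sigma> \<subseteq> \<tau>} \<longleftrightarrow> \<tau> \<in> \<Delta>"
    proof
      assume "\<tau> \<in> {\<tau>. \<forall>\<sigma>\<in>minimal_nonfaces n \<Delta>. \<not> \<sigma> \<subseteq> \<tau>}"
      then show "\<tau> \<in> \<Delta>" using minimal_nonface_below[OF \<tau>] by blast
    next
      assume "\<tau> \<in> \<Delta>"
      then have "\<sigma> \<in> \<Delta>" if "\<sigma> \<subseteq> \<tau>" for \<sigma> using down_closedD[OF assms] that by blast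
      then show "\<tau> \<in> {\<tau>. \<forall>\<sigma>\<in>minimal_nonfaces n \<Delta>. \<not> \<sigma> \<subseteq> \<tau>}"
        by (auto simp: minimal_nonfaces_def)
    qed
  qed
  finally show ?thesis .
qed

lemma sqfree_monomial_ideal_hideal: "sqfree_monomial_ideal n L \<Longrightarrow> hideal n L"
  unfolding sqfree_monomial_ideal_def
  by (elim exE conjE) (simp add: genideal_sqfree_monomials hideal_face_ideal down_closed_avoiding)

lemma sqfree_monomial_ideal_stanley_reisner: "sqfree_monomial_ideal n (stanley_reisner_ideal n \<Delta>)"
  unfolding sqfree_monomial_ideal_def stanley_reisner_ideal_def
  by (intro exI[of _ "minimal_nonfaces n \<Delta>"]) (auto simp: minimal_nonfaces_def)

lemma simplicial_complex_down_closed: "simplicial_complex n \<Delta> \<Longrightarrow> down_closed \<Delta>"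
  by (simp add: simplicial_complex_def down_closed_def)

lemma finite_minimal_nonfaces: "finite (minimal_nonfaces n \<Delta>)"
  by (rule finite_subset[of _ "Pow {1..n}"]) (auto simp: minimal_nonfaces_def)

text \<open>Minimal nonfaces are pairwise incomparable. In a relation among their monomials, the
  coefficient at the squarefree monomial of one of them therefore comes only from the constant term
  of the factor in front of that one.\<close>

lemma face_ideal_generators:
  fixes n :: nat
  assumes \<Delta>: "down_closed \<Delta>" and xs: "set xs = minimal_nonfaces n \<Delta>" "distinct xs"
  defines "c \<equiv> \<lambda>b. (sqfree_monomial (xs ! b) :: 'k::field mpoly) *\<^sub>p bvec 0"
  shows "generates n (ideal_gvec n (face_ideal n \<Delta>)) (map card xs) c"
    and "const_free_kernel n (map card xs) (lin (length xs) c)"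
proof -
  let ?L = "face_ideal n \<Delta> :: 'k mpoly set"
  have nf: "\<sigma> \<subseteq> {1..n}" "\<sigma> \<notin> \<Delta>" "finite \<sigma>" if "\<sigma> \<in> set xs" for \<sigma>
    using that finite_subset[of \<sigma> "{1..n}"] by (auto simp: xs(1) minimal_nonfaces_def)
  let ?zs = "map (\<lambda>\<sigma>. (card \<sigma>, (sqfree_monomial \<sigma> :: 'k mpoly) *\<^sub>p bvec 0)) xs"
  have sq: "(sqfree_monomial \<sigma> :: 'k mpoly) \<in> forms n (card \<sigma>)" if "\<sigma> \<in> set xs" for \<sigma>
    using nf[OF that] by (simp add: sqfree_monomial_eq forms_iff keys_indicator_exponent
        mdeg_indicator_exponent)
  show "generates n (ideal_gvec n ?L) (map card xs) c"
    unfolding generates_def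
  proof (intro conjI allI impI ballI)
    fix b assume b: "b < length (map card xs)"
    then have \<sigma>: "xs ! b \<in> set xs" by simp
    have "c b \<in> gvec n [0] (map card xs ! b)"
      unfolding c_def using gvec_pscale[OF sq[OF \<sigma>] gvec_bvec[of 0 "[0]" n]] b by simp
    moreover have "c b 0 \<in> ?L"
      using nf[OF \<sigma>] by (simp add: c_def sqfree_monomial_eq face_ideal_def polyring_def
          keys_indicator_exponent)
    ultimately show "c b \<in> ideal_gvec n ?L (map card xs ! b)" by (simp add: ideal_gvec_def)
  next
    fix e and u :: "'k pvec" assume u: "u \<in> ideal_gvec n ?L e"
    then have ug: "u \<in> gvec n [0] e" and uL: "u 0 \<in> ?L" by (auto simp: ideal_gvec_def)
    have uf: "u 0 \<in> forms n e" using gvec_forms[OF ug, of 0] by simp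
    have "u = (\<Sum>m\<in>keys (u 0). single m (lookup (u 0) m) *\<^sub>p bvec 0)"
    proof
      fix a
      show "u a = (\<Sum>m\<in>keys (u 0). single m (lookup (u 0) m) *\<^sub>p bvec 0) a"
        using gvec_outside[OF ug, of a] poly_mapping_sum_single[of "keys (u 0)" "u 0"]
        by (cases "a = 0") (simp_all add: sum_fun_apply bvec_def)
    qed
    moreover have "hspan n (set ?zs) e (\<Sum>m\<in>keys (u 0). single m (lookup (u 0) m) *\<^sub>p bvec 0)"
    proof (rule hspan_sum)
      fix m assume m: "m \<in> keys (u 0)"
      have m': "keys m \<subseteq> {1..n}" "mdeg m = e" "keys m \<notin> \<Delta>"
        using m uf uL by (auto simp: forms_iff face_ideal_def)
      obtain \<sigma> where \<sigma>: "\<sigma> \<in> set xs" "\<sigma> \<subseteq> keys m"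
        using minimal_nonface_below[OF m'(1,3)] xs(1) by blast
      let ?r = "m - indicator_exponent \<sigma>"
      have mr: "m = ?r + indicator_exponent \<sigma>"
          by (rule indicator_exponent_factor[OF nf(3)[OF \<sigma>(1)] \<sigma>(2)])
      have keys: "keys ?r \<subseteq> {1..n}" using m'(1) by (auto simp: in_keys_iff lookup_minus)
      have "mdeg m = mdeg ?r + card \<sigma>"
        by (subst mr) (simp only: mdeg_add mdeg_indicator_exponent[OF nf(3)[OF \<sigma>(1)]])
      moreover have "hspan n (set ?zs) (mdeg ?r + card \<sigma>)
          (single ?r (lookup (u 0) m) *\<^sub>p sqfree_monomial \<sigma> *\<^sub>p bvec 0)"
        using \<sigma>(1) by (intro hspan_gen forms_single keys) auto
      moreover have "single ?r (lookup (u 0) m) *\<^sub>p sqfree_monomial \<sigma> *\<^sub>p bvec 0 =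
          single m (lookup (u 0) m) *\<^sub>p bvec 0"
        unfolding pscale_pscale sqfree_monomial_eq mult_single using mr by simp
      ultimately show "hspan n (set ?zs) e (single m (lookup (u 0) m) *\<^sub>p bvec 0)"
        using m'(2) by simp
    qed
    ultimately have "hspan n (set ?zs) e u" by simp
    from hspan_lin[OF this] obtain v where v: "v \<in> gvec n (map fst ?zs) e" "u =
        lin (length ?zs) (\<lambda>b. snd (?zs ! b)) v" by blast
    have "map fst ?zs = map card xs" by simp
    moreover have "lin (length ?zs) (\<lambda>b. snd (?zs ! b)) v = lin (length (map card xs)) c v"
      unfolding lin_def c_def by (intro sum.cong) auto
    ultimately show "\<exists>v\<in>gvec n (map card xs) e. u = lin (length (map card xs)) c v" using v by metis
  qed
  show "const_free_kernel n (map card xs) (lin (length xs) c)"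
    unfolding const_free_kernel_def
  proof (intro allI ballI impI, rule ccontr)
    fix e b0 and v :: "'k pvec"
    assume v: "v \<in> gvec n (map card xs) e" and 0: "lin (length xs) c v = 0"
      and k: "lookup (v b0) 0 \<noteq> 0"
    have b0: "b0 < length xs" using gvecD[OF v, of 0 b0] k by (auto simp: in_keys_iff)
    let ?m = "indicator_exponent (xs ! b0)"
    have "0 = lookup (lin (length xs) c v 0) ?m" by (simp add: 0)
    also have "\<dots> = (\<Sum>b<length xs. lookup (v b * sqfree_monomial (xs ! b)) ?m)"
      by (simp add: lin_def sum_fun_apply lookup_sum c_def)
    also have "\<dots> = (\<Sum>b<length xs. if b = b0 then lookup (v b0) 0 else 0)"
    proof (rule sum.cong[OF refl])
      fix b assume b: "b \<in> {..<length xs}"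
      show "lookup (v b * sqfree_monomial (xs ! b)) ?m = (if b = b0 then lookup (v b0) 0 else 0)"
      proof (cases "b = b0")
        case True
        then show ?thesis
          using lookup_single_mult[of ?m 1 "v b0" 0] by (simp add: sqfree_monomial_eq mult.commute)
      next
        case False
        \<comment> \<open>Divisibility of squarefree monomials would be a proper inclusion between
          two minimal nonfaces.\<close>
        have "?m \<noteq> indicator_exponent (xs ! b) + m'" for m'
        proof
          assume *: "?m = indicator_exponent (xs ! b) + m'"
          have "xs ! b0 = keys ?m" using nf(3) b0 by (simp add: keys_indicator_exponent)
          also have "\<dots> = xs ! b \<union> keys m'"
            unfolding * keys_add_nat using nf(3) b by (simp add: keys_indicator_exponent)
          finally have "xs ! b \<subseteq> xs ! b0" by blast
          moreover have "xs ! b \<noteq> xs ! b0" using False b b0 xs(2) by (simp add: nth_eq_iff_index_eq)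
          moreover have "xs ! b0 \<in> minimal_nonfaces n \<Delta>" "xs ! b \<in> minimal_nonfaces n \<Delta>"
            using b b0 xs(1) nth_mem by (blast, fastforce)
          ultimately show False unfolding minimal_nonfaces_def by blast
        qed
        then show ?thesis
          using False lookup_single_mult_not[of ?m "indicator_exponent (xs ! b)" 1 "v b"]
          by (simp add: sqfree_monomial_eq mult.commute)
      qed
    qed
    also have "\<dots> = lookup (v b0) 0" using b0 by simp
    finally show False using k by simp
  qed
qed

text \<open>The minimal nonfaces can be imposed as \<open>F 1\<close> of a minimal resolution; the
  empty face keeps 1 out of the ideal.\<close>

lemma betti_1_face_ideal:
  assumes \<Delta>: "down_closed \<Delta>" "{} \<in> \<Delta>"
  shows "betti n (face_ideal n \<Delta> :: 'k::field mpoly set) 1 = card (minimal_nonfaces n \<Delta>)"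
    and "graded_betti n (face_ideal n \<Delta> :: 'k mpoly set) 1 j = card {\<sigma> \<in> minimal_nonfaces n \<Delta>. card
        \<sigma> = j}"
proof -
  let ?L = "face_ideal n \<Delta> :: 'k mpoly set"
  have L: "hideal n ?L" by (rule hideal_face_ideal[OF \<Delta>(1)])
  have one: "1 \<notin> ?L" using \<Delta>(2) by (simp add: face_ideal_def)
  obtain xs where xs: "set xs = minimal_nonfaces n \<Delta>" "distinct xs"
    using finite_distinct_list[OF finite_minimal_nonfaces] by blast
  note gens = face_ideal_generators[OF \<Delta>(1) xs, where 'k = 'k]
  obtain F d where F: "gres n ?L F (\<lambda>_. 1) d" "gmin F d" "F 0 = [0]" "F 1 = map card xs"
    using minimal_resolution_extends[OF L one gens(1)] gens(2) by (metis length_map)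
  show "betti n ?L 1 = card (minimal_nonfaces n \<Delta>)"
    using betti_eq[OF L F(1,2), of 1] F(4) distinct_card[OF xs(2)] xs(1) by simp
  have "count_list (map card xs) j = length (filter (\<lambda>\<sigma>. card \<sigma> = j) xs)"
    by (simp add: count_list_eq_length_filter filter_map o_def eq_commute)
  also have "\<dots> = card {\<sigma> \<in> minimal_nonfaces n \<Delta>. card \<sigma> = j}"
    using distinct_card[of "filter (\<lambda>\<sigma>. card \<sigma> = j) xs"] xs by (simp add: set_filter)
  finally show "graded_betti n ?L 1 j = card {\<sigma> \<in> minimal_nonfaces n \<Delta>. card \<sigma> = j}"
    using graded_betti_eq[OF L F(1,2), of 1 j] F(4) by simp
qed

section \<open>Resolutions of partial cones\<close>

definition var :: "nat \<Rightarrow> 'k::field mpoly" where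
  "var v = single (single v 1) 1"

lemma var_forms: "1 \<le> v \<Longrightarrow> v \<le> n \<Longrightarrow> var v \<in> forms n 1"
  by (simp add: var_def forms_iff)

lemma lookup_var_mult: "lookup (var v * p) (m + single v 1) = lookup p m"
  using lookup_single_mult[of "single v 1" 1 p m] by (simp add: var_def add.commute)

lemma lookup_var_mult_not: "v \<notin> keys m \<Longrightarrow> lookup (var v * p) m = 0"
  unfolding var_def by (rule lookup_single_mult_not) (auto simp: keys_add_nat)

lemma keys_var_mult:
  "keys (var v * p) = (\<lambda>m. m + single v 1) ` keys p"
proof (intro equalityI subsetI)
  fix m assume "m \<in> keys (var v * p)"
  then show "m \<in> (\<lambda>m. m + single v 1) ` keys p"
    by (auto simp: var_def add.commute dest!: keys_mult_mpoly)
next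
  fix m assume "m \<in> (\<lambda>m. m + single v 1) ` keys p"
  then obtain m' where "m' \<in> keys p" "m = m' + single v 1" by blast
  then show "m \<in> keys (var v * p)"
    using lookup_var_mult[of v p m'] by (simp add: in_keys_iff)
qed

text \<open>Remainder of the division by the variable with index \<open>v\<close>; the next
  definition is the quotient.\<close>

definition rem_var :: "nat \<Rightarrow> 'k::field mpoly \<Rightarrow> 'k mpoly" where
  "rem_var v p = (\<Sum>m\<in>{m \<in> keys p. v \<notin> keys m}.
     single m (lookup p m))"

definition div_var :: "nat \<Rightarrow> 'k::field mpoly \<Rightarrow> 'k mpoly" where
  "div_var v p = (\<Sum>m\<in>{m \<in> keys p. v \<in> keys m}.
     single (m - single v 1) (lookup p m))"

lemma rem_div_var: "p = rem_var v p + var v * div_var v p"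
proof -
  let ?A = "{m \<in> keys p. v \<notin> keys m}"
  let ?B = "{m \<in> keys p. v \<in> keys m}"
  have "var v * div_var v p = (\<Sum>m\<in>?B. single m (lookup p m))"
    unfolding div_var_def sum_distrib_left
  proof (rule sum.cong[OF refl])
    fix m assume "m \<in> ?B"
    then have "single v 1 + (m - single v 1) = m"
      using minus_single_add[of m v] by (simp add: in_keys_iff add.commute)
    then show "var v * single (m - single v 1) (lookup p m) =
        single m (lookup p m)"
      unfolding var_def mult_single by simp
  qed
  moreover have "p = (\<Sum>m\<in>?A \<union> ?B. single m (lookup p m))"
    by (rule poly_mapping_sum_single) auto
  moreover have "\<dots> = (\<Sum>m\<in>?A. single m (lookup p m)) +
      (\<Sum>m\<in>?B. single m (lookup p m))"
    by (rule sum.union_disjoint) auto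
  ultimately show ?thesis by (simp add: rem_var_def)
qed

lemma keys_rem_var: "m \<in> keys (rem_var v p) \<Longrightarrow> m \<in> keys p \<and> v \<notin> keys m"
  unfolding rem_var_def using keys_sum by (fastforce split: if_splits)

lemma keys_div_var: "m \<in> keys (div_var v p) \<Longrightarrow> m + single v 1 \<in> keys p"
proof -
  assume "m \<in> keys (div_var v p)"
  then have "m + single v 1 \<in> keys (var v * div_var v p)"
    by (simp add: keys_var_mult)
  then have "lookup (var v * div_var v p) (m + single v 1) \<noteq> 0"
    by (simp add: in_keys_iff)
  moreover have "m + single v 1 \<notin> keys (rem_var v p)"
    using keys_rem_var[of "m + single v 1" v p] by (auto simp: keys_add_nat)
  ultimately have "lookup (rem_var v p + var v * div_var v p) (m + single v 1) \<noteq> 0"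
    by (simp add: lookup_add in_keys_iff)
  then show ?thesis by (simp add: rem_div_var[symmetric] in_keys_iff)
qed

lemma rem_var_forms: "p \<in> forms (Suc n) e \<Longrightarrow> rem_var (Suc n) p \<in> forms n e"
  unfolding forms_iff by (fastforce dest!: keys_rem_var simp: le_Suc_eq)

lemma div_var_forms: "p \<in> forms (Suc n) (Suc e) \<Longrightarrow> div_var (Suc n) p \<in> forms (Suc n) e"
  unfolding forms_iff by (fastforce dest!: keys_div_var simp: keys_add_nat mdeg_add)

lemma forms_Suc_0: "p \<in> forms (Suc n) 0 \<Longrightarrow> p \<in> forms n 0"
  by (metis forms_zero_const forms_const)

lemma gvec_split:
  assumes "u \<in> gvec (Suc n) ds (Suc e)"
  obtains u0 u' where "u0 \<in> gvec n ds (Suc e)" "u' \<in> gvec (Suc n) ds e" "u = u0 + var (Suc n) *\<^sub>p u'"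
proof
  show "(\<lambda>a. rem_var (Suc n) (u a)) \<in> gvec n ds (Suc e)"
    using gvecD[OF assms] unfolding gvec_def by (fastforce dest!: keys_rem_var simp: le_Suc_eq)
  show "(\<lambda>a. div_var (Suc n) (u a)) \<in> gvec (Suc n) ds e"
    using gvecD[OF assms] unfolding gvec_def
        by (fastforce dest!: keys_div_var simp: keys_add_nat mdeg_add)
  show "u = (\<lambda>a. rem_var (Suc n) (u a)) + var (Suc n) *\<^sub>p (\<lambda>a. div_var (Suc n) (u a))"
    by (rule ext) (simp add: rem_div_var[symmetric])
qed

lemma gvec_Suc_0: "u \<in> gvec (Suc n) ds 0 \<Longrightarrow> u \<in> gvec n ds 0"
  unfolding gvec_iff by (metis diff_0_eq_0 forms_Suc_0)

lemma var_split_unique: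
  assumes "\<And>m. m \<in> keys p \<Longrightarrow> v \<notin> keys m" "p + var v * q = 0"
  shows "p = 0" "q = 0"
proof -
  show "p = 0"
  proof (rule poly_mapping_eqI)
    fix m
    show "lookup p m = lookup 0 m"
    proof (cases "m \<in> keys p")
      case True
      have "lookup (p + var v * q) m = lookup p m"
        using lookup_var_mult_not[OF assms(1)[OF True]] by (simp add: lookup_add)
      then show ?thesis using assms(2) by simp
    qed (simp add: in_keys_iff)
  qed
  then have "var v * q = 0" using assms(2) by simp
  then show "q = 0"
    by (intro poly_mapping_eqI) (metis lookup_var_mult lookup_zero)
qed

lemma gvec_split_unique:
  assumes "w \<in> gvec n ds e" "w + var (Suc n) *\<^sub>p w' = 0"
  shows "w = 0" "w' = 0"
proof -
  have "w a = 0 \<and> w' a = 0" for a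
    using var_split_unique[of "w a" "Suc n" "w' a"] gvecD[OF assms(1), of _ a] fun_cong[OF assms(2),
        of a] by fastforce
  then show "w = 0" "w' = 0" by (auto simp: fun_eq_iff)
qed

lemma glin_Suc:
  assumes "glin n es ds f"
  shows "glin (Suc n) es ds f"
proof -
  have "f u \<in> gvec (Suc n) ds e" if u: "u \<in> gvec (Suc n) es e" for u e
    unfolding plinear_eq_lin[OF glin_plinear[OF assms] u]
    by (rule lin_gvec[OF _ u]) (rule gvec_mono[OF _ glin_gvec[OF assms gvec_bvec]], simp)
  then show ?thesis using assms by (simp add: glin_def)
qed

text \<open>Adjoining a variable \<open>y\<close> is flat: a homogeneous vector is uniquely
  \<open>u0 + y u'\<close> with \<open>u0\<close> free of \<open>y\<close> and \<open>u'\<close> of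
  degree one less, so exactness is carried over by induction on the degree. The hypothesis
  \<open>split\<close> says that membership in \<open>L'\<close> is inherited by the coefficients of
  powers of \<open>y\<close>.\<close>

lemma gres_Suc:
  fixes L L' :: "'k::field mpoly set"
  assumes F: "gres n L F g d" and L': "hideal (Suc n) L'" "L \<subseteq> L'"
    and split: "\<And>p q e. p \<in> forms n e \<Longrightarrow> p + var (Suc n) * q \<in> L' \<Longrightarrow> p \<in> L \<and> q \<in> L'"
  shows "gres (Suc n) L' F g d"
proof -
  let ?y = "var (Suc n) :: 'k mpoly" and ?aug = "aug (length (F 0)) g"
  have y: "?y \<in> forms (Suc n) 1" by (rule var_forms) auto
  note g = gresD(1)[OF F] and d = gresD(2)[OF F]
  note lind = glin_plinear[OF d]
  have gv: "u0 + ?y *\<^sub>p u' \<in> gvec (Suc n) ds (Suc e)"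
    if "u0 \<in> gvec n ds (Suc e)" "u' \<in> gvec (Suc n) ds e" for u0 u' :: "'k pvec" and ds e
    using gvec_add[OF gvec_mono[OF le_SucI[OF order_refl] that(1)], of "?y *\<^sub>p u'"] gvec_pscale[OF y
        that(2)] by simp
  have sur: "\<exists>u\<in>gvec (Suc n) (F 0) e. p - ?aug u \<in> L'" if "p \<in> forms (Suc n) e" for p e
    using that
  proof (induction e arbitrary: p)
    case 0
    from gresD(3)[OF F forms_Suc_0[OF this]] obtain u where "u \<in> gvec n (F 0) 0" "p - ?aug u \<in> L"
        by blast
    then show ?case using L'(2) gvec_mono[OF le_SucI[OF order_refl]] by blast
  next
    case (Suc e)
    let ?p0 = "rem_var (Suc n) p" and ?p' = "div_var (Suc n) p"
    obtain u0 where u0: "u0 \<in> gvec n (F 0) (Suc e)" "?p0 - ?aug u0 \<in> L"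
      using gresD(3)[OF F rem_var_forms[OF Suc.prems]] by blast
    obtain u' where u': "u' \<in> gvec (Suc n) (F 0) e" "?p' - ?aug u' \<in> L'"
      using Suc.IH[OF div_var_forms[OF Suc.prems]] by blast
    have "p - ?aug (u0 + ?y *\<^sub>p u') = (?p0 - ?aug u0) + ?y * (?p' - ?aug u')"
      using rem_div_var[of p "Suc n"] by (simp add: aug_add aug_pscale algebra_simps)
    also have "\<dots> \<in> L'"
      using u0(2) L'(2) by (intro hideal_add[OF L'(1)] hideal_mult[OF L'(1) forms_carrier[OF y]
          u'(2)]) auto
    finally show ?case using gv[OF u0(1) u'(1)] by blast
  qed
  have ex0: "\<exists>v\<in>gvec (Suc n) (F (Suc 0)) e. u = d 0 v" if "u \<in> gvec (Suc n) (F 0) e" "?aug u \<in> L'"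
      for u e
    using that
  proof (induction e arbitrary: u)
    case 0
    have u: "u \<in> gvec n (F 0) 0" by (rule gvec_Suc_0[OF 0(1)])
    have "?aug u \<in> L" using split[OF aug_forms[OF g u], of 0] 0(2) by simp
    from gresD(4)[OF F u this] show ?case using gvec_mono[OF le_SucI[OF order_refl]] by blast
  next
    case (Suc e)
    obtain u0 u' where u: "u0 \<in> gvec n (F 0) (Suc e)" "u' \<in> gvec (Suc n) (F 0) e" "u = u0 + ?y *\<^sub>p u'"
      by (rule gvec_split[OF Suc.prems(1)])
    have "?aug u \<in> L'" by (rule Suc.prems(2))
    then have "?aug u0 + ?y * ?aug u' \<in> L'" unfolding u(3) aug_add aug_pscale .
    then have "?aug u0 \<in> L" "?aug u' \<in> L'" using split[OF aug_forms[OF g u(1)]] by auto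
    then obtain v0 v' where v: "v0 \<in> gvec n (F (Suc 0)) (Suc e)" "u0 = d 0 v0"
        "v' \<in> gvec (Suc n) (F (Suc 0)) e" "u' = d 0 v'"
      using gresD(4)[OF F u(1)] Suc.IH[OF u(2)] by blast
    have "u = d 0 (v0 + ?y *\<^sub>p v')" using u(3) v
        by (simp add: plinear_add[OF lind] plinear_pscale[OF lind])
    then show ?case using gv[OF v(1,3)] by blast
  qed
  have exi: "\<exists>v\<in>gvec (Suc n) (F (Suc (Suc i))) e. u = d (Suc i) v"
    if "u \<in> gvec (Suc n) (F (Suc i)) e" "d i u = 0" for u e i
    using that
  proof (induction e arbitrary: u)
    case 0
    from gresD(6)[OF F gvec_Suc_0[OF 0(1)] 0(2)] show ?case
        using gvec_mono[OF le_SucI[OF order_refl]] by blast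
  next
    case (Suc e)
    obtain u0 u' where u: "u0 \<in> gvec n (F (Suc i)) (Suc e)" "u' \<in> gvec (Suc n) (F (Suc i)) e" "u =
        u0 + ?y *\<^sub>p u'"
      by (rule gvec_split[OF Suc.prems(1)])
    have "d i u = 0" by (rule Suc.prems(2))
    then have "d i u0 + ?y *\<^sub>p d i u' = 0" unfolding u(3) plinear_add[OF lind] plinear_pscale[OF lind] .
    from gvec_split_unique[OF glin_gvec[OF d u(1)] this] obtain v0 v'
      where v: "v0 \<in> gvec n (F (Suc (Suc i))) (Suc e)" "u0 = d (Suc i) v0"
        "v' \<in> gvec (Suc n) (F (Suc (Suc i))) e" "u' = d (Suc i) v'"
      using gresD(6)[OF F u(1)] Suc.IH[OF u(2)] by blast
    have "u = d (Suc i) (v0 + ?y *\<^sub>p v')" using u(3) v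
        by (simp add: plinear_add[OF lind] plinear_pscale[OF lind])
    then show ?case using gv[OF v(1,3)] by blast
  qed
  have im0: "?aug (d 0 v) \<in> L'" if "v \<in> gvec (Suc n) (F (Suc 0)) e" for v e
    using that
  proof (induction e arbitrary: v)
    case 0
    then show ?case using gresD(5)[OF F gvec_Suc_0] L'(2) by blast
  next
    case (Suc e)
    obtain v0 v' where v: "v0 \<in> gvec n (F (Suc 0)) (Suc e)" "v' \<in> gvec (Suc n) (F (Suc 0)) e" "v =
        v0 + ?y *\<^sub>p v'"
      by (rule gvec_split[OF Suc.prems])
    have "?aug (d 0 v) = ?aug (d 0 v0) + ?y * ?aug (d 0 v')"
      using v(3) by (simp add: plinear_add[OF lind] plinear_pscale[OF lind] aug_add aug_pscale)
    also have "\<dots> \<in> L'"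
      using gresD(5)[OF F v(1)] L'(2) Suc.IH[OF v(2)]
      by (intro hideal_add[OF L'(1)] hideal_mult[OF L'(1) forms_carrier[OF y]]) auto
    finally show ?case .
  qed
  have imi: "d i (d (Suc i) v) = 0" if "v \<in> gvec (Suc n) (F (Suc (Suc i))) e" for v e i
    using plinear_eq_on_gvec[OF plinear_comp[OF lind lind] plinear_zero that] gresD(7)[OF F
        gvec_bvec] by simp
  show ?thesis
    unfolding gres_def
  proof (intro conjI allI ballI impI)
    show "g a \<in> forms (Suc n) (F 0 ! a)" if "a < length (F 0)" for a
      by (rule forms_mono[OF _ g[OF that]]) simp
    show "glin (Suc n) (F (Suc i)) (F i) (d i)" for i by (rule glin_Suc[OF d])
  next
    fix e and p :: "'k mpoly" assume "p \<in> forms (Suc n) e"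
    then show "\<exists>u\<in>gvec (Suc n) (F 0) e. p - ?aug u \<in> L'" by (rule sur)
  next
    fix e and u :: "'k pvec" assume "u \<in> gvec (Suc n) (F 0) e"
    then show "?aug u \<in> L' \<longleftrightarrow> (\<exists>v\<in>gvec (Suc n) (F 1) e. u = d 0 v)" using ex0 im0 by auto
  next
    fix i e and u :: "'k pvec" assume "u \<in> gvec (Suc n) (F (Suc i)) e"
    then show "d i u = 0 \<longleftrightarrow> (\<exists>v\<in>gvec (Suc n) (F (Suc (Suc i))) e. u = d (Suc i) v)" using exi imi by auto
  qed
qed

section \<open>Direct sums and degree shifts of free modules\<close>

definition vjoin :: "nat \<Rightarrow> 'k::field pvec \<Rightarrow> 'k pvec \<Rightarrow> 'k pvec" where
  "vjoin r u v = (\<lambda>a. if a < r then u a else v (a - r))"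

definition vfst :: "nat \<Rightarrow> 'k::field pvec \<Rightarrow> 'k pvec" where
  "vfst r x = (\<lambda>a. if a < r then x a else 0)"

definition vsnd :: "nat \<Rightarrow> 'k::field pvec \<Rightarrow> 'k pvec" where
  "vsnd r x = (\<lambda>a. x (a + r))"

lemma vjoin_vfst_vsnd: "vjoin r (vfst r x) (vsnd r x) = x"
  by (auto simp: vjoin_def vfst_def vsnd_def)

lemma vsnd_vjoin [simp]: "vsnd r (vjoin r u v) = v"
  by (auto simp: vjoin_def vsnd_def)

lemma vfst_vjoin: "u \<in> gvec n ds e \<Longrightarrow> r = length ds \<Longrightarrow> vfst r (vjoin r u v) = u"
  by (rule ext) (auto simp: vjoin_def vfst_def gvec_outside)

lemma vjoin_gvec:
  assumes u: "u \<in> gvec n xs e" and v: "v \<in> gvec n ys e" and r: "r = length xs"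
  shows "vjoin r u v \<in> gvec n (xs @ ys) e"
  unfolding gvec_def
proof (intro CollectI allI ballI)
  fix a m assume m: "m \<in> keys (vjoin r u v a)"
  show "a < length (xs @ ys) \<and> keys m \<subseteq> {1..n} \<and> mdeg m + (xs @ ys) ! a = e"
  proof (cases "a < r")
    case True
    then show ?thesis using gvecD[OF u, of m a] m r by (simp add: vjoin_def nth_append)
  next
    case False
    then show ?thesis using gvecD[OF v, of m "a - r"] m r by (auto simp: vjoin_def nth_append)
  qed
qed

lemma vfst_gvec:
  assumes "x \<in> gvec n (xs @ ys) e"
  shows "vfst (length xs) x \<in> gvec n xs e"
  unfolding gvec_def vfst_def
proof (intro CollectI allI ballI)
  fix a m assume m: "m \<in> keys (if a < length xs then x a else 0)"
  then have "a < length xs" "m \<in> keys (x a)" by (auto split: if_splits)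
  then show "a < length xs \<and> keys m \<subseteq> {1..n} \<and> mdeg m + xs ! a = e"
    using gvecD[OF assms, of m a] by (simp add: nth_append)
qed

lemma vsnd_gvec:
  assumes "x \<in> gvec n (xs @ ys) e"
  shows "vsnd (length xs) x \<in> gvec n ys e"
  unfolding gvec_def vsnd_def
proof (intro CollectI allI ballI)
  fix a m assume "m \<in> keys (x (a + length xs))"
  then show "a < length ys \<and> keys m \<subseteq> {1..n} \<and> mdeg m + ys ! a = e"
    using gvecD[OF assms, of m "a + length xs"] by (simp add: nth_append)
qed

lemma plinear_vjoin: "plinear f \<Longrightarrow> plinear h \<Longrightarrow> plinear (\<lambda>x. vjoin r (f x) (h x))"
  by (auto simp: plinear_def vjoin_def fun_eq_iff)

lemma plinear_vfst: "plinear (vfst r)" and plinear_vsnd: "plinear (vsnd r)"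
  by (auto simp: plinear_def vfst_def vsnd_def fun_eq_iff)

text \<open>\<open>map Suc\<close> on the list of degrees encodes the shift by -1. In degree 0 a
  shifted module is zero, which is why the lemmas on shifts split on \<open>e\<close>.\<close>

lemma gvec_map_Suc: "u \<in> gvec n (map Suc ds) (Suc e) \<longleftrightarrow> u \<in> gvec n ds e"
proof -
  have "a < length ds \<and> P \<and> mdeg m + map Suc ds ! a = Suc e \<longleftrightarrow> a < length ds \<and> P \<and> mdeg m + ds ! a = e"
    for a m P by auto
  then show ?thesis by (simp only: gvec_def length_map)
qed

lemma gvec_map_Suc_0: "u \<in> gvec n (map Suc ds) 0 \<Longrightarrow> u = 0"
  unfolding gvec_def by (fastforce simp: fun_eq_iff simp flip: keys_eq_empty)

lemma gvec_map_Suc_pscale: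
  assumes "y \<in> forms n 1" "u \<in> gvec n (map Suc ds) e"
  shows "y *\<^sub>p u \<in> gvec n ds e"
proof (cases e)
  case 0
  then show ?thesis using gvec_map_Suc_0 assms(2) by fastforce
next
  case (Suc k)
  then show ?thesis using gvec_pscale[OF assms(1)] assms(2) gvec_map_Suc by fastforce
qed

lemma glin_gvec_map_Suc:
  assumes "glin n es ds f" "u \<in> gvec n (map Suc es) e"
  shows "f u \<in> gvec n (map Suc ds) e"
proof (cases e)
  case 0
  then show ?thesis using gvec_map_Suc_0 assms(2) plinear_0[OF glin_plinear[OF assms(1)]] by fastforce
next
  case (Suc k)
  then show ?thesis using glin_gvec[OF assms(1)] assms(2) gvec_map_Suc by blast
qed

lemma gres_exact_map_Suc:
  assumes F: "gres n L F g d" and u: "u \<in> gvec n (map Suc (F (Suc i))) e" "d i u = 0"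
  shows "\<exists>v\<in>gvec n (map Suc (F (Suc (Suc i)))) e. u = d (Suc i) v"
proof (cases e)
  case 0
  then have "u = d (Suc i) 0"
    using gvec_map_Suc_0 u(1) plinear_0[OF glin_plinear[OF gresD(2)[OF F]]] by metis
  then show ?thesis by (intro bexI[of _ 0]) auto
next
  case (Suc k)
  then show ?thesis using gresD(6)[OF F _ u(2)] u(1) gvec_map_Suc by blast
qed

text \<open>
  If \<open>y\<close> is a nonzerodivisor on \<open>R/L\<close> and \<open>M = L + y Q\<close>, then
  \<open>0 \<rightarrow> R/L(-1) \<rightarrow> R/L \<oplus> R/Q(-1) \<rightarrow> R/M \<rightarrow> 0\<close> is exact, where the first map is \<open>(y, -1)\<close> and the second
  \<open>(1, y)\<close>.  The mapping cone of a lift of the first map is a resolution of \<open>R/M\<close>.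
\<close>

lemma mapping_cone_resolution:
  fixes L Q M :: "'k::field mpoly set"
  assumes F: "gres n L F g d" and K: "gres n Q K k dK"
    and L: "hideal n L" and Q: "hideal n Q" "L \<subseteq> Q" and M: "hideal n M" "L \<subseteq> M"
    and y: "y \<in> forms n 1"
    and yL: "\<And>p e. p \<in> forms n e \<Longrightarrow> y * p \<in> L \<Longrightarrow> p \<in> L"
    and yQ: "\<And>q. q \<in> Q \<Longrightarrow> y * q \<in> M"
    and M_Suc: "\<And>p e. p \<in> forms n (Suc e) \<Longrightarrow> p \<in> M \<Longrightarrow> \<exists>q\<in>forms n e. q \<in> Q \<and> p - y * q \<in> L"
    and M_0: "\<And>p. p \<in> forms n 0 \<Longrightarrow> p \<in> M \<Longrightarrow> p \<in> L"
  obtains T h D where "gres n M T h D" "T 0 = F 0 @ map Suc (K 0)"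
    "\<And>i. T (Suc i) = F (Suc i) @ map Suc (F i) @ map Suc (K (Suc i))"
proof -
  obtain P where P: "\<And>i. glin n (F i) (K i) (P i)"
    "\<And>e u. u \<in> gvec n (F 0) e \<Longrightarrow> aug (length (K 0)) k (P 0 u) - aug (length (F 0)) g u \<in> Q"
    "\<And>i e u. u \<in> gvec n (F (Suc i)) e \<Longrightarrow> P i (d i u) = dK i (P (Suc i) u)"
    using comparison_map[OF F K Q] by blast
  note d = gresD(2)[OF F] and dK = gresD(2)[OF K]
  note lind = glin_plinear[OF d] and lindK = glin_plinear[OF dK] and linP = glin_plinear[OF P(1)]
  let ?augF = "aug (length (F 0)) g" and ?augK = "aug (length (K 0)) k"
  \<comment> \<open>In index \<open>Suc j\<close> the middle block is the source \<open>F j\<close>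
    of the lifted map, shifted in degree; the other two blocks resolve the target of that map. Index
    0 has no middle block.\<close>
  define T where "T i = (case i of 0 \<Rightarrow> F 0 @ map Suc (K 0)
    | Suc j \<Rightarrow> F (Suc j) @ map Suc (F j) @ map Suc (K (Suc j)))" for i
  have T: "T 0 = F 0 @ map Suc (K 0)" "T (Suc i) = F (Suc i) @ map Suc (F i) @ map Suc (K (Suc i))"
      for i
    by (simp_all add: T_def)
  define h where "h a = (if a < length (F 0) then g a else y * k (a - length (F 0)))" for a
  define pa :: "nat \<Rightarrow> 'k pvec \<Rightarrow> 'k pvec" where "pa i = vfst (length (F (Suc i)))" for i
  define pb where "pb i x = vfst (length (F i)) (vsnd (length (F (Suc i))) x)" for i :: nat
      and x :: "'k pvec"
  define pc where "pc i x = vsnd (length (F i)) (vsnd (length (F (Suc i))) x)" for i :: nat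
      and x :: "'k pvec"
  define tri where "tri i a b c = vjoin (length (F (Suc i))) a (vjoin (length (F i)) b c)"
    for i :: nat and a b c :: "'k pvec"
  \<comment> \<open>The differential of the mapping cone of \<open>(y, - P)\<close>. The sign of
    \<open>- d j\<close> in the middle block makes the mixed terms of the square cancel.\<close>
  define D where "D i x = (case i of
      0 \<Rightarrow> vjoin (length (F 0)) (d 0 (pa 0 x) + y *\<^sub>p pb 0 x) (dK 0 (pc 0 x) - P 0 (pb 0 x))
    | Suc j \<Rightarrow> tri j (d i (pa i x) + y *\<^sub>p pb i x) (- d j (pb i x)) (dK i (pc i x) - P i
        (pb i x)))" for i x
  have tri_parts: "x = tri i (pa i x) (pb i x) (pc i x)" for i x
    by (simp add: tri_def pa_def pb_def pc_def vjoin_vfst_vsnd)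
  have tri_gvec: "tri i a b c \<in> gvec n (T (Suc i)) e"
    if "a \<in> gvec n (F (Suc i)) e" "b \<in> gvec n (map Suc (F i)) e" "c \<in> gvec n (map Suc (K (Suc i)))
        e" for i a b c e
    unfolding tri_def T using that by (intro vjoin_gvec) simp_all
  have parts_gvec: "pa i x \<in> gvec n (F (Suc i)) e" "pb i x \<in> gvec n (map Suc (F i)) e"
      "pc i x \<in> gvec n (map Suc (K (Suc i))) e" if "x \<in> gvec n (T (Suc i)) e" for i x e
    using vfst_gvec[OF that[unfolded T]] vfst_gvec[OF vsnd_gvec[OF that[unfolded T]]]
      vsnd_gvec[OF vsnd_gvec[OF that[unfolded T]]] by (simp_all add: pa_def pb_def pc_def)
  have parts_tri: "pa i (tri i a b c) = a" "pb i (tri i a b c) = b" "pc i (tri i a b c) = c"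
    if "a \<in> gvec n (F (Suc i)) e" "b \<in> gvec n (map Suc (F i)) e" for i a b c e
    using vfst_vjoin[OF that(1)] vfst_vjoin[OF that(2)] by (simp_all add: pa_def pb_def pc_def tri_def)
  have linD: "plinear (D i)" for i
  proof -
    have "plinear (pa i)" "plinear (pb i)" "plinear (pc i)"
      unfolding pa_def pb_def pc_def
      by (intro plinear_vfst plinear_comp[OF plinear_vfst plinear_vsnd] plinear_comp[OF plinear_vsnd
          plinear_vsnd])+
    note lp = this
    have "plinear (\<lambda>x. d i (pa i x) + y *\<^sub>p pb i x)" "plinear (\<lambda>x. dK i (pc i x) - P i (pb i x))"
      "plinear (\<lambda>x. - d j (pb i x))" for j
      by (intro plinear_plus plinear_minus plinear_neg plinear_mult plinear_comp[OF lind lp(1)]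
          plinear_comp[OF lind lp(2)] plinear_comp[OF lindK lp(3)] plinear_comp[OF linP lp(2)] lp(2))+
    note lq = this
    show ?thesis
    proof (cases i)
      case 0
      then have "D i = (\<lambda>x. vjoin (length (F 0)) (d i (pa i x) + y *\<^sub>p pb i x) (dK i (pc i x) - P i
          (pb i x)))"
        by (auto simp: D_def)
      then show ?thesis using lq(1,2) by (simp add: plinear_vjoin)
    next
      case (Suc j)
      then have "D i = (\<lambda>x. tri j (d i (pa i x) + y *\<^sub>p pb i x) (- d j (pb i x)) (dK i (pc i x) - P
          i (pb i x)))"
        by (auto simp: D_def)
      then show ?thesis using lq unfolding tri_def by (simp add: plinear_vjoin)
    qed
  qed
  have D_gvec: "D i x \<in> gvec n (T i) e" if x: "x \<in> gvec n (T (Suc i)) e" for i x e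
  proof -
    note p = parts_gvec[OF x]
    have 1: "d i (pa i x) + y *\<^sub>p pb i x \<in> gvec n (F i) e"
      by (rule gvec_add[OF glin_gvec[OF d p(1)] gvec_map_Suc_pscale[OF y p(2)]])
    have 3: "dK i (pc i x) - P i (pb i x) \<in> gvec n (map Suc (K i)) e"
      by (rule gvec_diff[OF glin_gvec_map_Suc[OF dK p(3)] glin_gvec_map_Suc[OF P(1) p(2)]])
    show ?thesis
    proof (cases i)
      case 0
      then show ?thesis using vjoin_gvec[OF 1 3] by (simp add: D_def T)
    next
      case (Suc j)
      have "- d j (pb i x) \<in> gvec n (map Suc (F j)) e"
        using p(2) Suc by (intro gvec_uminus glin_gvec_map_Suc[OF d]) simp
      then show ?thesis using tri_gvec[of _ j] 1 3 Suc by (simp add: D_def)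
    qed
  qed
  have augT: "aug (length (T 0)) h x = ?augF (vfst (length (F 0)) x) + y * ?augK (vsnd (length (F
      0)) x)" for x
  proof -
    let ?r = "length (F 0)" and ?s = "length (K 0)"
    have "aug (length (T 0)) h x = (\<Sum>a<?r + ?s. x a * h a)" by (simp add: aug_def T)
    also have "\<dots> = (\<Sum>a<?r. x a * h a) + (\<Sum>a<?s. x (a + ?r) * h (a + ?r))"
      by (induction ("?s")) (simp_all add: add.commute add.left_commute)
    also have "\<dots> = ?augF (vfst ?r x) + y * ?augK (vsnd ?r x)"
      by (simp add: aug_def h_def vfst_def vsnd_def sum_distrib_left mult.left_commute)
    finally show ?thesis .
  qed
  have T0_parts: "vfst (length (F 0)) x \<in> gvec n (F 0) e" "vsnd (length (F 0)) x \<in> gvec n (map Suc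
      (K 0)) e"
    if "x \<in> gvec n (T 0) e" for x e
    using vfst_gvec vsnd_gvec that by (auto simp: T)
  have chain: "P i (d i b) = dK i (P (Suc i) b)" if b: "b \<in> gvec n (map Suc (F (Suc i))) e" for i b e
  proof (cases e)
    case 0
    then have "b = 0" using gvec_map_Suc_0 b by blast
    then show ?thesis by (simp add: plinear_0[OF lind] plinear_0[OF linP] plinear_0[OF lindK])
  next
    case (Suc e')
    then show ?thesis using P(3) b gvec_map_Suc by blast
  qed
  \<comment> \<open>Exactness reduces to finding \<open>b0\<close>: if the middle part of a cycle is
    \<open>d i b0\<close>, then adding \<open>y b0\<close> to the first part and subtracting
    \<open>P b0\<close> from the third yields cycles of \<open>F\<close> and
    \<open>K\<close>.\<close>
  have lift: "\<exists>v\<in>gvec n (T (Suc (Suc i))) e. x = D (Suc i) v"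
    if x: "x \<in> gvec n (T (Suc i)) e" and b0: "b0 \<in> gvec n (map Suc (F (Suc i))) e" "pb i x = d i b0"
      and a: "d i (pa i x) + y *\<^sub>p pb i x = 0" and c: "dK i (pc i x) - P i (pb i x) = 0" for i x e b0
  proof -
    note p = parts_gvec[OF x]
    have "d i (pa i x + y *\<^sub>p b0) = 0"
      using a b0(2) by (simp add: plinear_add[OF lind] plinear_pscale[OF lind])
    then obtain a' where a': "a' \<in> gvec n (F (Suc (Suc i))) e" "pa i x + y *\<^sub>p b0 = d (Suc i) a'"
      using gresD(6)[OF F gvec_add[OF p(1) gvec_map_Suc_pscale[OF y b0(1)]]] by blast
    have "dK i (pc i x - P (Suc i) b0) = 0"
      using c b0(2) chain[OF b0(1)] by (simp add: plinear_diff[OF lindK])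
    then obtain c' where c': "c' \<in> gvec n (map Suc (K (Suc (Suc i)))) e" "pc i x - P (Suc i) b0 =
        dK (Suc i) c'"
      using gres_exact_map_Suc[OF K gvec_diff[OF p(3) glin_gvec_map_Suc[OF P(1) b0(1)]]] by blast
    let ?v = "tri (Suc i) a' (- b0) c'"
    note pt = parts_tri[OF a'(1) gvec_uminus[OF b0(1)], of c']
    have "D (Suc i) ?v = tri i (d (Suc i) a' - y *\<^sub>p b0) (d i b0) (dK (Suc i) c' + P (Suc i) b0)"
      using pt by (simp add: D_def plinear_uminus[OF lind] plinear_uminus[OF linP])
    also have "\<dots> = tri i (pa i x) (pb i x) (pc i x)"
      unfolding a'(2)[symmetric] c'(2)[symmetric] b0(2) by simp
    finally have "x = D (Suc i) ?v" using tri_parts by simp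
    then show ?thesis using tri_gvec[OF a'(1) gvec_uminus[OF b0(1)] c'(1)] by blast
  qed
  have "gres n M T h D"
    unfolding gres_def
  proof (intro conjI allI ballI impI)
    fix a assume a: "a < length (T 0)"
    show "h a \<in> forms n (T 0 ! a)"
    proof (cases "a < length (F 0)")
      case True
      then show ?thesis using gresD(1)[OF F] by (simp add: h_def T nth_append)
    next
      case False
      then have "k (a - length (F 0)) \<in> forms n (K 0 ! (a - length (F 0)))"
        using gresD(1)[OF K] a by (simp add: T)
      from forms_mult[OF y this] show ?thesis using False a by (simp add: h_def T nth_append)
    qed
  next
    show "glin n (T (Suc i)) (T i) (D i)" for i using linD D_gvec by (simp add: glin_def)
  next
    fix e and p :: "'k mpoly" assume "p \<in> forms n e"
    then obtain u where u: "u \<in> gvec n (F 0) e" "p - ?augF u \<in> L" using gresD(3)[OF F] by blast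
    have "aug (length (T 0)) h (vjoin (length (F 0)) u 0) = ?augF u"
      unfolding augT vfst_vjoin[OF u(1) refl] by (simp add: aug_def)
    then show "\<exists>u\<in>gvec n (T 0) e. p - aug (length (T 0)) h u \<in> M"
      using u M(2) vjoin_gvec[OF u(1) gvec_0 refl] T(1)
          by (intro bexI[of _ "vjoin (length (F 0)) u 0"]) auto
  next
    fix e and x :: "'k pvec" assume x: "x \<in> gvec n (T 0) e"
    let ?a = "vfst (length (F 0)) x" and ?c = "vsnd (length (F 0)) x"
    note xp = T0_parts[OF x]
    show "aug (length (T 0)) h x \<in> M \<longleftrightarrow> (\<exists>v\<in>gvec n (T 1) e. x = D 0 v)"
    proof
      assume M': "aug (length (T 0)) h x \<in> M"
      have "\<exists>b\<in>gvec n (map Suc (F 0)) e. ?augF (?a - y *\<^sub>p b) \<in> L \<and>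
          (\<exists>c'\<in>gvec n (map Suc (K (Suc 0))) e. ?c + P 0 b = dK 0 c')"
      proof (cases e)
        case 0
        then have c0: "?c = 0" using xp(2) gvec_map_Suc_0 by blast
        then have "?augF ?a \<in> M" using M' unfolding augT by (simp add: aug_def)
        then have "?augF ?a \<in> L" using M_0 aug_forms[OF gresD(1)[OF F] xp(1)] 0 by simp
        then show ?thesis using c0 plinear_0[OF linP] plinear_0[OF lindK]
            by (intro bexI[of _ 0]) (auto intro!: bexI[of _ 0])
      next
        case (Suc e')
        have c: "?c \<in> gvec n (K 0) e'" using xp(2) Suc gvec_map_Suc by blast
        have cf: "?augK ?c \<in> forms n e'" by (rule aug_forms[OF gresD(1)[OF K] c])
        have "aug (length (T 0)) h x \<in> forms n (Suc e')"
          unfolding augT using aug_forms[OF gresD(1)[OF F] xp(1)] forms_mult[OF y cf] Suc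
              by (auto intro: forms_add)
        then obtain q where q: "q \<in> forms n e'" "q \<in> Q" "aug (length (T 0)) h x - y * q \<in> L"
          using M_Suc M' by blast
        \<comment> \<open>Modulo \<open>L\<close>, the augmentation of \<open>x\<close> is
          \<open>y q\<close>. The vector \<open>b\<close> represents \<open>q\<close> minus the
          contribution of the second part, so that after the correction the first part maps into
          \<open>L\<close> and the second into \<open>Q\<close>.\<close>
        obtain b where b: "b \<in> gvec n (F 0) e'" "(q - ?augK ?c) - ?augF b \<in> L"
          using gresD(3)[OF F forms_diff[OF q(1) cf]] by blast
        have "?augF (?a - y *\<^sub>p b) = (aug (length (T 0)) h x - y * q) + y * ((q - ?augK ?c) - ?augF b)"
          unfolding augT by (simp add: aug_diff aug_pscale algebra_simps)
        also have "\<dots> \<in> L" by (rule hideal_add[OF L q(3) hideal_mult[OF L forms_carrier[OF y] b(2)]])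
        finally have aL: "?augF (?a - y *\<^sub>p b) \<in> L" .
        have "?augK (?c + P 0 b) = q - ((q - ?augK ?c) - ?augF b) + (?augK (P 0 b) - ?augF b)"
          by (simp add: aug_add)
        also have "\<dots> \<in> Q"
          using b(2) Q(2) by (intro hideal_add[OF Q(1)] hideal_diff[OF Q(1) q(2)] P(2)[OF b(1)]) auto
        finally obtain c' where "c' \<in> gvec n (K (Suc 0)) e'" "?c + P 0 b = dK 0 c'"
          using gresD(4)[OF K gvec_add[OF c glin_gvec[OF P(1) b(1)]]] by blast
        then show ?thesis using aL b(1) Suc gvec_map_Suc by blast
      qed
      then obtain b c' where b: "b \<in> gvec n (map Suc (F 0)) e" "?augF (?a - y *\<^sub>p b) \<in> L"
          and c': "c' \<in> gvec n (map Suc (K (Suc 0))) e" "?c + P 0 b = dK 0 c'" by blast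
      obtain a' where a': "a' \<in> gvec n (F (Suc 0)) e" "?a - y *\<^sub>p b = d 0 a'"
        using gresD(4)[OF F gvec_diff[OF xp(1) gvec_map_Suc_pscale[OF y b(1)]] b(2)] by blast
      have "D 0 (tri 0 a' b c') = vjoin (length (F 0)) (d 0 a' + y *\<^sub>p b) (dK 0 c' - P 0 b)"
        using parts_tri[OF a'(1) b(1)] by (simp add: D_def)
      also have "\<dots> = vjoin (length (F 0)) ?a ?c"
        unfolding a'(2)[symmetric] c'(2)[symmetric] by simp
      finally show "\<exists>v\<in>gvec n (T 1) e. x = D 0 v"
        using tri_gvec[OF a'(1) b(1) c'(1)] by (intro bexI[of _ "tri 0 a' b c'"])
            (simp_all add: vjoin_vfst_vsnd)
    next
      assume "\<exists>v\<in>gvec n (T 1) e. x = D 0 v"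
      then obtain v where v: "v \<in> gvec n (T (Suc 0)) e" "x = D 0 v" by auto
      note p = parts_gvec[OF v(1)]
      have 1: "d 0 (pa 0 v) + y *\<^sub>p pb 0 v \<in> gvec n (F 0) e"
        by (rule gvec_add[OF glin_gvec[OF d p(1)] gvec_map_Suc_pscale[OF y p(2)]])
      have "aug (length (T 0)) h x = ?augF (d 0 (pa 0 v)) +
          y * (?augK (dK 0 (pc 0 v)) - (?augK (P 0 (pb 0 v)) - ?augF (pb 0 v)))"
        unfolding v(2) augT D_def using vfst_vjoin[OF 1 refl]
        by (simp add: aug_add aug_diff aug_pscale algebra_simps)
      also have "\<dots> \<in> M"
      proof (rule hideal_add[OF M(1) _ yQ[OF hideal_diff[OF Q(1)]]])
        show "?augF (d 0 (pa 0 v)) \<in> M" using gresD(5)[OF F p(1)] M(2) by blast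
        show "?augK (dK 0 (pc 0 v)) \<in> Q" "?augK (P 0 (pb 0 v)) - ?augF (pb 0 v) \<in> Q"
        proof (cases e, goal_cases)
          case 1
          then have "pc 0 v = 0" using p(3) gvec_map_Suc_0[of "pc 0 v" n "K (Suc 0)"] by simp
          then show ?case using plinear_0[OF lindK] hideal_0[OF Q(1)] by (simp add: aug_def)
        next
          case (2 e')
          then show ?case using gresD(5)[OF K] p(3) gvec_map_Suc by blast
        next
          case 3
          show ?case
          proof (cases e)
            case 0
            then have "pb 0 v = 0" using p(2) gvec_map_Suc_0[of "pb 0 v" n "F 0"] by simp
            then show ?thesis using plinear_0[OF linP] hideal_0[OF Q(1)] by (simp add: aug_def)
          next
            case (Suc e')
            then show ?thesis using P(2) p(2) gvec_map_Suc by blast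
          qed
        qed
      qed
      finally show "aug (length (T 0)) h x \<in> M" .
    qed
  next
    fix i e and x :: "'k pvec" assume x: "x \<in> gvec n (T (Suc i)) e"
    note p = parts_gvec[OF x]
    have 1: "d i (pa i x) + y *\<^sub>p pb i x \<in> gvec n (F i) e"
      by (rule gvec_add[OF glin_gvec[OF d p(1)] gvec_map_Suc_pscale[OF y p(2)]])
    show "D i x = 0 \<longleftrightarrow> (\<exists>v\<in>gvec n (T (Suc (Suc i))) e. x = D (Suc i) v)"
    proof
      assume D0: "D i x = 0"
      have "d i (pa i x) + y *\<^sub>p pb i x = 0 \<and> dK i (pc i x) - P i (pb i x) = 0 \<and>
          (\<exists>b0\<in>gvec n (map Suc (F (Suc i))) e. pb i x = d i b0)"
      proof (cases i)
        case 0
        let ?A = "d 0 (pa 0 x) + y *\<^sub>p pb 0 x" and ?C = "dK 0 (pc 0 x) - P 0 (pb 0 x)"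
        have j: "vjoin (length (F 0)) ?A ?C = 0" using D0 0 by (simp add: D_def)
        have A: "?A = 0" using vfst_vjoin[OF 1[unfolded 0] refl, of ?C] plinear_0[OF plinear_vfst] j
            by metis
        have C: "?C = 0" using vsnd_vjoin[of "length (F 0)" ?A ?C] plinear_0[OF plinear_vsnd] j by metis
        have "\<exists>b0\<in>gvec n (map Suc (F (Suc 0))) e. pb 0 x = d 0 b0"
        proof (cases e)
          case zero: 0
          then show ?thesis using p(2) 0 gvec_map_Suc_0 plinear_0[OF lind]
              by (intro bexI[of _ 0]) fastforce+
        next
          case (Suc e')
          then have b: "pb 0 x \<in> gvec n (F 0) e'" using p(2) 0 gvec_map_Suc by blast
          \<comment> \<open>Exactness in index 1 uses that \<open>y\<close> is a nonzerodivisor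
            modulo \<open>L\<close>, applied to the augmentation of the middle part.\<close>
          have "y * ?augF (pb 0 x) = ?augF ?A - ?augF (d 0 (pa 0 x))"
            by (simp add: aug_add aug_pscale)
          also have "\<dots> \<in> L"
            using gresD(5)[OF F] p(1) 0 A hideal_uminus[OF L] by (simp add: aug_def)
          finally have "?augF (pb 0 x) \<in> L" using yL[OF aug_forms[OF gresD(1)[OF F] b]] by blast
          then show ?thesis using gresD(4)[OF F b] Suc gvec_map_Suc by blast
        qed
        then show ?thesis using A C 0 by simp
      next
        case (Suc j)
        let ?A = "d i (pa i x) + y *\<^sub>p pb i x" and ?C = "dK i (pc i x) - P i (pb i x)"
            and ?B = "- d j (pb i x)"
        have B: "?B \<in> gvec n (map Suc (F j)) e"
          using p(2) Suc by (intro gvec_uminus glin_gvec_map_Suc[OF d]) simp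
        have A: "?A \<in> gvec n (F (Suc j)) e" using 1 Suc by simp
        have t: "tri j ?A ?B ?C = 0" using D0 Suc by (simp add: D_def)
        have z: "pa j 0 = 0" "pb j 0 = 0" "pc j 0 = 0"
          by (auto simp: pa_def pb_def pc_def vfst_def vsnd_def)
        have "?A = 0" "?B = 0" "?C = 0" using parts_tri[OF A B, of ?C] t z by metis+
        moreover have "\<exists>b0\<in>gvec n (map Suc (F (Suc i))) e. pb i x = d i b0"
          using gres_exact_map_Suc[OF F, of "pb i x" j e] p(2) \<open>?B = 0\<close> Suc by simp
        ultimately show ?thesis by simp
      qed
      then show "\<exists>v\<in>gvec n (T (Suc (Suc i))) e. x = D (Suc i) v" using lift[OF x] by blast
    next
      assume "\<exists>v\<in>gvec n (T (Suc (Suc i))) e. x = D (Suc i) v"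
      then obtain v where v: "v \<in> gvec n (T (Suc (Suc i))) e" "x = D (Suc i) v" by blast
      let ?a = "pa (Suc i) v" and ?b = "pb (Suc i) v" and ?c = "pc (Suc i) v"
      note q = parts_gvec[OF v(1)]
      have A: "d (Suc i) ?a + y *\<^sub>p ?b \<in> gvec n (F (Suc i)) e"
        by (rule gvec_add[OF glin_gvec[OF d q(1)] gvec_map_Suc_pscale[OF y q(2)]])
      have B: "- d i ?b \<in> gvec n (map Suc (F i)) e"
          by (rule gvec_uminus[OF glin_gvec_map_Suc[OF d q(2)]])
      have xeq: "x = tri i (d (Suc i) ?a + y *\<^sub>p ?b) (- d i ?b) (dK (Suc i) ?c - P (Suc i) ?b)"
        using v(2) by (simp add: D_def)
      note px = parts_tri[OF A B, of "dK (Suc i) ?c - P (Suc i) ?b", folded xeq]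
      have dd: "d i (d (Suc i) ?a) = 0" by (rule gresD(7)[OF F q(1)])
      have ddK: "dK i (dK (Suc i) ?c) = 0"
      proof (cases e)
        case 0
        then have "?c = 0" using q(3) gvec_map_Suc_0 by blast
        then show ?thesis by (simp add: plinear_0[OF lindK])
      next
        case (Suc e')
        then show ?thesis using q(3) gresD(7)[OF K] gvec_map_Suc by blast
      qed
      note PdK = chain[OF q(2)]
      have 1: "d i (pa i x) + y *\<^sub>p pb i x = 0"
        using px dd by (simp add: plinear_add[OF lind] plinear_pscale[OF lind])
      have 3: "dK i (pc i x) - P i (pb i x) = 0"
        using px ddK PdK[symmetric] by (simp add: plinear_diff[OF lindK] plinear_uminus[OF linP])
      show "D i x = 0"
      proof (cases i)
        case 0
        then show ?thesis using 1 3 by (auto simp: D_def vjoin_def)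
      next
        case (Suc j)
        have "d j (pb i x) = 0"
        proof (cases e)
          case 0
          then have "?b = 0" using q(2) gvec_map_Suc_0 by blast
          then show ?thesis using px plinear_0[OF lind] by simp
        next
          case (Suc e')
          then have "d j (d (Suc j) ?b) = 0" using q(2) gvec_map_Suc \<open>i = Suc j\<close> gresD(7)[OF F] by blast
          then show ?thesis using px \<open>i = Suc j\<close> by (simp add: plinear_uminus[OF lind])
        qed
        then show ?thesis using 1 3 Suc by (auto simp: D_def tri_def vjoin_def)
      qed
    qed
  qed
  then show thesis using T by (rule that)
qed

section \<open>Face ideals of cones and the Koszul complex\<close>

definition full_cone :: "nat \<Rightarrow> nat set set \<Rightarrow> nat set set" where
  "full_cone v \<Delta> = {\<tau>. \<tau> - {v} \<in> \<Delta>}"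

lemma down_closed_full_cone: "down_closed \<Delta> \<Longrightarrow> down_closed (full_cone v \<Delta>)"
  unfolding down_closed_def full_cone_def by (simp add: Diff_mono)

text \<open>Deleting the apex decides membership in the full cone, so its face ideal is the
  extension of the face ideal of \<open>\<Delta>\<close> to one more variable, and the resolution
  stays the same.\<close>

lemma gres_full_cone:
  assumes F: "gres n (face_ideal n \<Delta>) F g d" and \<Delta>: "down_closed \<Delta>"
  shows "gres (Suc n) (face_ideal (Suc n) (full_cone (Suc n) \<Delta>)) F g d"
proof (rule gres_Suc[OF F hideal_face_ideal[OF down_closed_full_cone[OF \<Delta>]]])
  show "face_ideal n \<Delta> \<subseteq> (face_ideal (Suc n) (full_cone (Suc n) \<Delta>) :: 'a mpoly set)"
  proof
    fix p :: "'a mpoly" assume p: "p \<in> face_ideal n \<Delta>"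
    have "keys m \<subseteq> {1..n} \<and> keys m \<notin> \<Delta>" if "m \<in> keys p" for m
      using p that by (auto simp: face_ideal_def polyring_def)
    moreover have "\<sigma> - {Suc n} = \<sigma> \<and> \<sigma> \<subseteq> {1..Suc n}" if "\<sigma> \<subseteq> {1..n}" for \<sigma> :: "nat set"
      using that by fastforce
    ultimately show "p \<in> face_ideal (Suc n) (full_cone (Suc n) \<Delta>)"
      by (simp add: face_ideal_def polyring_def full_cone_def)
  qed
next
  fix p q :: "'a mpoly" and e
  assume p: "p \<in> forms n e" and pq: "p + var (Suc n) * q \<in> face_ideal (Suc n) (full_cone (Suc n) \<Delta>)"
  have pk: "keys m \<subseteq> {1..n}" if "m \<in> keys p" for m
    using p that by (simp add: forms_iff)
  have face: "keys m \<subseteq> {1..Suc n} \<and> keys m - {Suc n} \<notin> \<Delta>"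
    if "m \<in> keys (p + var (Suc n) * q)" for m
    using pq that by (simp add: face_ideal_def polyring_def full_cone_def)
  show "p \<in> face_ideal n \<Delta> \<and> q \<in> face_ideal (Suc n) (full_cone (Suc n) \<Delta>)"
  proof
    have "keys m \<notin> \<Delta>" if m: "m \<in> keys p" for m
    proof -
      have N: "Suc n \<notin> keys m" using pk[OF m] by auto
      then have "m \<in> keys (p + var (Suc n) * q)"
        using m lookup_var_mult_not[of "Suc n" m q] by (simp add: in_keys_iff lookup_add)
      from face[OF this] N show ?thesis by simp
    qed
    then show "p \<in> face_ideal n \<Delta>" using p by (simp add: face_ideal_def forms_def)
  next
    have "keys m \<subseteq> {1..Suc n} \<and> keys m - {Suc n} \<notin> \<Delta>" if m: "m \<in> keys q" for m
    proof -
      let ?m = "m + single (Suc n) 1"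
      have "?m \<notin> keys p" using pk by (fastforce simp: keys_add_nat)
      then have "?m \<in> keys (p + var (Suc n) * q)"
        using m lookup_var_mult[of "Suc n" q m] by (simp add: in_keys_iff lookup_add)
      from face[OF this] show ?thesis by (simp add: keys_add_nat)
    qed
    then show "q \<in> face_ideal (Suc n) (full_cone (Suc n) \<Delta>)"
      by (simp add: face_ideal_def polyring_def full_cone_def)
  qed
qed

text \<open>With \<open>y\<close> the new variable, the face ideal is \<open>L + y Q\<close> for the
  extended face ideals \<open>L\<close> of \<open>\<Delta>\<close> and \<open>Q\<close> of
  \<open>\<Theta>\<close>. For \<open>\<Theta> = {{}}\<close> this is the zero cone;
  \<open>\<Delta> = {{}}\<close> and \<open>\<Theta> = {}\<close> give the inductive step for the
  Koszul complex.\<close>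

lemma gres_partial_cone:
  fixes n :: nat
  assumes F: "gres n (face_ideal n \<Delta> :: 'k::field mpoly set) F g d"
      and K: "gres n (face_ideal n \<Theta> :: 'k mpoly set) K k dK"
    and \<Delta>: "down_closed \<Delta>" "\<Delta> \<subseteq> Pow {1..n}" and \<Theta>: "down_closed \<Theta>" "\<Theta> \<subseteq> \<Delta>"
  obtains T h D where "gres (Suc n) (face_ideal (Suc n) (\<Delta> \<union> insert (Suc n) ` \<Theta>) :: 'k mpoly set) T h D"
    "T 0 = F 0 @ map Suc (K 0)" "\<And>i. T (Suc i) = F (Suc i) @ map Suc (F i) @ map Suc (K (Suc i))"
proof -
  let ?N = "Suc n" and ?C = "\<Delta> \<union> insert (Suc n) ` \<Theta>"
  let ?L = "face_ideal ?N (full_cone ?N \<Delta>) :: 'k mpoly set"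
      and ?Q = "face_ideal ?N (full_cone ?N \<Theta>) :: 'k mpoly set"
  let ?M = "face_ideal ?N ?C :: 'k mpoly set"
  have N: "?N \<notin> \<sigma>" if "\<sigma> \<in> \<Delta>" for \<sigma>
    using subsetD[OF \<Delta>(2) that] by auto
  have sub: "?C \<subseteq> full_cone ?N \<Delta>"
    using N \<Theta>(2) by (auto simp: full_cone_def insert_Diff_if)
  have dc: "down_closed ?C"
    unfolding down_closed_def
  proof (intro ballI allI impI)
    fix \<sigma> \<tau> assume \<sigma>: "\<sigma> \<in> ?C" and \<tau>: "\<tau> \<subseteq> \<sigma>"
    show "\<tau> \<in> ?C"
    proof (cases "\<sigma> \<in> \<Delta>")
      case True
      then show ?thesis using down_closedD[OF \<Delta>(1) _ \<tau>] by blast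
    next
      case False
      then obtain \<theta> where \<theta>: "\<theta> \<in> \<Theta>" "\<sigma> = insert ?N \<theta>" using \<sigma> by blast
      have t: "\<tau> - {?N} \<in> \<Theta>" using down_closedD[OF \<Theta>(1) \<theta>(1)] \<theta>(2) \<tau> by blast
      show ?thesis
      proof (cases "?N \<in> \<tau>")
        case True
        then have "\<tau> = insert ?N (\<tau> - {?N})" by blast
        then show ?thesis using t by blast
      next
        case False
        then show ?thesis using t \<Theta>(2) by auto
      qed
    qed
  qed
  have anti: "face_ideal ?N \<A> \<subseteq> (face_ideal ?N \<B> :: 'k mpoly set)" if "\<B> \<subseteq> \<A>" for \<A> \<B>
    using that by (auto simp: face_ideal_def)
  note hL = hideal_face_ideal[OF down_closed_full_cone[OF \<Delta>(1)]]
    and hQ = hideal_face_ideal[OF down_closed_full_cone[OF \<Theta>(1)]]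
  have y: "var ?N \<in> forms ?N 1" by (rule var_forms) auto
  show thesis
  proof (rule mapping_cone_resolution[OF gres_full_cone[OF F \<Delta>(1)] gres_full_cone[OF K \<Theta>(1)] hL hQ _
        hideal_face_ideal[OF dc] anti[OF sub] y])
    show "?L \<subseteq> ?Q" using \<Theta>(2) by (intro anti) (auto simp: full_cone_def)
  next
    fix p :: "'k mpoly" and e assume "p \<in> forms ?N e" "var ?N * p \<in> ?L"
    then show "p \<in> ?L"
      by (fastforce simp: face_ideal_def keys_var_mult full_cone_def keys_add_nat forms_def)
  next
    fix q :: "'k mpoly" assume q: "q \<in> ?Q"
    show "var ?N * q \<in> ?M"
      unfolding face_ideal_def
    proof (intro CollectI conjI ballI)
      show "var ?N * q \<in> carrier (polyring ?N)"
        using q by (intro carrier_polyring_mult forms_carrier[OF y]) (simp add: face_ideal_def)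
      fix m assume "m \<in> keys (var ?N * q)"
      then obtain m' where m': "m' \<in> keys q" "keys m = insert ?N (keys m')"
        by (auto simp: keys_var_mult keys_add_nat)
      then have "keys m' - {?N} \<notin> \<Theta>" using q by (simp add: face_ideal_def full_cone_def)
      moreover have "keys m' - {?N} = \<theta>" if "keys m = insert ?N \<theta>" "\<theta> \<in> \<Theta>" for \<theta>
      proof -
        have "insert ?N (keys m') - {?N} = insert ?N \<theta> - {?N}" using m'(2) that(1) by simp
        moreover have "?N \<notin> \<theta>" using N \<Theta>(2) that(2) by blast
        ultimately show ?thesis by (simp add: insert_Diff_if)
      qed
      moreover have "keys m \<notin> \<Delta>" using m'(2) N by blast
      ultimately show "keys m \<notin> ?C" by blast
    qed
  next
    fix p :: "'k mpoly" and e assume p: "p \<in> forms ?N (Suc e)" "p \<in> ?M"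
    \<comment> \<open>Division by \<open>y\<close> yields the decomposition: the quotient lies in
      \<open>Q\<close>, and the remainder, which avoids \<open>y\<close>, lies in
      \<open>L\<close>.\<close>
    have "div_var ?N p \<in> ?Q"
      unfolding face_ideal_def
    proof (intro CollectI conjI ballI)
      show "div_var ?N p \<in> carrier (polyring ?N)" by (rule forms_carrier[OF div_var_forms[OF p(1)]])
      fix m assume "m \<in> keys (div_var ?N p)"
      from keys_div_var[OF this] have "keys (m + single ?N 1) \<notin> ?C"
        using p(2) unfolding face_ideal_def by blast
      moreover have "keys (m + single ?N (1::nat)) = insert ?N (keys m)"
        by (simp add: keys_add_nat)
      ultimately have "insert ?N (keys m) \<notin> ?C" by metis
      moreover have "insert ?N (keys m) = insert ?N (keys m - {?N})" by blast
      ultimately show "keys m \<notin> full_cone ?N \<Theta>" unfolding full_cone_def by blast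
    qed
    moreover have "rem_var ?N p \<in> ?L"
      unfolding face_ideal_def
    proof (intro CollectI conjI ballI)
      show "rem_var ?N p \<in> carrier (polyring ?N)"
        using forms_mono[OF _ rem_var_forms[OF p(1)], of ?N] forms_carrier by simp
      fix m assume "m \<in> keys (rem_var ?N p)"
      from keys_rem_var[OF this] show "keys m \<notin> full_cone ?N \<Delta>"
        using p(2) by (auto simp: face_ideal_def full_cone_def)
    qed
    ultimately show "\<exists>q\<in>forms ?N e. q \<in> ?Q \<and> p - var ?N * q \<in> ?L"
      using div_var_forms[OF p(1)] rem_div_var[of p ?N] by (intro bexI[of _ "div_var ?N p"])
          (metis add_diff_cancel_right')
  next
    fix p :: "'k mpoly" assume p: "p \<in> forms ?N 0" "p \<in> ?M"
    have "m = 0" if "m \<in> keys p" for m using p(1) that by (simp add: forms_iff)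
    then show "p \<in> ?L" using p(2) by (fastforce simp: face_ideal_def full_cone_def)
  qed (rule that)
qed

lemma gres_unit_ideal: "gres n (face_ideal n {} :: 'k::field mpoly set) (\<lambda>_. []) g (\<lambda>_ _. 0)"
  unfolding gres_def
  by (auto simp: glin_def plinear_zero aug_def face_ideal_def forms_def polyring_def)

text \<open>The Koszul complex arises one variable at a time as the mapping cone of multiplication
  by the new variable, with the zero module in place of the second resolution. Of its structure only
  linearity is recorded: generators of index \<open>i\<close> have degree \<open>i\<close>.\<close>

lemma koszul_resolution:
  obtains K k dK where "gres n (face_ideal n {{}} :: 'k::field mpoly set) K k dK" "\<And>i. set (K i) \<subseteq> {i}"
proof -
  have "\<exists>K k dK. gres n (face_ideal n {{}} :: 'k mpoly set) K k dK \<and> (\<forall>i. set (K i) \<subseteq> {i})"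
  proof (induction n)
    case 0
    let ?K = "\<lambda>i::nat. if i = 0 then [0::nat] else []"
    have L: "face_ideal 0 {{}} = ({0} :: 'k mpoly set)"
      by (auto simp: face_ideal_def polyring_def simp flip: keys_eq_empty)
    have "gres 0 ({0} :: 'k mpoly set) ?K (\<lambda>_. 1) (\<lambda>_ _. 0)"
      unfolding gres_def
    proof (intro conjI allI ballI impI)
      fix e and p :: "'k mpoly" assume "p \<in> forms 0 e"
      then show "\<exists>u\<in>gvec 0 (?K 0) e. p - aug (length (?K 0)) (\<lambda>_. 1) u \<in> {0}"
        by (intro bexI[of _ "\<lambda>a. if a = 0 then p else 0"]) (auto simp: aug_def gvec_iff)
    next
      fix e and u :: "'k pvec" assume "u \<in> gvec 0 (?K 0) e"
      then show "aug (length (?K 0)) (\<lambda>_. 1) u \<in> {0} \<longleftrightarrow> (\<exists>v\<in>gvec 0 (?K 1) e. u = 0)"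
        using gvec_outside[of u 0 "[0]" e] by (auto simp: aug_def fun_eq_iff)
            (metis Suc_leI bot_nat_0.not_eq_extremum)
    qed (auto simp: glin_def plinear_zero)
    then show ?case unfolding L by (intro exI[of _ ?K]) auto
  next
    case (Suc n)
    then obtain K k dK where K: "gres n (face_ideal n {{}} :: 'k mpoly set) K k dK"
        "\<And>i. set (K i) \<subseteq> {i}" by blast
    have dc: "down_closed {{}}" "down_closed {}" by (auto simp: down_closed_def)
    obtain T h D where T: "gres (Suc n) (face_ideal (Suc n) ({{}} \<union> insert (Suc n) ` {}) :: 'k mpoly
        set) T h D"
      "T 0 = K 0 @ map Suc []" "\<And>i. T (Suc i) = K (Suc i) @ map Suc (K i) @ map Suc []"
      by (rule gres_partial_cone[OF K(1) gres_unit_ideal dc(1) _ dc(2)]) auto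
    have "set (T i) \<subseteq> {i}" for i
      using K(2) T(2,3) by (cases i) fastforce+
    then show ?case using T(1) by auto
  qed
  then show thesis using that by blast
qed

section \<open>Hilbert functions and \<open>f\<close>-vectors\<close>

definition fps_degree_le :: "nat \<Rightarrow> int fps \<Rightarrow> bool" where
  "fps_degree_le k f \<longleftrightarrow> (\<forall>j>k. fps_nth f j = 0)"

lemma fps_degree_le_mult:
  assumes "fps_degree_le a f" "fps_degree_le b g"
  shows "fps_degree_le (a + b) (f * g)"
  unfolding fps_degree_le_def
proof (intro allI impI)
  fix j assume j: "a + b < j"
  have "fps_nth f i * fps_nth g (j - i) = 0" for i
  proof (cases "i \<le> a")
    case True
    then have "b < j - i" using j by simp
    then show ?thesis using assms(2) by (simp add: fps_degree_le_def)
  qed (use assms(1) in \<open>simp add: fps_degree_le_def\<close>)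
  then show "fps_nth (f * g) j = 0" by (simp add: fps_mult_nth del: mult_eq_0_iff)
qed

lemma fps_degree_le_power: "fps_degree_le a f \<Longrightarrow> fps_degree_le (k * a) (f ^ k)"
proof (induction k)
  case (Suc k)
  then show ?case using fps_degree_le_mult[of a f "k * a" "f ^ k"] by simp
qed (simp add: fps_degree_le_def)

lemma fps_degree_le_1_minus_X_power: "fps_degree_le k ((1 - fps_X) ^ k)"
  using fps_degree_le_power[of 1 "1 - fps_X" k] by (simp add: fps_degree_le_def)

lemma fps_degree_le_X_power: "fps_degree_le k (fps_X ^ k)"
  by (simp add: fps_degree_le_def fps_X_power_nth)

text \<open>Pascal's rule: multiplying by \<open>1 - fps_X\<close> lowers \<open>i\<close> by one
  and produces a factor \<open>fps_X\<close>. The value at \<open>m = 0\<close> is set to 0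
  explicitly, since \<open>(0 - 1) choose 0\<close> is 1 for natural numbers.\<close>

lemma binomial_fps:
  "Abs_fps (\<lambda>m. if m = 0 then 0 else int ((m - 1) choose i)) * (1 - fps_X) ^ Suc i = fps_X ^ Suc i"
proof (induction i)
  case 0
  show ?case
  proof (rule fps_ext)
    fix k
    show "fps_nth (Abs_fps (\<lambda>m. if m = 0 then 0 else int ((m - 1) choose 0)) * (1 - fps_X) ^ Suc 0)
        k = fps_nth (fps_X ^ Suc 0) k"
      by (simp add: fps_mult_1_minus_X_nth)
  qed
next
  case (Suc i)
  let ?B = "\<lambda>i. Abs_fps (\<lambda>m. if m = 0 then 0 else int ((m - 1) choose i))"
  have eq: "?B (Suc i) * (1 - fps_X) = fps_X * ?B i"
  proof (rule fps_ext)
    fix k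
    show "fps_nth (?B (Suc i) * (1 - fps_X)) k = fps_nth (fps_X * ?B i) k"
      unfolding fps_mult_1_minus_X_nth
    proof (cases k)
      case (Suc k')
      then show "fps_nth (?B (Suc i)) k - (if k = 0 then 0 else fps_nth (?B (Suc i)) (k - 1)) =
          fps_nth (fps_X * ?B i) k"
        by (cases k') simp_all
    qed simp
  qed
  have "?B (Suc i) * (1 - fps_X) ^ Suc (Suc i) = (?B (Suc i) * (1 - fps_X)) * (1 - fps_X) ^ Suc i"
    by (simp only: power_Suc[of _ "Suc i"] mult.assoc)
  also have "\<dots> = fps_X * (?B i * (1 - fps_X) ^ Suc i)" by (simp only: eq mult.assoc)
  also have "\<dots> = fps_X ^ Suc (Suc i)" by (simp only: Suc.IH power_Suc[of _ "Suc i"])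
  finally show ?case .
qed

text \<open>With \<open>n\<close> entries, the entry of index \<open>i\<close> contributes a
  multiple of \<open>fps_X ^ Suc i * (1 - fps_X) ^ (n - Suc i)\<close>, of degree \<open>n\<close>.
  This supplies the degree bound for the comparison of total Betti sums.\<close>

lemma fvector_hilbert_numerator:
  "fps_degree_le (length w) (Abs_fps (\<lambda>e. int (fvector_hilbert w e)) * (1 - fps_X) ^ length w)"
proof -
  let ?B = "\<lambda>i. Abs_fps (\<lambda>m. if m = 0 then 0 else int ((m - 1) choose i))" and ?n = "length w"
  have "Abs_fps (\<lambda>e. int (fvector_hilbert w e)) = 1 + (\<Sum>i<?n. fps_const (int (w ! i)) * ?B i)"
    by (rule fps_ext) (simp add: fvector_hilbert_def fps_sum_nth)
  then have "Abs_fps (\<lambda>e. int (fvector_hilbert w e)) * (1 - fps_X) ^ ?n =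
      (1 - fps_X) ^ ?n + (\<Sum>i<?n. fps_const (int (w ! i)) * (?B i * (1 - fps_X) ^ ?n))"
    by (simp add: distrib_right sum_distrib_right mult.assoc)
  also have "(\<Sum>i<?n. fps_const (int (w ! i)) * (?B i * (1 - fps_X) ^ ?n)) =
      (\<Sum>i<?n. fps_const (int (w ! i)) * (fps_X ^ Suc i * (1 - fps_X) ^ (?n - Suc i)))"
  proof (rule sum.cong[OF refl])
    fix i assume "i \<in> {..<?n}"
    then have "Suc i + (?n - Suc i) = ?n" by simp
    then have "(1 - fps_X :: int fps) ^ ?n = (1 - fps_X) ^ Suc i * (1 - fps_X) ^ (?n - Suc i)"
      by (simp only: power_add[symmetric])
    then show "fps_const (int (w ! i)) * (?B i * (1 - fps_X) ^ ?n) =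
        fps_const (int (w ! i)) * (fps_X ^ Suc i * (1 - fps_X) ^ (?n - Suc i))"
      unfolding binomial_fps[of i, symmetric] by (simp only: mult.assoc)
  qed
  finally have eq: "Abs_fps (\<lambda>e. int (fvector_hilbert w e)) * (1 - fps_X) ^ ?n = (1 - fps_X) ^ ?n +
      (\<Sum>i<?n. fps_const (int (w ! i)) * (fps_X ^ Suc i * (1 - fps_X) ^ (?n - Suc i)))" .
  have "fps_degree_le ?n (fps_X ^ Suc i * (1 - fps_X) ^ (?n - Suc i))" if "i < ?n" for i
  proof -
    have "Suc i + (?n - Suc i) = ?n" using that by simp
    then show ?thesis
      using fps_degree_le_mult[OF fps_degree_le_X_power[of "Suc i"] fps_degree_le_1_minus_X_power[of
          "?n - Suc i"]]
      by (simp only:)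
  qed
  then show ?thesis
    unfolding eq using fps_degree_le_1_minus_X_power[of ?n] by (simp add: fps_degree_le_def fps_sum_nth)
qed

text \<open>Such monomials are compositions of \<open>e\<close> into \<open>card \<sigma>\<close>
  positive parts. For the induction one power of a fixed vertex \<open>v\<close> is removed: either
  \<open>v\<close> leaves the support or it stays, which is Pascal's rule.\<close>

lemma card_monomials_with_support:
  assumes "\<sigma> \<subseteq> {1..n}"
  shows "card {m :: nat \<Rightarrow>\<^sub>0 nat. keys m = \<sigma> \<and> mdeg m = e} =
    (if \<sigma> = {} then (if e = 0 then 1 else 0) else if e = 0 then 0 else (e - 1) choose (card \<sigma> - 1))"
  using assms
proof (induction e arbitrary: \<sigma>)
  case 0
  have "{m :: nat \<Rightarrow>\<^sub>0 nat. keys m = \<sigma> \<and> mdeg m = 0} = (if \<sigma> = {} then {0} else {})"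
    by auto
  then show ?case by simp
next
  case (Suc e)
  let ?T = "\<lambda>\<sigma> e. {m :: nat \<Rightarrow>\<^sub>0 nat. keys m = \<sigma> \<and> mdeg m = e}"
  have finT: "finite (?T \<sigma> e)" if "\<sigma> \<subseteq> {1..n}" for \<sigma> e
    by (rule finite_subset[OF _ finite_monomials[of n e]]) (use that in auto)
  show ?case
  proof (cases "\<sigma> = {}")
    case True
    have "?T {} (Suc e) = {}" by auto
    then show ?thesis using True by simp
  next
    case False
    then obtain v where v: "v \<in> \<sigma>" by blast
    define \<rho> where "\<rho> = \<sigma> - {v}"
    have \<sigma>: "\<sigma> = insert v \<rho>" "v \<notin> \<rho>" using v by (auto simp: \<rho>_def)
    have \<rho>: "\<rho> \<subseteq> {1..n}" using Suc.prems by (auto simp: \<rho>_def)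
    have fin: "finite \<rho>" using \<rho> finite_subset by blast
    let ?f = "\<lambda>m. m + single v (1::nat)"
    have "?T \<sigma> (Suc e) = ?f ` (?T \<rho> e \<union> ?T \<sigma> e)"
    proof (intro equalityI subsetI)
      fix m assume m: "m \<in> ?T \<sigma> (Suc e)"
      let ?m = "m - single v 1"
      have eq: "m = ?f ?m" using minus_single_add[of m v] m v by (auto simp: in_keys_iff)
      have "mdeg m = mdeg ?m + 1" by (subst eq) (simp add: mdeg_add)
      moreover have "keys m = insert v (keys ?m)"
        by (subst eq) (simp add: keys_add_nat)
      ultimately have "?m \<in> ?T \<rho> e \<union> ?T \<sigma> e" using m \<sigma> by auto
      with eq show "m \<in> ?f ` (?T \<rho> e \<union> ?T \<sigma> e)" by blast
    next
      fix m assume "m \<in> ?f ` (?T \<rho> e \<union> ?T \<sigma> e)"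
      then obtain m' where m': "m' \<in> ?T \<rho> e \<union> ?T \<sigma> e" "m = ?f m'" by (rule imageE)
      have "keys m = insert v (keys m')" "mdeg m = mdeg m' + 1"
        by (simp_all add: m'(2) mdeg_add keys_add_nat)
      then show "m \<in> ?T \<sigma> (Suc e)" using m'(1) \<sigma>(1) by auto
    qed
    moreover have "inj_on ?f (?T \<rho> e \<union> ?T \<sigma> e)" by (simp add: inj_on_def)
    ultimately have "card (?T \<sigma> (Suc e)) = card (?T \<rho> e \<union> ?T \<sigma> e)" by (simp only: card_image)
    also have "\<dots> = card (?T \<rho> e) + card (?T \<sigma> e)"
      using \<sigma> by (intro card_Un_disjoint finT \<rho> Suc.prems) blast
    finally have rec: "card (?T \<sigma> (Suc e)) = card (?T \<rho> e) + card (?T \<sigma> e)" .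
    have c: "card \<sigma> = Suc (card \<rho>)" using \<sigma> fin by simp
    show ?thesis
    proof (cases "\<rho> = {}")
      case True
      then show ?thesis using rec Suc.IH[OF \<rho>] Suc.IH[OF Suc.prems] False c by simp
    next
      case nonempty: False
      then obtain k where k: "card \<rho> = Suc k" using fin by (cases "card \<rho>") auto
      show ?thesis
        using rec Suc.IH[OF \<rho>] Suc.IH[OF Suc.prems] False nonempty c k by (cases e) simp_all
    qed
  qed
qed

lemma face_idealD: "p \<in> face_ideal n \<Delta> \<Longrightarrow> m \<in> keys p \<Longrightarrow> keys m \<notin> \<Delta>"
  by (simp add: face_ideal_def)

text \<open>A form is reduced modulo the face ideal by dropping its monomials supported on nonfaces,
  so the monomials supported on faces give a residue basis.\<close>

lemma hilbert_function_face_ideal: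
  assumes \<Delta>: "down_closed \<Delta>"
  shows "hilbert_function n (face_ideal n \<Delta> :: 'k::field mpoly set) e =
    card {m. keys m \<subseteq> {1..n} \<and> keys m \<in> \<Delta> \<and> mdeg m = e}" (is "_ = card ?S")
proof -
  let ?L = "face_ideal n \<Delta> :: 'k mpoly set" and ?f = "\<lambda>m. single m (1::'k)"
  have L: "kp.subspace ?L" by (rule hideal_subspace[OF hideal_face_ideal[OF \<Delta>]])
  have fin: "finite ?S" by (rule finite_subset[OF _ finite_monomials[of n e]]) auto
  have inj: "inj_on ?f ?S"
    by (rule inj_onI) (metis keys_single singleton_inject zero_neq_one)
  have lk: "lookup (\<Sum>b\<in>?f ` ?S. single 0 (c b) * b) m = (if m \<in> ?S then c (?f m) else 0)"
    for c :: "'k mpoly \<Rightarrow> 'k" and m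
  proof -
    have "lookup (\<Sum>b\<in>?f ` ?S. single 0 (c b) * b) m =
        (\<Sum>m'\<in>?S. if m' = m then c (?f m') else 0)"
      unfolding sum.reindex[OF inj] lookup_sum
      by (rule sum.cong) (auto simp: mult_single lookup_single when_def)
    then show ?thesis using fin by (simp add: sum.delta)
  qed
  have "residue_basis n ?L e (?f ` ?S)"
  proof (rule residue_basisI[OF _ _ L])
    show "finite (?f ` ?S)" using fin by simp
    show "?f ` ?S \<subseteq> forms n e" by (auto simp: forms_iff)
  next
    fix p :: "'k mpoly" assume p: "p \<in> forms n e"
    let ?c = "\<lambda>b. lookup p (the_inv_into ?S ?f b)"
    have c: "?c (?f m) = lookup p m" if "m \<in> ?S" for m
      by (simp only: the_inv_into_f_f[OF inj that])
    have "p - (\<Sum>b\<in>?f ` ?S. single 0 (?c b) * b) \<in> ?L"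
      unfolding face_ideal_def
    proof (intro CollectI conjI ballI)
      have "(\<Sum>b\<in>?f ` ?S. single 0 (?c b) * b) \<in> forms n e"
        by (intro forms_sum kp.subspace_scale[OF subspace_forms]) (auto simp: forms_iff)
      then show "p - (\<Sum>b\<in>?f ` ?S. single 0 (?c b) * b) \<in> carrier (polyring n)"
        by (intro forms_carrier[OF forms_diff[OF p]])
    next
      fix m assume m: "m \<in> keys (p - (\<Sum>b\<in>?f ` ?S. single 0 (?c b) * b))"
      then have ne: "lookup p m \<noteq> (if m \<in> ?S then ?c (?f m) else 0)"
        by (simp only: in_keys_iff lookup_minus lk) simp
      then have "m \<notin> ?S" using c by auto
      moreover have "m \<in> keys p"
        using ne unfolding if_not_P[OF \<open>m \<notin> ?S\<close>] by (simp add: in_keys_iff)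
      ultimately show "keys m \<notin> \<Delta>" using p by (auto simp: forms_iff)
    qed
    then show "\<exists>c. p - (\<Sum>b\<in>?f ` ?S. single 0 (c b) * b) \<in> ?L" by (rule exI[of _ ?c])
  next
    fix c b assume c: "(\<Sum>b\<in>?f ` ?S. single 0 (c b) * b) \<in> ?L" and "b \<in> ?f ` ?S"
    then obtain m where m: "m \<in> ?S" "b = ?f m" by blast
    show "c b = 0"
    proof (rule ccontr)
      assume "c b \<noteq> 0"
      then have "m \<in> keys (\<Sum>b\<in>?f ` ?S. single 0 (c b) * b)"
        using m by (simp only: in_keys_iff lk) simp
      from face_idealD[OF c this] m(1) show False by simp
    qed
  qed
  from hilbert_function_eq[OF L this] show ?thesis by (simp only: card_image[OF inj])
qed

lemma simplicial_complexD:
  assumes "simplicial_complex n \<Delta>"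
  shows "down_closed \<Delta>" "\<Delta> \<subseteq> Pow {1..n}" "{} \<in> \<Delta>" "finite \<Delta>"
    and "\<sigma> \<in> \<Delta> \<Longrightarrow> finite \<sigma>" "\<sigma> \<in> \<Delta> \<Longrightarrow> card \<sigma> \<le> n" "v \<in> {1..n} \<Longrightarrow> {v} \<in> \<Delta>"
proof -
  show sub: "\<Delta> \<subseteq> Pow {1..n}" and "{} \<in> \<Delta>" "v \<in> {1..n} \<Longrightarrow> {v} \<in> \<Delta>"
    using assms by (auto simp: simplicial_complex_def)
  show "down_closed \<Delta>" by (rule simplicial_complex_down_closed[OF assms])
  show "finite \<Delta>" by (rule finite_subset[OF sub]) simp
  show "\<sigma> \<in> \<Delta> \<Longrightarrow> finite \<sigma>" using sub finite_subset by blast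
  show "\<sigma> \<in> \<Delta> \<Longrightarrow> card \<sigma> \<le> n" using sub card_mono[of "{1..n}" \<sigma>] by auto
qed

text \<open>Monomials are sorted by their support, and supports by cardinality. The empty face
  accounts for degree 0 alone, and the shift by one in \<open>card \<sigma> - 1\<close> matches the
  indexing of the f-vector.\<close>

lemma hilbert_function_stanley_reisner:
  assumes \<Delta>: "simplicial_complex n \<Delta>"
  shows "hilbert_function n (face_ideal n \<Delta> :: 'k::field mpoly set) = fvector_hilbert (fvector n \<Delta>)"
proof
  fix e
  note sc = simplicial_complexD[OF \<Delta>]
  let ?T = "\<lambda>\<sigma>. {m :: nat \<Rightarrow>\<^sub>0 nat. keys m = \<sigma> \<and> mdeg m = e}"
  have "{m. keys m \<subseteq> {1..n} \<and> keys m \<in> \<Delta> \<and> mdeg m = e} = (\<Union>\<sigma>\<in>\<Delta>. ?T \<sigma>)"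
    using sc(2) by auto
  moreover have "finite (?T \<sigma>)" if "\<sigma> \<in> \<Delta>" for \<sigma>
    by (rule finite_subset[OF _ finite_monomials[of n e]]) (use that sc(2) in auto)
  then have "card (\<Union>\<sigma>\<in>\<Delta>. ?T \<sigma>) = (\<Sum>\<sigma>\<in>\<Delta>. card (?T \<sigma>))"
    using sc(4) by (intro card_UN_disjoint) auto
  ultimately have h: "hilbert_function n (face_ideal n \<Delta> :: 'k mpoly set) e = (\<Sum>\<sigma>\<in>\<Delta>. card (?T \<sigma>))"
    using hilbert_function_face_ideal[OF sc(1), of n e, where 'k = 'k] by simp
  have sup: "card (?T \<sigma>) = (if \<sigma> = {} then (if e = 0 then 1 else 0) else if e =
      0 then 0 else (e - 1) choose (card \<sigma> - 1))"
    if "\<sigma> \<in> \<Delta>" for \<sigma>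
    using card_monomials_with_support[of \<sigma> n e] sc(2) that by blast
  show "hilbert_function n (face_ideal n \<Delta> :: 'k mpoly set) e = fvector_hilbert (fvector n \<Delta>) e"
  proof (cases "e = 0")
    case True
    have "(\<Sum>\<sigma>\<in>\<Delta>. card (?T \<sigma>)) = (\<Sum>\<sigma>\<in>\<Delta>. if \<sigma> = {} then 1 else 0)"
      using sup True by (intro sum.cong) simp_all
    then show ?thesis using h sc(3,4) True by (simp add: fvector_hilbert_def)
  next
    case False
    have "(\<Sum>\<sigma>\<in>\<Delta>. card (?T \<sigma>)) = (\<Sum>\<sigma>\<in>\<Delta>. if \<sigma> = {} then 0 else (e - 1) choose (card \<sigma> - 1))"
      using sup False by (intro sum.cong) simp_all
    also have "\<dots> = (\<Sum>\<sigma>\<in>\<Delta> - {{}}. (e - 1) choose (card \<sigma> - 1))"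
      using sc(4) by (intro sum.mono_neutral_cong_right) auto
    also have "\<dots> = (\<Sum>i<n. \<Sum>\<sigma>\<in>{\<sigma> \<in> \<Delta> - {{}}. card \<sigma> - 1 = i}. (e - 1) choose (card \<sigma> - 1))"
    proof (rule sum.group[symmetric])
      show "(\<lambda>\<sigma>. card \<sigma> - 1) ` (\<Delta> - {{}}) \<subseteq> {..<n}"
      proof (rule image_subsetI)
        fix \<sigma> assume "\<sigma> \<in> \<Delta> - {{}}"
        then have "0 < card \<sigma>" "card \<sigma> \<le> n" using sc(5,6)[of \<sigma>] by (auto simp: card_gt_0_iff)
        then show "card \<sigma> - 1 \<in> {..<n}" by simp
      qed
    qed (use sc(4) in auto)
    also have "\<dots> = (\<Sum>i<n. fvector n \<Delta> ! i * ((e - 1) choose i))"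
    proof (rule sum.cong[OF refl])
      fix i assume i: "i \<in> {..<n}"
      have "{\<sigma> \<in> \<Delta> - {{}}. card \<sigma> - 1 = i} = {\<sigma> \<in> \<Delta>. card \<sigma> = i + 1}"
      proof -
        have "\<sigma> \<noteq> {} \<and> card \<sigma> - 1 = i \<longleftrightarrow> card \<sigma> = i + 1" if "\<sigma> \<in> \<Delta>" for \<sigma>
          using sc(5)[OF that] card_gt_0_iff[of \<sigma>] by (cases "\<sigma> = {}") auto
        then show ?thesis by blast
      qed
      then have "(\<Sum>\<sigma>\<in>{\<sigma> \<in> \<Delta> - {{}}. card \<sigma> - 1 = i}. (e - 1) choose (card \<sigma> - 1)) =
          (\<Sum>\<sigma>\<in>{\<sigma> \<in> \<Delta>. card \<sigma> = i + 1}. (e - 1) choose i)"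
        by (intro sum.cong) auto
      then show "(\<Sum>\<sigma>\<in>{\<sigma> \<in> \<Delta> - {{}}. card \<sigma> - 1 = i}. (e - 1) choose (card \<sigma> - 1)) =
          fvector n \<Delta> ! i * ((e - 1) choose i)"
        using i by (simp add: fvector_def)
    qed
    finally show ?thesis using h False by (simp add: fvector_hilbert_def fvector_def)
  qed
qed

section \<open>The tree of coned \<open>f\<close>-vectors\<close>

lemma length_fvector [simp]: "length (fvector n \<Delta>) = n"
  by (simp add: fvector_def)

text \<open>Cardinality 0 and cardinalities above \<open>n\<close> are not recorded in the vector;
  there the counts are 1 and 0 for every complex.\<close>

lemma fvector_eq_iff:
  assumes "simplicial_complex n \<Delta>" "simplicial_complex n \<Gamma>" "fvector n \<Delta> = fvector n \<Gamma>"
  shows "card {\<sigma> \<in> \<Delta>. card \<sigma> = i} = card {\<sigma> \<in> \<Gamma>. card \<sigma> = i}"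
proof (cases i)
  case 0
  have "{\<sigma> \<in> \<Lambda>. card \<sigma> = 0} = {{}}" if "simplicial_complex n \<Lambda>" for \<Lambda>
    using simplicial_complexD(3,5)[OF that] by auto
  then show ?thesis using assms(1,2) 0 by simp
next
  case (Suc k)
  show ?thesis
  proof (cases "k < n")
    case True
    then show ?thesis using arg_cong[OF assms(3), of "\<lambda>w. w ! k"] Suc by (simp add: fvector_def)
  next
    case False
    have empty: "{\<sigma> \<in> \<Lambda>. card \<sigma> = i} = {}" if "simplicial_complex n \<Lambda>" for \<Lambda>
      using simplicial_complexD(6)[OF that] False Suc by fastforce
    show ?thesis unfolding empty[OF assms(1)] empty[OF assms(2)] ..
  qed
qed

lemma cone_iff: "\<tau> \<in> cone n p \<Delta> \<longleftrightarrow> \<tau> \<in> \<Delta> \<or> (\<exists>\<sigma>\<in>\<Delta>. card \<sigma> \<le> p \<and> \<tau> = insert (Suc n) \<sigma>)"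
  by (auto simp: cone_def)

lemma cone_if_remove:
  assumes "\<tau> - {Suc n} \<in> \<Delta>" "card (\<tau> - {Suc n}) \<le> p"
  shows "\<tau> \<in> cone n p \<Delta>"
proof (cases "Suc n \<in> \<tau>")
  case True
  then have "\<tau> = insert (Suc n) (\<tau> - {Suc n})" by blast
  then show ?thesis unfolding cone_iff using assms by blast
next
  case False
  then show ?thesis using assms(1) by (simp add: cone_iff)
qed

lemma card_faces_cone:
  assumes \<Delta>: "simplicial_complex n \<Delta>"
  shows "card {\<sigma> \<in> cone n p \<Delta>. card \<sigma> = Suc i} =
    card {\<sigma> \<in> \<Delta>. card \<sigma> = Suc i} + (if i \<le> p then card {\<sigma> \<in> \<Delta>. card \<sigma> = i} else 0)"
proof -
  note sc = simplicial_complexD[OF \<Delta>]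
  have N: "Suc n \<notin> \<sigma>" if "\<sigma> \<in> \<Delta>" for \<sigma> using subsetD[OF sc(2) that] by auto
  let ?A = "{\<sigma> \<in> \<Delta>. card \<sigma> = i \<and> i \<le> p}"
  have "{\<sigma> \<in> cone n p \<Delta>. card \<sigma> = Suc i} = {\<sigma> \<in> \<Delta>. card \<sigma> = Suc i} \<union> insert (Suc n) ` ?A"
  proof (intro equalityI subsetI)
    fix \<tau> assume "\<tau> \<in> {\<sigma> \<in> cone n p \<Delta>. card \<sigma> = Suc i}"
    then consider "\<tau> \<in> \<Delta>" "card \<tau> = Suc i" | \<sigma> where "\<tau> = insert (Suc n) \<sigma>" "\<sigma> \<in> \<Delta>" "card \<sigma> \<le> p"
        "card \<tau> = Suc i"
      by (auto simp: cone_def)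
    then show "\<tau> \<in> {\<sigma> \<in> \<Delta>. card \<sigma> = Suc i} \<union> insert (Suc n) ` ?A"
    proof cases
      case 2
      then have "card \<sigma> = i" using N[of \<sigma>] sc(5)[of \<sigma>] by simp
      then show ?thesis using 2 by blast
    qed blast
  next
    fix \<tau> assume "\<tau> \<in> {\<sigma> \<in> \<Delta>. card \<sigma> = Suc i} \<union> insert (Suc n) ` ?A"
    then show "\<tau> \<in> {\<sigma> \<in> cone n p \<Delta>. card \<sigma> = Suc i}"
      using N sc(5) by (auto simp: cone_def)
  qed
  moreover have "inj_on (insert (Suc n)) ?A"
    using N by (intro inj_onI) (metis (no_types, lifting) insert_ident mem_Collect_eq)
  moreover have "{\<sigma> \<in> \<Delta>. card \<sigma> = Suc i} \<inter> insert (Suc n) ` ?A = {}" using N by blast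
  ultimately have "card {\<sigma> \<in> cone n p \<Delta>. card \<sigma> = Suc i} = card {\<sigma> \<in> \<Delta>. card \<sigma> = Suc i} + card ?A"
    using sc(4) by (simp add: card_Un_disjoint card_image)
  then show ?thesis by simp
qed

text \<open>The counts in a cone are determined by the counts of the base. Since
  \<open>fvector_cone\<close> speaks of some complex with the given vector, this allows it to be
  replaced by any chosen one.\<close>

lemma fvector_cone_cong:
  assumes "simplicial_complex n \<Delta>" "simplicial_complex n \<Gamma>" "fvector n \<Delta> = fvector n \<Gamma>"
  shows "fvector (n + 1) (cone n p \<Delta>) = fvector (n + 1) (cone n p \<Gamma>)"
  using card_faces_cone[OF assms(1)] card_faces_cone[OF assms(2)] fvector_eq_iff[OF assms]
  by (simp add: fvector_def del: upt_Suc)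

lemma simplicial_complex_cone:
  assumes \<Delta>: "simplicial_complex n \<Delta>"
  shows "simplicial_complex (Suc n) (cone n p \<Delta>)"
proof -
  note sc = simplicial_complexD[OF \<Delta>]
  have "\<tau> \<in> cone n p \<Delta>" if \<sigma>: "\<sigma> \<in> cone n p \<Delta>" and \<tau>: "\<tau> \<subseteq> \<sigma>" for \<sigma> \<tau>
  proof (cases "\<sigma> \<in> \<Delta>")
    case True
    then show ?thesis using down_closedD[OF sc(1) _ \<tau>] by (auto simp: cone_def)
  next
    case False
    then obtain \<theta> where \<theta>: "\<theta> \<in> \<Delta>" "\<sigma> = insert (Suc n) \<theta>" "card \<theta> \<le> p" using \<sigma> by (auto simp: cone_def)
    have t: "\<tau> - {Suc n} \<subseteq> \<theta>" using \<theta>(2) \<tau> by blast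
    then have "\<tau> - {Suc n} \<in> \<Delta>" by (rule down_closedD[OF sc(1) \<theta>(1)])
    moreover have "card (\<tau> - {Suc n}) \<le> p" using card_mono[OF sc(5)[OF \<theta>(1)] t] \<theta>(3) by simp
    ultimately show ?thesis by (rule cone_if_remove)
  qed
  moreover have "cone n p \<Delta> \<subseteq> Pow {1..Suc n}"
    using sc(2) by (fastforce simp: cone_def)
  moreover have "{v} \<in> cone n p \<Delta>" if "v \<in> {1..Suc n}" for v
  proof (cases "v = Suc n")
    case True
    then show ?thesis using sc(3) by (auto simp: cone_def intro!: exI[of _ "{}"])
  next
    case False
    then show ?thesis using sc(7)[of v] that by (auto simp: cone_def)
  qed
  ultimately show ?thesis
    using sc(3) unfolding simplicial_complex_def by (auto simp: cone_def)
qed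

lemma face_ideal_infinite_cone:
  assumes \<Delta>: "simplicial_complex n \<Delta>"
  shows "face_ideal (Suc n) (cone n n \<Delta>) = face_ideal (Suc n) (full_cone (Suc n) \<Delta>)"
proof (rule face_ideal_cong)
  note sc = simplicial_complexD[OF \<Delta>]
  fix \<tau>
  have N: "Suc n \<notin> \<sigma>" if "\<sigma> \<in> \<Delta>" for \<sigma> using subsetD[OF sc(2) that] by auto
  show "\<tau> \<in> cone n n \<Delta> \<longleftrightarrow> \<tau> \<in> full_cone (Suc n) \<Delta>"
  proof
    assume "\<tau> \<in> cone n n \<Delta>"
    then show "\<tau> \<in> full_cone (Suc n) \<Delta>"
      using N by (auto simp: cone_def full_cone_def insert_Diff_if)
  next
    assume "\<tau> \<in> full_cone (Suc n) \<Delta>"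
    then have t: "\<tau> - {Suc n} \<in> \<Delta>" by (simp add: full_cone_def)
    then show "\<tau> \<in> cone n n \<Delta>" by (rule cone_if_remove) (rule sc(6)[OF t])
  qed
qed

text \<open>The same lists of degrees and the same differentials resolve the ideal over the larger
  ring, and the constant terms that decide minimality do not change.\<close>

lemma betti_infinite_cone:
  assumes \<Delta>: "simplicial_complex n \<Delta>"
  shows "graded_betti (Suc n) (face_ideal (Suc n) (cone n n \<Delta>) :: 'k::field mpoly set) i j =
      graded_betti n (face_ideal n \<Delta> :: 'k mpoly set) i j"
    and "betti (Suc n) (face_ideal (Suc n) (cone n n \<Delta>) :: 'k mpoly set) i =
      betti n (face_ideal n \<Delta> :: 'k mpoly set) i"
proof -
  note sc = simplicial_complexD[OF \<Delta>]
  let ?L = "face_ideal n \<Delta> :: 'k mpoly set"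
  have L: "hideal n ?L" by (rule hideal_face_ideal[OF sc(1)])
  have "1 \<notin> ?L" using sc(3) by (simp add: face_ideal_def)
  then obtain F d where F: "gres n ?L F (\<lambda>_. 1) d" "gmin F d" using minimal_resolution_exists[OF L]
      by blast
  note L' = hideal_face_ideal[OF down_closed_full_cone[OF sc(1)]] and F' = gres_full_cone[OF F(1) sc(1)]
  show "graded_betti (Suc n) (face_ideal (Suc n) (cone n n \<Delta>) :: 'k mpoly set) i j =
      graded_betti n ?L i j"
    unfolding face_ideal_infinite_cone[OF \<Delta>] graded_betti_eq[OF L F]
        by (rule graded_betti_eq[OF L' F' F(2)])
  show "betti (Suc n) (face_ideal (Suc n) (cone n n \<Delta>) :: 'k mpoly set) i = betti n ?L i"
    unfolding face_ideal_infinite_cone[OF \<Delta>] betti_eq[OF L F] by (rule betti_eq[OF L' F' F(2)])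
qed

lemma zero_cone_eq:
  assumes "simplicial_complex n \<Delta>"
  shows "cone n 0 \<Delta> = \<Delta> \<union> insert (Suc n) ` {{}}"
  using simplicial_complexD(3,5)[OF assms] by (auto simp: cone_def)

text \<open>The only face containing the isolated vertex is its singleton. All old vertices are
  faces, so the new minimal nonfaces are the edges from the isolated vertex to them.\<close>

lemma minimal_nonfaces_zero_cone:
  assumes \<Delta>: "simplicial_complex n \<Delta>"
  shows "minimal_nonfaces (Suc n) (cone n 0 \<Delta>) = minimal_nonfaces n \<Delta> \<union> (\<lambda>v. {v, Suc n}) ` {1..n}"
proof (intro equalityI subsetI)
  note sc = simplicial_complexD[OF \<Delta>]
  have N: "Suc n \<notin> \<sigma>" if "\<sigma> \<in> \<Delta>" for \<sigma> using subsetD[OF sc(2) that] by auto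
  have C: "\<tau> \<in> cone n 0 \<Delta> \<longleftrightarrow> \<tau> \<in> \<Delta> \<or> \<tau> = {Suc n}" for \<tau>
    unfolding zero_cone_eq[OF \<Delta>] by auto
  {
    fix \<sigma> assume \<sigma>: "\<sigma> \<in> minimal_nonfaces (Suc n) (cone n 0 \<Delta>)"
    then have s: "\<sigma> \<subseteq> {1..Suc n}" "\<sigma> \<notin> \<Delta>" "\<sigma> \<noteq> {Suc n}" "\<And>\<tau>. \<tau> \<subset> \<sigma> \<Longrightarrow> \<tau> \<in> \<Delta> \<or> \<tau> = {Suc n}"
      by (auto simp: minimal_nonfaces_def C)
    show "\<sigma> \<in> minimal_nonfaces n \<Delta> \<union> (\<lambda>v. {v, Suc n}) ` {1..n}"
    proof (cases "Suc n \<in> \<sigma>")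
      case True
      then obtain v where v: "v \<in> \<sigma>" "v \<noteq> Suc n" using s(3) by blast
      have "\<not> {v, Suc n} \<subset> \<sigma>"
      proof
        assume "{v, Suc n} \<subset> \<sigma>"
        from s(4)[OF this] N[of "{v, Suc n}"] v(2) show False by auto
      qed
      then have "\<sigma> = {v, Suc n}" using v(1) True by blast
      moreover have "v \<in> {1..n}" using v s(1) by fastforce
      ultimately show ?thesis by blast
    next
      case False
      then have "\<sigma> \<subseteq> {1..n}" using s(1) by (fastforce simp: le_Suc_eq)
      moreover have "\<tau> \<in> \<Delta>" if "\<tau> \<subset> \<sigma>" for \<tau> using s(4)[OF that] that False by auto
      ultimately show ?thesis using s(2) by (simp add: minimal_nonfaces_def)
    qed
  }
  fix \<sigma> assume "\<sigma> \<in> minimal_nonfaces n \<Delta> \<union> (\<lambda>v. {v, Suc n}) ` {1..n}"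
  then consider "\<sigma> \<in> minimal_nonfaces n \<Delta>" | v where "v \<in> {1..n}" "\<sigma> = {v, Suc n}" by blast
  then show "\<sigma> \<in> minimal_nonfaces (Suc n) (cone n 0 \<Delta>)"
  proof cases
    case 1
    then show ?thesis by (fastforce simp: minimal_nonfaces_def C)
  next
    case 2
    have "\<tau> \<in> \<Delta> \<or> \<tau> = {Suc n}" if "\<tau> \<subset> \<sigma>" for \<tau>
    proof -
      have "\<tau> = {} \<or> \<tau> = {v} \<or> \<tau> = {Suc n}" using that 2(2) by blast
      then show ?thesis using sc(3) sc(7)[OF 2(1)] by blast
    qed
    moreover have "\<sigma> \<notin> \<Delta>" "\<sigma> \<noteq> {Suc n}" "\<sigma> \<subseteq> {1..Suc n}" using N[of \<sigma>] 2 by auto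
    ultimately show ?thesis by (simp add: minimal_nonfaces_def C)
  qed
qed

text \<open>The increment \<open>n\<close> is the same for every complex on \<open>n\<close>
  vertices, which is what preserves the strict inequality at index 1.\<close>

lemma betti_1_zero_cone:
  assumes \<Delta>: "simplicial_complex n \<Delta>"
  shows "betti (Suc n) (face_ideal (Suc n) (cone n 0 \<Delta>) :: 'k::field mpoly set) 1 =
    betti n (face_ideal n \<Delta> :: 'k mpoly set) 1 + n"
proof -
  note sc = simplicial_complexD[OF \<Delta>] and sc' = simplicial_complexD[OF simplicial_complex_cone[OF \<Delta>,
      of 0]]
  have "inj_on (\<lambda>v. {v, Suc n}) {1..n}" by (auto simp: inj_on_def doubleton_eq_iff)
  then have "card ((\<lambda>v. {v, Suc n}) ` {1..n}) = n" by (simp add: card_image)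
  moreover have "minimal_nonfaces n \<Delta> \<inter> (\<lambda>v. {v, Suc n}) ` {1..n} = {}"
    by (auto simp: minimal_nonfaces_def)
  ultimately have "card (minimal_nonfaces (Suc n) (cone n 0 \<Delta>)) = card (minimal_nonfaces n \<Delta>) + n"
    unfolding minimal_nonfaces_zero_cone[OF \<Delta>] by (simp add: card_Un_disjoint finite_minimal_nonfaces)
  then show ?thesis
    using betti_1_face_ideal(1)[OF sc(1,3), of n, where 'k = 'k] betti_1_face_ideal(1)[OF sc'(1,3),
        of "Suc n", where 'k = 'k]
    by simp
qed

text \<open>The condition \<open>j > 0\<close> exempts the generator of \<open>F 0\<close>, where
  index and degree are both 0.\<close>

definition odd_betti :: "nat \<Rightarrow> 'k::field mpoly set \<Rightarrow> bool" where
  "odd_betti n L \<longleftrightarrow> (\<forall>i j. even (int j - int i) \<and> j > 0 \<longrightarrow> graded_betti n L i j = 0)"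

text \<open>
  In the resolution of the zero cone given by \<open>gres_partial_cone\<close> the only generator violating the
  parity condition is the one of index 1
      and degree 1; it does not survive in the minimal resolution, since
  the ideal contains no linear forms.
\<close>

lemma odd_betti_zero_cone:
  assumes \<Delta>: "simplicial_complex n \<Delta>" and odd: "odd_betti n (face_ideal n \<Delta> :: 'k::field mpoly set)"
  shows "odd_betti (Suc n) (face_ideal (Suc n) (cone n 0 \<Delta>) :: 'k mpoly set)"
  unfolding odd_betti_def
proof (intro allI impI, elim conjE)
  note sc = simplicial_complexD[OF \<Delta>] and sc' = simplicial_complexD[OF simplicial_complex_cone[OF \<Delta>,
      of 0]]
  fix i j assume ev: "even (int j - int i)" and j: "0 < j"
  let ?L = "face_ideal n \<Delta> :: 'k mpoly set" and ?L' = "face_ideal (Suc n) (cone n 0 \<Delta>) :: 'k mpoly set"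
  have L: "hideal n ?L" and L': "hideal (Suc n) ?L'" using hideal_face_ideal sc(1) sc'(1) by auto
  have one: "1 \<notin> ?L" "1 \<notin> ?L'" using sc(3) sc'(3) by (simp_all add: face_ideal_def)
  show "graded_betti (Suc n) ?L' i j = 0"
  proof (cases "i = 1 \<and> j = 1")
    case True
    \<comment> \<open>Every vertex is a face, hence no minimal nonface is a singleton and there are
      no linear generators.\<close>
    have "{\<sigma> \<in> minimal_nonfaces (Suc n) (cone n 0 \<Delta>). card \<sigma> = 1} = {}"
      using sc'(7) by (fastforce simp: minimal_nonfaces_def card_1_singleton_iff)
    then show ?thesis using betti_1_face_ideal(2)[OF sc'(1,3), of "Suc n" 1, where 'k = 'k] True
      by (metis card.empty)
  next
    case not11: False
    obtain F d where F: "gres n ?L F (\<lambda>_. 1) d" "gmin F d" "F 0 = [0]"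
      using minimal_resolution_exists[OF L one(1)] by blast
    obtain F' d' where F': "gres (Suc n) ?L' F' (\<lambda>_. 1) d'" "gmin F' d'"
      using minimal_resolution_exists[OF L' one(2)] by blast
    obtain K k dK where K: "gres n (face_ideal n {{}} :: 'k mpoly set) K k dK" "\<And>i. set (K i) \<subseteq> {i}"
      by (rule koszul_resolution[where n = n]) (rule that)
    have dc: "down_closed {{}}" by (auto simp: down_closed_def)
    obtain T h D where T: "gres (Suc n) (face_ideal (Suc n) (\<Delta> \<union> insert (Suc n) ` {{}}) :: 'k mpoly
        set) T h D"
      "T 0 = F 0 @ map Suc (K 0)" "\<And>i. T (Suc i) = F (Suc i) @ map Suc (F i) @ map Suc (K (Suc i))"
      by (rule gres_partial_cone[OF F(1) K(1) sc(1,2) dc]) (use sc(3) in auto)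
    have Fodd: "l \<notin> set (F a)" if "even (int l - int a)" "0 < l" for a l
      using odd that graded_betti_eq[OF L F(1,2), of a l] by (simp add: odd_betti_def count_list_0_iff)
    have "j \<notin> set (T i)"
    proof (cases i)
      case 0
      then show ?thesis using T(2) F(3) K(2)[of 0] ev j by auto
    next
      case (Suc a)
      have "j \<notin> set (F (Suc a))" using Fodd ev j Suc by simp
      moreover have "j \<notin> Suc ` set (F a)"
      proof
        assume "j \<in> Suc ` set (F a)"
        then obtain l where l: "j = Suc l" "l \<in> set (F a)" by blast
        \<comment> \<open>Shifting index and degree together keeps the parity, so only the exempt
          degree 0 is left; then \<open>a = 0\<close>, since degrees are at least the index, and
          this is the excluded position of index 1 and degree 1.\<close>
        have "l = 0" using Fodd[of l a] l ev Suc by auto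
        then have "a = 0" using gres_degree_ge[OF F] l(2) by (force simp: in_set_conv_nth)
        then show False using not11 l(1) \<open>l = 0\<close> Suc by simp
      qed
      \<comment> \<open>These generators have index \<open>Suc a\<close> and degree
        \<open>Suc (Suc a)\<close>, so the difference is 1.\<close>
      moreover have "j \<notin> Suc ` set (K (Suc a))" using K(2)[of "Suc a"] ev Suc by auto
      ultimately show ?thesis using T(3) Suc by simp
    qed
    then have "count_list (T i) j = 0" by (simp add: count_list_0_iff)
    \<comment> \<open>\<open>T\<close> may fail to be minimal; its counts bound those of the minimal
      resolution from above.\<close>
    then have "count_list (F' i) j = 0"
      using minimal_resolution_count_le[OF L' F' T(1)[folded zero_cone_eq[OF \<Delta>]], of i j] by simp
    then show ?thesis using graded_betti_eq[OF L' F'] by simp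
  qed
qed

text \<open>Each coning step is given by some complex with the right vector; its cone is replaced by
  the cones of the current pair, which have the same f-vector. The induction carries one complex
  with the parity condition and one with a smaller first Betti number.\<close>

lemma cone_tree_complexes:
  assumes "w \<in> cone_tree v" and \<Delta>: "simplicial_complex (length v) \<Delta>" "fvector (length v) \<Delta> = v"
    and \<Gamma>: "simplicial_complex (length v) \<Gamma>" "fvector (length v) \<Gamma> = v"
    and odd: "odd_betti (length v) (face_ideal (length v) \<Delta> :: 'k::field mpoly set)"
    and lt: "betti (length v) (face_ideal (length v) \<Gamma> :: 'k mpoly set) 1 <
      betti (length v) (face_ideal (length v) \<Delta> :: 'k mpoly set) 1"
  shows "\<exists>\<Delta> \<Gamma>. simplicial_complex (length w) \<Delta> \<and> fvector (length w) \<Delta> = w \<and>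
    simplicial_complex (length w) \<Gamma> \<and> fvector (length w) \<Gamma> = w \<and>
    odd_betti (length w) (face_ideal (length w) \<Delta> :: 'k mpoly set) \<and>
    betti (length w) (face_ideal (length w) \<Gamma> :: 'k mpoly set) 1 <
      betti (length w) (face_ideal (length w) \<Delta> :: 'k mpoly set) 1"
  using assms(1)
proof (induction rule: cone_tree.induct)
  case root
  then show ?case using assms by blast
next
  case (zero_cone u w)
  then obtain \<Delta> \<Gamma> \<Lambda> where
    d: "simplicial_complex (length u) \<Delta>" "fvector (length u) \<Delta> = u"
      "simplicial_complex (length u) \<Gamma>" "fvector (length u) \<Gamma> = u"
      "odd_betti (length u) (face_ideal (length u) \<Delta> :: 'k mpoly set)"
      "betti (length u) (face_ideal (length u) \<Gamma> :: 'k mpoly set) 1 <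
        betti (length u) (face_ideal (length u) \<Delta> :: 'k mpoly set) 1"
    and l: "simplicial_complex (length u) \<Lambda>" "fvector (length u) \<Lambda> = u"
      "w = fvector (length u + 1) (cone (length u) 0 \<Lambda>)"
    unfolding fvector_cone_def by blast
  have w: "length w = Suc (length u)" "w = fvector (length u + 1) (cone (length u) 0 \<Delta>)"
      "w = fvector (length u + 1) (cone (length u) 0 \<Gamma>)"
    using l fvector_cone_cong[OF l(1) d(1), of 0] fvector_cone_cong[OF l(1) d(3), of 0] d(2,4)
        by simp_all
  show ?case
    unfolding w(1)
    using simplicial_complex_cone[OF d(1)] simplicial_complex_cone[OF d(3)] w(2,3)
        odd_betti_zero_cone[OF d(1,5)] d(6)
    by (intro exI[of _ "cone (length u) 0 \<Delta>"] exI[of _ "cone (length u) 0 \<Gamma>"])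
      (simp add: betti_1_zero_cone[OF d(1)] betti_1_zero_cone[OF d(3),
          simplified] betti_1_zero_cone[OF d(1), simplified])
next
  case (full_cone u w)
  then obtain \<Delta> \<Gamma> \<Lambda> where
    d: "simplicial_complex (length u) \<Delta>" "fvector (length u) \<Delta> = u"
      "simplicial_complex (length u) \<Gamma>" "fvector (length u) \<Gamma> = u"
      "odd_betti (length u) (face_ideal (length u) \<Delta> :: 'k mpoly set)"
      "betti (length u) (face_ideal (length u) \<Gamma> :: 'k mpoly set) 1 <
        betti (length u) (face_ideal (length u) \<Delta> :: 'k mpoly set) 1"
    and l: "simplicial_complex (length u) \<Lambda>" "fvector (length u) \<Lambda> = u"
      "w = fvector (length u + 1) (cone (length u) (length u) \<Lambda>)"
    unfolding fvector_cone_def by blast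
  let ?n = "length u"
  have w: "length w = Suc ?n" "w = fvector (?n + 1) (cone ?n ?n \<Delta>)" "w =
      fvector (?n + 1) (cone ?n ?n \<Gamma>)"
    using l fvector_cone_cong[OF l(1) d(1), of ?n] fvector_cone_cong[OF l(1) d(3), of ?n] d(2,4)
        by simp_all
  have "odd_betti (Suc ?n) (face_ideal (Suc ?n) (cone ?n ?n \<Delta>) :: 'k mpoly set)"
    using d(5) by (simp add: odd_betti_def betti_infinite_cone(1)[OF d(1)])
  then show ?case
    unfolding w(1)
    using simplicial_complex_cone[OF d(1)] simplicial_complex_cone[OF d(3)] w(2,3) d(6)
    by (intro exI[of _ "cone ?n ?n \<Delta>"] exI[of _ "cone ?n ?n \<Gamma>"])
      (simp add: betti_infinite_cone(2)[OF d(1)] betti_infinite_cone(2)[OF d(3)])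
qed

text \<open>A least element would agree with \<open>I\<close> at index 1 and be at most
  \<open>J\<close> there. The family \<open>X\<close> is arbitrary so that homogeneous ideals and
  squarefree monomial ideals are covered by the same argument.\<close>

lemma no_least_betti:
  fixes X :: "'k::field mpoly set set"
  assumes X: "\<And>L. L \<in> X \<Longrightarrow> hideal n L \<and> hilbert_function n L = fvector_hilbert w" and n: "n = length w"
    and IJ: "I \<in> X" "J \<in> X" "odd_betti n I" "betti n J 1 < betti n I 1"
  shows "\<not> (\<exists>b\<in>betti n ` X. \<forall>c\<in>betti n ` X. b \<le> c)"
proof
  assume "\<exists>b\<in>betti n ` X. \<forall>c\<in>betti n ` X. b \<le> c"
  then obtain L where L: "L \<in> X" "betti n L \<le> betti n I" "betti n L \<le> betti n J" using IJ(1,2) by blast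
  have "betti n L 1 = betti n I 1"
  proof (rule betti_eq_if_le[where H = "fvector_hilbert w"])
    show "fvector_hilbert w 0 = 1" by (simp add: fvector_hilbert_def)
    show "fps_nth (Abs_fps (\<lambda>e. int (fvector_hilbert w e)) * (1 - fps_X) ^ n) j = 0" if "n < j" for j
      using fvector_hilbert_numerator[of w] that n by (simp add: fps_degree_le_def)
    show "graded_betti n I i j = 0" if "even (int j - int i)" "j > 0" for i j
      using IJ(3) that by (simp add: odd_betti_def)
  qed (use X[OF L(1)] X[OF IJ(1)] L(2) in auto)
  moreover have "betti n L 1 \<le> betti n J 1" using L(3) by (simp add: le_fun_def)
  ultimately show False using IJ(4) by simp
qed

theorem lemma3p14:
  fixes I J :: "'k::field mpoly set" and \<Delta> \<Gamma> :: "nat set set"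
    and n k :: nat and v w :: "nat list"
  assumes "simplicial_complex n \<Delta>" and "I = stanley_reisner_ideal n \<Delta>" and "fvector n \<Delta> = v"
    and "simplicial_complex n \<Gamma>" and "J = stanley_reisner_ideal n \<Gamma>" and "fvector n \<Gamma> = v"
    and "betti n I 0 = betti n J 0"
    and "betti n I 1 > betti n J 1"
    and "betti n I k < betti n J k"
    and "\<forall>i>0. betti n I (k + i) \<le> betti n J (k + i)"
    and "\<forall>i j. even (int j - int i) \<and> j > 0 \<longrightarrow> graded_betti n I i j = 0"
    and "w \<in> cone_tree v"
  defines "B \<equiv> {betti (length w) L | L :: 'k mpoly set.
             homogeneous_ideal (length w) L \<and>
             hilbert_function (length w) L = fvector_hilbert w}"
    and "B' \<equiv> {betti (length w) L | L :: 'k mpoly set.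
             sqfree_monomial_ideal (length w) L \<and>
             hilbert_function (length w) L = fvector_hilbert w}"
  shows "\<not> (\<exists>b\<in>B. \<forall>c\<in>B. b \<le> c) \<and> \<not> (\<exists>b\<in>B'. \<forall>c\<in>B'. b \<le> c)"
proof -
  have len: "length v = n" using assms(3) by auto
  have SR: "stanley_reisner_ideal m \<Lambda> = (face_ideal m \<Lambda> :: 'k mpoly set)"
      if "simplicial_complex m \<Lambda>" for m \<Lambda>
    by (rule stanley_reisner_ideal_eq[OF simplicial_complex_down_closed[OF that]])
  have "odd_betti (length v) (face_ideal (length v) \<Delta> :: 'k mpoly set)"
      "betti (length v) (face_ideal (length v) \<Gamma> :: 'k mpoly set) 1 <
        betti (length v) (face_ideal (length v) \<Delta> :: 'k mpoly set) 1"
    using assms(8,11) SR[OF assms(1)] SR[OF assms(4)] len by (simp_all add: odd_betti_def assms(2,5))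
  from cone_tree_complexes[OF assms(12) _ _ _ _ this] assms(1,3,4,6) len obtain \<Delta>w \<Gamma>w
    where \<Delta>w: "simplicial_complex (length w) \<Delta>w" "fvector (length w) \<Delta>w = w"
      and \<Gamma>w: "simplicial_complex (length w) \<Gamma>w" "fvector (length w) \<Gamma>w = w"
      and odd: "odd_betti (length w) (face_ideal (length w) \<Delta>w :: 'k mpoly set)"
      and lt: "betti (length w) (face_ideal (length w) \<Gamma>w :: 'k mpoly set) 1 <
        betti (length w) (face_ideal (length w) \<Delta>w :: 'k mpoly set) 1"
    by auto
  let ?X = "{L :: 'k mpoly set. homogeneous_ideal (length w) L \<and> hilbert_function (length w) L =
      fvector_hilbert w}"
  let ?X' = "{L :: 'k mpoly set. sqfree_monomial_ideal (length w) L \<and> hilbert_function (length w) L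
      = fvector_hilbert w}"
  have H: "hilbert_function (length w) (face_ideal (length w) \<Lambda> :: 'k mpoly set) = fvector_hilbert w"
      "homogeneous_ideal (length w) (face_ideal (length w) \<Lambda> :: 'k mpoly set)"
      "sqfree_monomial_ideal (length w) (face_ideal (length w) \<Lambda> :: 'k mpoly set)"
    if "simplicial_complex (length w) \<Lambda>" "fvector (length w) \<Lambda> = w" for \<Lambda>
    using hilbert_function_stanley_reisner[OF that(1), where 'k = 'k] that(2)
      homogeneous_ideal_if_hideal[OF hideal_face_ideal face_ideal_subset]
          simplicial_complex_down_closed[OF that(1)]
      sqfree_monomial_ideal_stanley_reisner[of "length w" \<Lambda>, where 'a = 'k] SR[OF that(1)]
    by simp_all
  have "\<not> (\<exists>b\<in>betti (length w) ` ?X. \<forall>c\<in>betti (length w) ` ?X. b \<le> c)"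
    by (rule no_least_betti[OF _ refl _ _ odd lt])
      (use H[OF \<Delta>w] H[OF \<Gamma>w] hideal_if_homogeneous_ideal in auto)
  moreover have "\<not> (\<exists>b\<in>betti (length w) ` ?X'. \<forall>c\<in>betti (length w) ` ?X'. b \<le> c)"
    by (rule no_least_betti[OF _ refl _ _ odd lt])
      (use H[OF \<Delta>w] H[OF \<Gamma>w] sqfree_monomial_ideal_hideal in auto)
  moreover have "B = betti (length w) ` ?X" "B' = betti (length w) ` ?X'"
    by (auto simp: B_def B'_def)
  ultimately show ?thesis by simp
qed

end
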